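(* There exist absolute constants $c,C>0$ such that the following holds. Let $P\subseteq[0,1]^{2}$ be a set of $n$ independent uniformly random points in $[0,1]^{2}$, and let $G$ be either the box-Delaunay graph of $P$ or the Hasse diagram of $P$ (with respect to the coordinatewise partial order). Then, in each of these two cases, with high probability as $n\to\infty$, \[ \frac{c\log n}{\log\log n}\le\chi(G)\le \frac{C\log n}{\log\log n}\qquad\text{and}\qquad \frac{cn\log \log n}{\log n}\le \alpha(G)\le\frac{Cn\log \log n}{\log n}. \]
   Context: Logarithms are natural. "With high probability" (whp) means with probability $1-o(1)$ as $n\to\infty$. $\chi(G)$ is the chromatic number and $\alpha(G)$ the independence number of $G$. For a finite set $P\subseteq\mathbb R^{d}$, the box-Delaunay graph of $P$ is the graph on vertex set $P$ with an edge between distinct $p,q\in P$ whenever there is an axis-parallel box $B=[a_1,b_1]\times\dots\times[a_d,b_d]\subseteq\mathbb R^d$ with $B\cap P=\{p,q\}$. For a partially ordered set $(P,\preceq)$, its Hasse diagram is the graph on vertex set $P$ with an edge between distinct $p,q\in P$ whenever $p\preceq q$ and there is no $r\in P\setminus\{p,q\}$ with $p\preceq r\preceq q$. For $P\subseteq\mathbb R^d$, the coordinatewise partial order is: $p\preceq q$ if $p_i\le q_i$ for every coordinate $i$. *)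

theory Defs
  imports "HOL-Probability.Probability" "HOL-Library.Ramsey"
begin

text \<open>Simple graphs are pairs \<open>(V, E)\<close> with \<open>E\<close> a set of two-element subsets of \<open>V\<close>.\<close>

type_synonym 'a graph = "'a set \<times> 'a set set"

definition proper_coloring :: "'a graph \<Rightarrow> ('a \<Rightarrow> nat) \<Rightarrow> bool" where
  "proper_coloring G f \<longleftrightarrow> (\<forall>u\<in>fst G. \<forall>v\<in>fst G. {u, v} \<in> snd G \<longrightarrow> f u \<noteq> f v)"

text \<open>The following two numbers are meaningful only for graphs with finitely many vertices.\<close>

definition chromatic_number :: "'a graph \<Rightarrow> nat" where
  "chromatic_number G = (LEAST k. \<exists>f \<in> fst G \<rightarrow> {..<k}. proper_coloring G f)"

definition independence_number :: "'a graph \<Rightarrow> nat" where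
  "independence_number G = Max {card S | S. S \<subseteq> fst G \<and> indep S (snd G)}"

definition box_delaunay_graph :: "(real ^ 'd) set \<Rightarrow> (real ^ 'd) graph" where
  "box_delaunay_graph P =
     (P, {{p, q} | p q. p \<in> P \<and> q \<in> P \<and> p \<noteq> q \<and> (\<exists>a b. cbox a b \<inter> P = {p, q})})"

text \<open>On \<open>real ^ 'd\<close> the class order \<open>\<le>\<close> is the coordinatewise one (\<open>less_eq_vec_def\<close>).\<close>

definition hasse_diagram :: "'a::order set \<Rightarrow> 'a graph" where
  "hasse_diagram P =
     (P, {{p, q} | p q. p \<in> P \<and> q \<in> P \<and> p \<noteq> q \<and> p \<le> q \<and>
                        \<not> (\<exists>r \<in> P - {p, q}. p \<le> r \<and> r \<le> q)})"

text \<open>The joint law of \<open>n\<close> independent uniform points of the unit square; an outcome \<open>\<omega>\<close> lists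
  the points as \<open>\<omega> 0, \<dots>, \<omega> (n - 1)\<close>, which are almost surely distinct.\<close>

definition uniform_points :: "nat \<Rightarrow> (nat \<Rightarrow> real ^ 2) measure" where
  "uniform_points n = (\<Pi>\<^sub>M i\<in>{..<n}. uniform_measure lborel (cbox 0 1))"

lemma prob_space_uniform_points: "prob_space (uniform_points n)"
proof -
  have "(\<Prod>b\<in>(Basis :: (real ^ 2) set). (1 - 0) \<bullet> b) = 1"
    by (rule prod.neutral) (auto simp: Basis_vec_def inner_axis)
  then have "emeasure lborel (cbox 0 1 :: (real ^ 2) set) = 1"
    by (subst emeasure_lborel_cbox) (auto simp: Basis_vec_def inner_axis)
  then have "prob_space (uniform_measure lborel (cbox 0 1 :: (real ^ 2) set))"
    by (intro prob_space_uniform_measure) auto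
  then show ?thesis
    unfolding uniform_points_def by (intro prob_space_PiM)
qed

end

theory Submission
  imports Defs "HOL-Real_Asymp.Real_Asymp"
begin

text \<open>For points in general position the Hasse diagram is a subgraph of the box-Delaunay graph, so it
  suffices to bound the independence number of the former from above and the chromatic number of the
  latter from above.

  Independence number: if \<open>S\<close> is independent in the Hasse diagram, then the box of any two comparable
  points of \<open>S\<close> contains a point outside \<open>S\<close>. Fix the order of the points by their first
  coordinate and reveal the second coordinate digit by digit in base \<open>k\<^sup>2\<close>, with
  \<open>k \<approx> log n / log log n\<close> and \<open>|S| = m \<approx> n / k\<close>. A digit is revealed in two halves. The first half
  refines the cells given by the earlier digits; two points of \<open>S\<close> that become consecutive
  among the points of \<open>S\<close> in a refined cell, with \<open>g\<close> other points between them, then violate the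
  condition with probability of order \<open>1 / g\<close> in the second half. Since all scales
  of \<open>g\<close> up to \<open>k\<close> contribute equally, the expected sum of \<open>1 / (g + \<surd>k)\<close> has order \<open>m log k / k\<close>, and it
  is concentrated because it has small bounded differences. So a digit is survived with
  probability at most \<open>exp (- const * m log k / k)\<close>, and as there are about \<open>log n / log k\<close> digits a fixed \<open>S\<close>
  is independent with probability at most \<open>exp (- const * m log n / k)\<close>, which beats the number of sets \<open>S\<close>.

  Chromatic number: the neighbours of a point in a quadrant form a staircase, whose size is a number of
  records of a random sequence, so all degrees are \<open>O(log n)\<close>. Neighbourhoods span only
  linearly many edges, and a graph with this property and maximum degree \<open>\<Delta>\<close> can be coloured with
  \<open>O(\<Delta> / log \<Delta>)\<close> colours by Rosenfeld's counting method.\<close>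


section \<open>Averages over finite product spaces\<close>

text \<open>Upper bounds suffice because chi(G) * alpha(G) \<ge> n. For alpha, the union bound over
  about exp (m log k) sets dictates the shape. Only about log n / log k digits are available, since
  the cells must still hold many points of \<open>S\<close>. With just those pairs of
  \<open>S\<close> that are consecutive before a refinement, a digit would be survived with
  probability about exp (- m / k), hence all of them with exp (- m log n / (k log k)); for k near
  log n / log log n this is only exp (- O(m)). The missing factor log k comes from the first half of
  a digit: it separates points at random, so points of \<open>S\<close> at every rank distance up to
  order \<open>k\<close> have a chance of order 1 / k to become consecutive. The weights 1 / (g +
  sqrt k) replace 1 / (g + 1) to make the change of one digit harmless while keeping the logarithm.
  Probabilities are averages over finitely many digit vectors; only \<open>prob_digits_le\<close>
  carries the bounds over to random points.\<close>

definition avg :: "'i set \<Rightarrow> nat \<Rightarrow> (('i \<Rightarrow> nat) \<Rightarrow> real) \<Rightarrow> real" where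
  "avg I K f = (\<Sum>u\<in>PiE I (\<lambda>_. {..<K}). f u) / real K ^ card I"

lemma avg_insert:
  assumes "finite I" "i \<notin> I"
  shows "avg (insert i I) K f = (\<Sum>a<K. avg I K (\<lambda>u. f (u(i := a)))) / real K"
proof -
  have "(\<Sum>u\<in>PiE (insert i I) (\<lambda>_. {..<K}). f u)
      = (\<Sum>(a, u)\<in>{..<K} \<times> PiE I (\<lambda>_. {..<K}). f (u(i := a)))"
    unfolding PiE_insert_eq
    by (subst sum.reindex[OF inj_combinator[OF assms(2)]]) (simp add: case_prod_unfold o_def)
  then show ?thesis
    using assms
    by (simp add: avg_def sum.cartesian_product[symmetric] sum_divide_distrib[symmetric] mult.commute)
qed

lemma avg_empty [simp]: "avg {} K f = f (\<lambda>_. undefined)"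
  by (simp add: avg_def)

lemma avg_mono:
  assumes "\<And>u. u \<in> PiE I (\<lambda>_. {..<K}) \<Longrightarrow> f u \<le> g u"
  shows "avg I K f \<le> avg I K g"
  unfolding avg_def by (intro divide_right_mono sum_mono assms) auto

lemma avg_cong:
  assumes "\<And>u. u \<in> PiE I (\<lambda>_. {..<K}) \<Longrightarrow> f u = g u"
  shows "avg I K f = avg I K g"
  unfolding avg_def using assms by simp

lemma avg_const [simp]: "finite I \<Longrightarrow> K > 0 \<Longrightarrow> avg I K (\<lambda>_. c) = c"
  by (simp add: avg_def card_PiE)

lemma avg_add: "avg I K (\<lambda>u. f u + g u) = avg I K f + avg I K g"
  by (simp add: avg_def sum.distrib add_divide_distrib)

lemma avg_diff: "avg I K (\<lambda>u. f u - g u) = avg I K f - avg I K g"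
  by (simp add: avg_def sum_subtractf diff_divide_distrib)

lemma avg_cmult: "avg I K (\<lambda>u. c * f u) = c * avg I K f"
  by (simp add: avg_def sum_distrib_left)

lemma avg_sum: "avg I K (\<lambda>u. \<Sum>j\<in>J. f j u) = (\<Sum>j\<in>J. avg I K (f j))"
  unfolding avg_def by (subst sum.swap) (simp add: sum_divide_distrib)

lemma avg_nonneg:
  assumes "\<And>u. u \<in> PiE I (\<lambda>_. {..<K}) \<Longrightarrow> 0 \<le> f u"
  shows "0 \<le> avg I K f"
  unfolding avg_def by (intro divide_nonneg_nonneg sum_nonneg assms) auto

text \<open>Fubini in one coordinate: the inner mean over \<open>q\<close> is a conditional
  expectation given the other coordinates, so probabilities conditional on them can be bounded
  pointwise.\<close>

lemma avg_resample:
  assumes "finite I" "q \<in> I" "K > 0"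
  shows "avg I K f = avg I K (\<lambda>u. (\<Sum>a<K. f (u(q := a))) / K)"
proof -
  define I' where "I' = I - {q}"
  have I': "I = insert q I'" "finite I'" "q \<notin> I'" using assms by (auto simp: I'_def)
  have *: "avg I' K (\<lambda>u. (\<Sum>a<K. f (u(q := a))) / K) = (\<Sum>a<K. avg I' K (\<lambda>u. f (u(q := a)))) / K"
    by (subst avg_sum[symmetric]) (simp add: avg_def sum_divide_distrib mult.commute)
  show ?thesis unfolding I'(1) avg_insert[OF I'(2,3)]
    using * assms(3) by simp
qed

section \<open>Independence of functions of disjoint sets of coordinates\<close>

definition depends_on :: "'i set \<Rightarrow> (('i \<Rightarrow> 'a) \<Rightarrow> 'b) \<Rightarrow> bool" where
  "depends_on J f \<longleftrightarrow> (\<forall>u v. (\<forall>i\<in>J. u i = v i) \<longrightarrow> f u = f v)"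

lemma depends_onD: "depends_on J f \<Longrightarrow> (\<And>i. i \<in> J \<Longrightarrow> u i = v i) \<Longrightarrow> f u = f v"
  by (auto simp: depends_on_def)

lemma depends_on_upd: "depends_on J f \<Longrightarrow> depends_on J (\<lambda>u. f (u(i := a)))"
  unfolding depends_on_def by simp

lemma depends_on_upd_irrelevant: "depends_on J f \<Longrightarrow> i \<notin> J \<Longrightarrow> f (u(i := a)) = f u"
  by (erule depends_onD) auto

text \<open>Induction over the coordinates. Each one lies outside \<open>J\<close> or outside
  \<open>J'\<close>, so one of the two factors does not see it and can be pulled out of the sum over
  its values.\<close>

lemma avg_mult_indep:
  assumes "finite I" "K > 0" "depends_on J f" "depends_on J' g" "J \<inter> J' = {}"
  shows "avg I K (\<lambda>u. f u * g u) = avg I K f * avg I K g"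
  using assms(1,3,4)
proof (induction I arbitrary: f g rule: finite_induct)
  case empty
  then show ?case by simp
next
  case (insert i I)
  let ?f = "\<lambda>a u. f (u(i := a))" and ?g = "\<lambda>a u. g (u(i := a))"
  have IH: "avg I K (\<lambda>u. ?f a u * ?g a u) = avg I K (?f a) * avg I K (?g a)" for a
    by (rule insert.IH) (intro depends_on_upd insert.prems)+
  show ?case
  proof (cases "i \<in> J")
    case True
    then have "?g a = g" for a
      using assms(5) insert.prems(2) by (intro ext depends_on_upd_irrelevant) auto
    then show ?thesis using IH assms(2) insert.hyps
      by (simp add: avg_insert sum_distrib_right[symmetric])
  next
    case False
    then have "?f a = f" for a
      using insert.prems(1) by (intro ext depends_on_upd_irrelevant) auto
    then show ?thesis using IH assms(2) insert.hyps
      by (simp add: avg_insert sum_distrib_left[symmetric])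
  qed
qed

lemma avg_prod_indep:
  assumes "finite I" "K > 0" "finite E" "\<And>e. e \<in> E \<Longrightarrow> depends_on (J e) (f e)" "disjoint_family_on J E"
  shows "avg I K (\<lambda>u. \<Prod>e\<in>E. f e u) = (\<Prod>e\<in>E. avg I K (f e))"
  using assms(3-5)
proof (induction E rule: finite_induct)
  case empty
  then show ?case using assms by simp
next
  case (insert e E)
  have "depends_on (\<Union>e\<in>E. J e) (\<lambda>u. \<Prod>e\<in>E. f e u)"
    unfolding depends_on_def
    by (intro allI impI prod.cong refl depends_onD[OF insert.prems(1)]) auto
  moreover have "J e \<inter> (\<Union>e\<in>E. J e) = {}"
    using insert.prems(2) insert.hyps by (auto simp: disjoint_family_on_def)
  moreover have "disjoint_family_on J E"
    using insert.prems(2) by (auto simp: disjoint_family_on_def)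
  ultimately show ?case using insert
    by (simp add: avg_mult_indep[OF assms(1,2), of "J e" "f e" "\<Union>e\<in>E. J e"])
qed

section \<open>Exponential moments under bounded differences\<close>

lemma exp_le_quadratic:
  fixes x :: real
  assumes "\<bar>x\<bar> \<le> 1"
  shows "exp x \<le> 1 + x + x\<^sup>2"
proof (cases "x \<ge> 0")
  case True
  then show ?thesis using assms exp_bound by auto
next
  case False
  define y where "y = - x"
  have y: "y > 0" "y \<le> 1" using False assms by (auto simp: y_def)
  have "1 + y + y\<^sup>2 / 2 \<le> exp y" using y exp_lower_Taylor_quadratic by auto
  \<comment> \<open>With y = - x the claim is 1 \<le> (1 - y + y ^ 2) * exp y; the second-order
    Taylor bound for exp y leaves a polynomial inequality.\<close>
  moreover have "1 \<le> (1 - y + y\<^sup>2) * (1 + y + y\<^sup>2 / 2)"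
  proof -
    have "(1 - y + y\<^sup>2) * (1 + y + y\<^sup>2 / 2) = 1 + y\<^sup>2 / 2 * (1 + y + y\<^sup>2)"
      by (simp add: field_simps power2_eq_square)
    then show ?thesis using y by auto
  qed
  moreover have "0 < 1 - y + y\<^sup>2" using y
    by (metis add_pos_pos add_nonneg_pos diff_ge_0_iff_ge zero_less_power)
  ultimately have "1 \<le> (1 - y + y\<^sup>2) * exp y"
    by (smt (verit, best) mult_left_mono)
  then have "exp (- y) \<le> 1 - y + y\<^sup>2"
    by (simp add: exp_minus field_simps)
  then show ?thesis by (simp add: y_def)
qed

text \<open>Each \<open>x a\<close> is within \<open>c\<close> of the mean, so the quadratic bound
  for exp applies; the linear terms cancel on averaging and the square costs at most
  \<open>c\<^sup>2\<close>.\<close>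

lemma mean_exp_bounded_diff:
  fixes x :: "nat \<Rightarrow> real"
  assumes "K > 0" "c \<le> 1" "\<And>a b. a < K \<Longrightarrow> b < K \<Longrightarrow> \<bar>x a - x b\<bar> \<le> c"
  shows "(\<Sum>a<K. exp (- x a)) / K \<le> exp (- ((\<Sum>a<K. x a) / K) + c\<^sup>2)"
proof -
  define m where "m = (\<Sum>a<K. x a) / K"
  have d: "\<bar>x a - m\<bar> \<le> c" if "a < K" for a
  proof -
    have "x a - m = (\<Sum>b<K. x a - x b) / K"
      using assms(1) by (simp add: m_def sum_subtractf field_simps)
    moreover have "\<bar>\<Sum>b<K. x a - x b\<bar> \<le> (\<Sum>b<K. c)"
      by (intro order.trans[OF sum_abs] sum_mono assms) (use that in auto)
    ultimately show ?thesis using assms(1) by (simp add: abs_divide pos_divide_le_eq mult.commute)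
  qed
  have "c \<ge> 0" using assms(3)[of 0 0] assms(1) by auto
  have "exp (- x a) \<le> exp (- m) * (1 - (x a - m) + c\<^sup>2)" if "a < K" for a
  proof -
    have "exp (- (x a - m)) \<le> 1 + (- (x a - m)) + (- (x a - m))\<^sup>2"
      by (rule exp_le_quadratic) (use d[OF that] assms(2) in auto)
    moreover have "(- (x a - m))\<^sup>2 \<le> c\<^sup>2" 
      using d[OF that] \<open>c \<ge> 0\<close> by (metis abs_le_square_iff abs_minus_cancel abs_of_nonneg)
    ultimately have "exp (- (x a - m)) \<le> 1 - (x a - m) + c\<^sup>2" by simp
    then have "exp (- m) * exp (- (x a - m)) \<le> exp (- m) * (1 - (x a - m) + c\<^sup>2)" 
      by (intro mult_left_mono) auto
    then show ?thesis by (simp add: mult_exp_exp)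
  qed
  then have "(\<Sum>a<K. exp (- x a)) \<le> (\<Sum>a<K. exp (- m) * (1 - (x a - m) + c\<^sup>2))"
    by (intro sum_mono) auto
  also have "\<dots> = exp (- m) * (K - ((\<Sum>a<K. x a) - K * m) + K * c\<^sup>2)"
    by (simp add: sum_distrib_left[symmetric] sum.distrib sum_subtractf)
  also have "(\<Sum>a<K. x a) - K * m = 0" using assms(1) by (simp add: m_def)
  finally have "(\<Sum>a<K. exp (- x a)) / K \<le> exp (- m) * (1 + c\<^sup>2)"
    using assms(1) by (simp add: field_simps)
  also have "\<dots> \<le> exp (- m) * exp (c\<^sup>2)" by (intro mult_left_mono) auto
  finally show ?thesis by (simp add: m_def mult_exp_exp)
qed

text \<open>The bounded differences inequality in Laplace transform form, one coordinate at a time: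
  the mean over the remaining coordinates changes by at most \<open>c i\<close> when coordinate
  \<open>i\<close> changes, so \<open>mean_exp_bounded_diff\<close> applies to it.\<close>

lemma avg_exp_bounded_diff:
  assumes "finite I" "K > 0" "\<And>i. i \<in> I \<Longrightarrow> c i \<le> 1"
    and "\<And>u i a b. u \<in> PiE I (\<lambda>_. {..<K}) \<Longrightarrow> i \<in> I \<Longrightarrow> a < K \<Longrightarrow> b < K \<Longrightarrow>
           \<bar>f (u(i := a)) - f (u(i := b))\<bar> \<le> c i"
  shows "avg I K (\<lambda>u. exp (- f u)) \<le> exp (- avg I K f + (\<Sum>i\<in>I. (c i)\<^sup>2))"
  using assms(1,3,4)
proof (induction I arbitrary: f rule: finite_induct)
  case empty
  then show ?case by simp
next
  case (insert i I)
  let ?f = "\<lambda>a u. f (u(i := a))"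
  have 1: "avg I K (\<lambda>u. exp (- ?f a u)) \<le> exp (- avg I K (?f a) + (\<Sum>i\<in>I. (c i)\<^sup>2))" if a: "a < K" for a
  proof (rule insert.IH)
    fix u j b b' assume *: "u \<in> PiE I (\<lambda>_. {..<K})" "j \<in> I" "b < K" "b' < K"
    have "i \<noteq> j" using * insert.hyps by auto
    have "u(i := a) \<in> PiE (insert i I) (\<lambda>_. {..<K})" using * a by (intro PiE_fun_upd) auto
    from insert.prems(2)[OF this, of j b b'] show "\<bar>?f a (u(j := b)) - ?f a (u(j := b'))\<bar> \<le> c j"
      unfolding fun_upd_twist[OF \<open>i \<noteq> j\<close>] using * by blast
  qed (use insert.prems in auto)
  have 2: "\<bar>avg I K (?f a) - avg I K (?f b)\<bar> \<le> c i" if "a < K" "b < K" for a b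
  proof -
    have "\<bar>?f a u - ?f b u\<bar> \<le> c i" if u: "u \<in> PiE I (\<lambda>_. {..<K})" for u
    proof -
      have "u(i := a) \<in> PiE (insert i I) (\<lambda>_. {..<K})" using u \<open>a < K\<close> by (intro PiE_fun_upd) auto
      from insert.prems(2)[OF this, of i a b] show ?thesis
        unfolding fun_upd_upd using \<open>a < K\<close> \<open>b < K\<close> by blast
    qed
    then have "avg I K (\<lambda>u. ?f a u - ?f b u) \<le> avg I K (\<lambda>_. c i)" "avg I K (\<lambda>u. ?f b u - ?f a u) \<le> avg I K (\<lambda>_. c i)"
      by (intro avg_mono; force simp: abs_le_iff)+
    then show ?thesis using insert.hyps assms(2) by (simp add: avg_diff abs_le_iff)
  qed
  have "avg (insert i I) K (\<lambda>u. exp (- f u)) \<le> (\<Sum>a<K. exp (- avg I K (?f a) + (\<Sum>i\<in>I. (c i)\<^sup>2))) / K"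
    unfolding avg_insert[OF insert.hyps] by (intro divide_right_mono sum_mono 1) auto
  also have "\<dots> = exp (\<Sum>i\<in>I. (c i)\<^sup>2) * ((\<Sum>a<K. exp (- avg I K (?f a))) / K)"
    by (simp only: exp_add sum_distrib_right[symmetric]) simp
  also have "\<dots> \<le> exp (\<Sum>i\<in>I. (c i)\<^sup>2) * exp (- ((\<Sum>a<K. avg I K (?f a)) / K) + (c i)\<^sup>2)"
    by (intro mult_left_mono mean_exp_bounded_diff assms(2) 2) (use insert.prems in auto)
  also have "\<dots> = exp (- avg (insert i I) K f + (\<Sum>i\<in>insert i I. (c i)\<^sup>2))"
    using insert.hyps by (simp add: avg_insert mult_exp_exp add_ac)
  finally show ?case .
qed


section \<open>Separated sets and matched pairs\<close>

text \<open>Given all other coordinates, \<open>u q\<close> is uniform and hits the value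
  \<open>u a\<close> with probability 1 / K; the factor \<open>F\<close> ignores coordinate
  \<open>q\<close> and is not affected.\<close>

lemma avg_agree:
  assumes "finite I" "q \<in> I" "a \<in> I" "a \<noteq> q" "K > 0" "\<And>u \<alpha>. F (u(q := \<alpha>)) = F u"
  shows "avg I K (\<lambda>u. F u * of_bool (u q = u a)) = avg I K F / K"
proof -
  have "avg I K (\<lambda>u. F u * of_bool (u q = u a))
      = avg I K (\<lambda>u. (\<Sum>\<alpha><K. F u * of_bool (\<alpha> = u a)) / K)"
    using assms(4,6) by (subst avg_resample[OF assms(1,2,5)]) simp
  also have "\<dots> = avg I K (\<lambda>u. (1 / K) * F u)"
  proof (rule avg_cong)
    fix u assume "u \<in> PiE I (\<lambda>_. {..<K})"
    then have "u a < K" using assms(3) by auto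
    then have "(\<Sum>\<alpha><K. F u * of_bool (\<alpha> = u a)) = F u"
      by (subst sum.remove[of _ "u a"]) auto
    then show "(\<Sum>\<alpha><K. F u * of_bool (\<alpha> = u a)) / K = (1 / K) * F u" by simp
  qed
  also have "\<dots> = avg I K F / K" by (subst avg_cmult) simp
  finally show ?thesis .
qed

text \<open>\<open>G\<close> stands for the points between \<open>a\<close> and \<open>b\<close>.
  Ask that \<open>v b\<close> exceeds \<open>v a\<close> by at most \<open>w\<close>, which has
  probability of order w / V. Given this, a point of \<open>G\<close> falls into the window with
  probability at most (w + 1) / V, so for \<open>w\<close> near V / (2 * (g + 1)) the union bound
  keeps at least half of the event. The term 1 / (2 * V) pays for rounding.\<close>

lemma avg_adjacent_pair_ge:
  assumes "finite I" "a \<in> I" "b \<in> I" "a \<noteq> b" "G \<subseteq> I - {a, b}" "V > 0"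
  shows "1 / (8 * (real (card G) + 1)) - 1 / (2 * real V)
    \<le> avg I V (\<lambda>v. of_bool (v a < v b \<and> (\<forall>q\<in>G. \<not> (v a \<le> v q \<and> v q \<le> v b))))"
proof -
  define g where "g = card G"
  \<comment> \<open>A closed window of length \<open>w\<close> has \<open>w + 1\<close> values,
    hence the subtraction. If it yields 0, the lower bound to be shown is not positive.\<close>
  define w where "w = V div (2 * (g + 1)) - 1"
  have finG: "finite G" using assms finite_subset by blast
  have quot: "real V / (2 * (real g + 1)) \<le> real (V div (2 * (g + 1))) + 1"
  proof -
    have "V < (V div N + 1) * N" if "N > 0" for N
      using dividend_less_div_times[OF that, of V] by (simp add: add.commute)
    from this[of "2 * (g + 1)"] have "real V < real ((V div (2 * (g + 1)) + 1) * (2 * (g + 1)))"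
      unfolding of_nat_less_iff by simp
    then have "real V \<le> (real (V div (2 * (g + 1))) + 1) * (2 * (real g + 1))"
      by (simp only: of_nat_mult of_nat_add of_nat_numeral of_nat_1)
    then show ?thesis by (simp add: pos_divide_le_eq add_pos_nonneg)
  qed
  show ?thesis
  proof (cases "w = 0")
    case True
    then have "real V / (2 * (real g + 1)) \<le> 2" using quot by (simp add: w_def)
    then have "1 / (8 * (real g + 1)) \<le> 1 / (2 * real V)"
      using assms(6) by (simp add: field_simps)
    moreover have "0 \<le> avg I V (\<lambda>v. of_bool (v a < v b \<and> (\<forall>q\<in>G. \<not> (v a \<le> v q \<and> v q \<le> v b))))"
      by (rule avg_nonneg) auto
    ultimately show ?thesis by (simp add: g_def)
  next
    case False
    then have w1: "w + 1 = V div (2 * (g + 1))" by (simp add: w_def)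
    have "(w + 1) * (2 * (g + 1)) \<le> V" unfolding w1 by (rule div_times_less_eq_dividend)
    then have wV: "real (w + 1) * (2 * (real g + 1)) \<le> V"
      using of_nat_mono[where 'a=real, of "(w + 1) * (2 * (g + 1))" V]
      by (simp only: of_nat_mult of_nat_add of_nat_numeral of_nat_1)
    then have wg: "real g * real (w + 1) \<le> V / 2" by (simp add: algebra_simps)
    have "real (w + 1) * 2 \<le> real (w + 1) * (2 * (real g + 1))" by (intro mult_left_mono) auto
    then have "real (2 * (w + 1)) \<le> real V" using wV by simp
    then have "2 * (w + 1) \<le> V" by (simp only: of_nat_le_iff)
    then have w2: "2 * w \<le> V" by (rule order.trans[rotated]) simp
    define X where "X = (\<lambda>v. of_bool (v a < v b \<and> v b \<le> v a + w) :: real)"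
    have X: "avg I V X \<ge> w / (2 * V)"
    proof -
      have "avg I V X = avg I V (\<lambda>v. (\<Sum>c<V. of_bool (v a < c \<and> c \<le> v a + w)) / V)"
        unfolding X_def using assms(4) by (subst avg_resample[OF assms(1,3,6)]) simp
      also have "\<dots> = (\<Sum>\<alpha><V. (\<Sum>c<V. of_bool (\<alpha> < c \<and> c \<le> \<alpha> + w)) / V) / V"
        by (subst avg_resample[OF assms(1,2,6)]) (use assms in simp)
      \<comment> \<open>Only starting values with the whole window below \<open>V\<close> are
        counted; as 2 * w \<le> V, they are at least half of all.\<close>
      also have "\<dots> \<ge> (\<Sum>\<alpha><V. if \<alpha> < V - w then w / V else 0) / V"
      proof (intro divide_right_mono sum_mono)
        fix \<alpha>
        show "(if \<alpha> < V - w then w / V else 0) \<le> (\<Sum>c<V. of_bool (\<alpha> < c \<and> c \<le> \<alpha> + w)) / real V"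
        proof (cases "\<alpha> < V - w")
          case True
          have "real w = (\<Sum>c\<in>{\<alpha><..\<alpha> + w}. of_bool (\<alpha> < c \<and> c \<le> \<alpha> + w))" by simp
          also have "\<dots> \<le> (\<Sum>c<V. of_bool (\<alpha> < c \<and> c \<le> \<alpha> + w))"
            using True by (intro sum_mono2) auto
          finally show ?thesis using True by (simp add: divide_right_mono)
        qed (simp add: sum_nonneg)
      qed simp
      also have "(\<Sum>\<alpha><V. if \<alpha> < V - w then w / V else 0) / V = real (V - w) * (w / V) / V"
      proof -
        have "{..<V} \<inter> {\<alpha>. \<alpha> < V - w} = {..<V - w}" by auto
        then show ?thesis by (simp add: sum.If_cases)
      qed
      finally have "real (V - w) * (w / V) / V \<le> avg I V X" .
      moreover have "w / (2 * V) = (real V / 2) * (w / V) / V" using assms(6) by simp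
      moreover have "(real V / 2) * (w / V) / V \<le> real (V - w) * (w / V) / V"
        using w2 by (intro divide_right_mono mult_right_mono) auto
      ultimately show ?thesis by linarith
    qed
    have q: "avg I V (\<lambda>v. X v * of_bool (v a \<le> v q \<and> v q \<le> v b)) \<le> real (w + 1) / V * avg I V X"
      if "q \<in> G" for q
    proof -
      have q: "q \<in> I" "q \<noteq> a" "q \<noteq> b" using that assms(5) by auto
      have "avg I V (\<lambda>v. X v * of_bool (v a \<le> v q \<and> v q \<le> v b))
          = avg I V (\<lambda>v. (\<Sum>c<V. X v * of_bool (v a \<le> c \<and> c \<le> v b)) / V)"
        using q by (subst avg_resample[OF assms(1) q(1) assms(6)]) (simp add: X_def)
      also have "\<dots> \<le> avg I V (\<lambda>v. real (w + 1) / V * X v)"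
      proof (rule avg_mono)
        fix v :: "'a \<Rightarrow> nat"
        have "(\<Sum>c<V. X v * of_bool (v a \<le> c \<and> c \<le> v b)) \<le> (w + 1) * X v"
        proof (cases "v a < v b \<and> v b \<le> v a + w")
          case True
          have "(\<Sum>c<V. of_bool (v a \<le> c \<and> c \<le> v b) :: real) = (\<Sum>c\<in>{..<V} \<inter> {v a..v b}. 1)"
            by (simp add: of_bool_def sum.If_cases Int_def conj_commute)
          also have "\<dots> \<le> card {v a..v b}" using card_mono[of "{v a..v b}" "{..<V} \<inter> {v a..v b}"] by simp
          also have "\<dots> \<le> w + 1" using True by simp
          finally show ?thesis using True by (simp add: X_def)
        qed (auto simp: X_def)
        then show "(\<Sum>c<V. X v * of_bool (v a \<le> c \<and> c \<le> v b)) / V \<le> real (w + 1) / V * X v"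
          using assms(6) by (simp add: divide_right_mono)
      qed
      finally show ?thesis by (simp only: avg_cmult)
    qed
    have "w / (4 * V) \<le> avg I V X / 2" using X by simp
    also have "\<dots> \<le> avg I V X - g * (real (w + 1) / V * avg I V X)"
    proof -
      have "real g * (real (w + 1) / V) \<le> 1 / 2" using wg assms(6) by (simp add: field_simps)
      moreover have "0 \<le> avg I V X" by (rule avg_nonneg) (simp add: X_def)
      ultimately have "real g * (real (w + 1) / V) * avg I V X \<le> 1 / 2 * avg I V X"
        by (rule mult_right_mono)
      then show ?thesis by (simp only: mult.assoc)
    qed
    also have "\<dots> \<le> avg I V X - (\<Sum>q\<in>G. avg I V (\<lambda>v. X v * of_bool (v a \<le> v q \<and> v q \<le> v b)))"
      using sum_mono[OF q, of G] by (simp add: g_def)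
    also have "\<dots> = avg I V (\<lambda>v. X v - (\<Sum>q\<in>G. X v * of_bool (v a \<le> v q \<and> v q \<le> v b)))"
      by (simp add: avg_diff avg_sum)
    also have "\<dots> \<le> avg I V (\<lambda>v. of_bool (v a < v b \<and> (\<forall>q\<in>G. \<not> (v a \<le> v q \<and> v q \<le> v b))))"
    proof (rule avg_mono)
      fix v
      show "X v - (\<Sum>q\<in>G. X v * of_bool (v a \<le> v q \<and> v q \<le> v b))
          \<le> of_bool (v a < v b \<and> (\<forall>q\<in>G. \<not> (v a \<le> v q \<and> v q \<le> v b)))"
      proof (cases "\<exists>q\<in>G. v a \<le> v q \<and> v q \<le> v b")
        case True
        then obtain q where q: "q \<in> G" "v a \<le> v q \<and> v q \<le> v b" by auto
        have "X v * of_bool (v a \<le> v q \<and> v q \<le> v b) \<le> (\<Sum>q\<in>G. X v * of_bool (v a \<le> v q \<and> v q \<le> v b))"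
          by (rule member_le_sum[OF q(1)]) (auto simp: X_def finG)
        then show ?thesis using q by simp
      next
        case False
        then have "(\<Sum>q\<in>G. X v * of_bool (v a \<le> v q \<and> v q \<le> v b)) = 0" by (intro sum.neutral) auto
        then show ?thesis using False by (auto simp: X_def)
      qed
    qed
    finally have "w / (4 * V) \<le> avg I V (\<lambda>v. of_bool (v a < v b \<and> (\<forall>q\<in>G. \<not> (v a \<le> v q \<and> v q \<le> v b))))" .
    moreover have "1 / (8 * (real g + 1)) - 1 / (2 * real V) \<le> w / (4 * V)"
    proof -
      have "real V / (2 * (real g + 1)) - 2 \<le> w" using quot w1 by linarith
      then have "(real V / (2 * (real g + 1)) - 2) / (4 * V) \<le> w / (4 * V)" by (intro divide_right_mono) auto
      moreover have "(real V / (2 * (real g + 1)) - 2) / (4 * V) = 1 / (8 * (real g + 1)) - 1 / (2 * real V)"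
        using assms(6) by (simp add: diff_divide_distrib)
      ultimately show ?thesis by simp
    qed
    ultimately show ?thesis by (simp add: g_def)
  qed
qed

text \<open>\<open>e\<close> is the cell of a point, given by the digits already revealed, and
  \<open>v\<close> its next digit. The inequalities for the blocking point are weak in
  \<open>v\<close>, since it may share a digit with an end; only so does the condition pass to
  prefixes in \<open>blocked_digits\<close>.\<close>

definition blocked :: "'i set \<Rightarrow> ('i \<Rightarrow> nat) \<Rightarrow> 'i set \<Rightarrow> ('i \<Rightarrow> 'c) \<Rightarrow> ('i \<Rightarrow> nat) \<Rightarrow> bool" where
  "blocked I x S e v \<longleftrightarrow> (\<forall>s\<in>S. \<forall>p\<in>S. x s < x p \<longrightarrow> e s = e p \<longrightarrow> v s < v p \<longrightarrow>
     (\<exists>q\<in>I - S. x s < x q \<and> x q < x p \<and> e q = e s \<and> v s \<le> v q \<and> v q \<le> v p))"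

definition gap :: "'i set \<Rightarrow> ('i \<Rightarrow> nat) \<Rightarrow> ('i \<Rightarrow> 'c) \<Rightarrow> 'i \<Rightarrow> 'i \<Rightarrow> 'i set" where
  "gap Z x e a b = {q \<in> Z. x a < x q \<and> x q < x b \<and> e q = e a}"

text \<open>The pairs of \<open>E\<close> together with their gaps are disjoint, so the events that
  they are not violated depend on disjoint coordinates and their probabilities multiply; 1 - y \<le>
  exp (- y) turns the product into a sum.\<close>

lemma avg_blocked_le:
  assumes "finite I" "S \<subseteq> I" "V > 0" "finite E"
    and E: "\<And>a b. (a, b) \<in> E \<Longrightarrow> a \<in> S \<and> b \<in> S \<and> x a < x b \<and> e a = e b"
    and disj: "disjoint_family_on (\<lambda>(a, b). {a, b} \<union> gap (I - S) x e a b) E"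
  shows "avg I V (\<lambda>v. of_bool (blocked I x S e v))
    \<le> exp (- (\<Sum>(a, b)\<in>E. 1 / (8 * (real (card (gap (I - S) x e a b)) + 1)) - 1 / (2 * real V)))"
proof -
  let ?G = "\<lambda>a b. gap (I - S) x e a b"
  define bad where "bad = (\<lambda>(a, b) v. v a < v b \<and> (\<forall>q\<in>?G a b. \<not> (v a \<le> v q \<and> v q \<le> (v b :: nat))))"
  have "avg I V (\<lambda>v. of_bool (blocked I x S e v)) \<le> avg I V (\<lambda>v. \<Prod>p\<in>E. 1 - of_bool (bad p v))"
  proof (rule avg_mono)
    fix v
    show "of_bool (blocked I x S e v) \<le> (\<Prod>p\<in>E. 1 - of_bool (bad p v) :: real)"
    proof (cases "blocked I x S e v")
      case True
      have "\<not> bad p v" if p: "p \<in> E" for p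
      proof -
        obtain a b where ab: "p = (a, b)" by fastforce
        have "a \<in> S" "b \<in> S" "x a < x b" "e a = e b" using E p ab by auto
        then show ?thesis using True unfolding blocked_def bad_def ab gap_def by fastforce
      qed
      then show ?thesis by simp
    qed (auto intro: prod_nonneg)
  qed
  also have "\<dots> = (\<Prod>p\<in>E. avg I V (\<lambda>v. 1 - of_bool (bad p v)))"
  proof (rule avg_prod_indep[OF assms(1,3,4) _ disj])
    fix p assume "p \<in> E"
    show "depends_on (case p of (a, b) \<Rightarrow> {a, b} \<union> ?G a b) (\<lambda>v. 1 - of_bool (bad p v) :: real)"
      unfolding depends_on_def bad_def by (auto simp: case_prod_unfold)
  qed
  also have "\<dots> \<le> (\<Prod>p\<in>E. exp (- (case p of (a, b) \<Rightarrow> 1 / (8 * (real (card (?G a b)) + 1)) - 1 / (2 * real V))))"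
  proof (intro prod_mono conjI)
    fix p assume p: "p \<in> E"
    obtain a b where ab: "p = (a, b)" by fastforce
    have minus_le_exp: "1 - y \<le> exp (- y)" for y :: real
      using exp_ge_add_one_self[of "- y"] by simp
    have *: "a \<in> I" "b \<in> I" "a \<noteq> b" "?G a b \<subseteq> I - {a, b}"
      using E[of a b] p ab assms(2) by (auto simp: gap_def)
    have "avg I V (\<lambda>v. 1 - of_bool (bad p v)) = 1 - avg I V (\<lambda>v. of_bool (bad p v))"
      using assms(1,3) by (simp add: avg_diff)
    also have "\<dots> \<le> 1 - (1 / (8 * (real (card (?G a b)) + 1)) - 1 / (2 * real V))"
      using avg_adjacent_pair_ge[OF assms(1) * assms(3)] by (simp add: bad_def ab)
    also have "\<dots> \<le> exp (- (1 / (8 * (real (card (?G a b)) + 1)) - 1 / (2 * real V)))"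
      by (rule minus_le_exp)
    finally show "avg I V (\<lambda>v. 1 - of_bool (bad p v))
        \<le> exp (- (case p of (a, b) \<Rightarrow> 1 / (8 * (real (card (?G a b)) + 1)) - 1 / (2 * real V)))"
      by (simp add: ab)
  qed (rule avg_nonneg, simp)
  also have "\<dots> = exp (- (\<Sum>(a, b)\<in>E. 1 / (8 * (real (card (?G a b)) + 1)) - 1 / (2 * real V)))"
    using assms(4) by (simp add: exp_sum[symmetric] sum_negf)
  finally show ?thesis .
qed

text \<open>\<open>c\<close> is the cell before and (c, u) the cell after a refinement
  \<open>u\<close>. A candidate in \<open>Prs\<close> becomes active when its ends stay together and
  no point of \<open>S\<close> separates them. Left ends come from \<open>A\<close> and right ends
  from \<open>B\<close>, so the right end of an active pair is never the left end of another one.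
  The summand \<open>T\<close> in the weights caps the influence of a single digit on
  \<open>R\<close>.\<close>

locale matched_pairs =
  fixes I S A B :: "'i set" and x :: "'i \<Rightarrow> nat" and c :: "'i \<Rightarrow> 'c" and Prs :: "('i \<times> 'i) set" and T :: real
  assumes finI: "finite I" and inj: "inj_on x I" and SI: "S \<subseteq> I"
    and AB: "A \<inter> B = {}" "A \<subseteq> S" "B \<subseteq> S"
    and Prs: "\<And>a b. (a, b) \<in> Prs \<Longrightarrow> a \<in> A \<and> b \<in> B \<and> x a < x b \<and> c a = c b"
    and T: "T \<ge> 1"
begin

text \<open>The set \<open>S'\<close> is a parameter because \<open>R_change_S\<close> compares
  \<open>S\<close> with \<open>S - {z}\<close>.\<close>

definition active :: "'i set \<Rightarrow> ('i \<Rightarrow> nat) \<Rightarrow> ('i \<times> 'i) set" where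
  "active S' u = {(a, b) \<in> Prs. a \<in> S' \<and> b \<in> S' \<and> u a = u b \<and>
     (\<forall>z\<in>S'. x a < x z \<longrightarrow> x z < x b \<longrightarrow> c z = c a \<longrightarrow> u z \<noteq> u a)}"

definition gp :: "('i \<Rightarrow> nat) \<Rightarrow> 'i \<times> 'i \<Rightarrow> 'i set" where
  "gp u = (\<lambda>(a, b). gap (I - S) x (\<lambda>i. (c i, u i)) a b)"

text \<open>Since T \<ge> 1, this is at most 1 / (g + 1), the order of the violation probability in
  \<open>avg_adjacent_pair_ge\<close>.\<close>

definition wt :: "('i \<Rightarrow> nat) \<Rightarrow> 'i \<times> 'i \<Rightarrow> real" where
  "wt u p = 1 / (card (gp u p) + T)"

definition R :: "('i \<Rightarrow> nat) \<Rightarrow> real" where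
  "R u = (\<Sum>p\<in>active S u. wt u p)"

lemma finite_Prs: "finite Prs"
proof (rule finite_subset)
  show "Prs \<subseteq> I \<times> I"
  proof
    fix p assume "p \<in> Prs"
    then show "p \<in> I \<times> I" using Prs[of "fst p" "snd p"] AB SI by (cases p) auto
  qed
qed (use finI in auto)

lemma finite_active [simp]: "finite (active S' u)"
  by (rule finite_subset[OF _ finite_Prs]) (auto simp: active_def)

lemma finite_gp [simp]: "finite (gp u p)"
  using finI by (auto simp: gp_def gap_def case_prod_unfold)

lemma wt_bounds: "0 \<le> wt u p" "wt u p \<le> 1 / T"
  using T by (auto simp: wt_def frac_le)

lemma active_cong:
  assumes "\<And>i. i \<in> S' \<Longrightarrow> u i = v i"
  shows "active S' u = active S' v"
  by (auto simp: active_def assms)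

text \<open>If x a' < x a \<le> w \<le> x b', then \<open>a\<close> is a point of \<open>S'\<close>
  in the same refined cell strictly between the ends of (a', b'), contradicting activity; equality
  of \<open>a\<close> and \<open>b'\<close> is excluded as \<open>A\<close> and \<open>B\<close> are
  disjoint. With equal left ends, the nearer right end would separate the other pair.\<close>

lemma active_unique:
  assumes "S' \<subseteq> S" "(a, b) \<in> active S' u" "(a', b') \<in> active S' u" "c a = c a'" "u a = u a'"
    and "x a \<le> w" "w \<le> x b" "x a' \<le> w" "w \<le> x b'"
  shows "a = a' \<and> b = b'"
proof -
  have first: "x a \<le> x a'" if H: "(a, b) \<in> active S' u" "(a', b') \<in> active S' u" "c a = c a'" "u a = u a'"
    "w \<le> x b'" "x a \<le> w" for a b a' b'
  proof (rule ccontr)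
    assume "\<not> x a \<le> x a'"
    then have lt: "x a' < x a" by simp
    have m: "a \<in> A" "b' \<in> B" "a \<in> S'" "b' \<in> S'" "a \<in> I" "b' \<in> I"
      using H Prs AB SI \<open>S' \<subseteq> S\<close> by (auto simp: active_def)
    then have "x a \<noteq> x b'" using inj_onD[OF inj] AB by blast
    then have "x a < x b'" using H by auto
    then have "u a \<noteq> u a'" using lt m H(2,3) by (auto simp: active_def)
    then show False using H by simp
  qed
  have "x a = x a'" using first[of a b a' b'] first[of a' b' a b] assms by auto
  moreover have m: "a \<in> I" "a' \<in> I" "b \<in> I" "b' \<in> I" "b \<in> S'" "b' \<in> S'" "u b = u a" "u b' = u a'"
    "x a < x b" "x a' < x b'" "c a = c b" "c a' = c b'"
  proof -
    have "(a, b) \<in> Prs" "(a', b') \<in> Prs" and *: "a \<in> S'" "a' \<in> S'" "b \<in> S'" "b' \<in> S'" "u b = u a" "u b' = u a'"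
      using assms(2,3) by (auto simp: active_def)
    then show "x a < x b" "x a' < x b'" "c a = c b" "c a' = c b'" using Prs by auto
    show "b \<in> S'" "b' \<in> S'" "u b = u a" "u b' = u a'" by fact+
    show "a \<in> I" "a' \<in> I" "b \<in> I" "b' \<in> I" using * assms(1) SI by auto
  qed
  ultimately have a: "a = a'" using inj_onD[OF inj] by blast
  have "\<not> x b < x b'" using assms(2,3,4,5) m a by (auto simp: active_def)
  moreover have "\<not> x b' < x b" using assms(2,3,4,5) m a by (auto simp: active_def)
  ultimately have "b = b'" using inj_onD[OF inj] m by (metis linorder_neqE_nat)
  with a show ?thesis by simp
qed

lemma card_active_le: "card (active S u) \<le> card S"
proof (rule card_inj_on_le)
  show "inj_on fst (active S u)"
  proof (rule inj_onI)
    fix p p' assume *: "p \<in> active S u" "p' \<in> active S u" "fst p = fst p'"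
    obtain a b a' b' where ab: "p = (a, b)" "p' = (a', b')" by fastforce
    then have "x a < x b" "x a' < x b'" using * Prs by (auto simp: active_def)
    then have "a = a' \<and> b = b'" using * ab by (intro active_unique[of S _ _ u _ _ "x a"]) auto
    then show "p = p'" using ab by simp
  qed
  show "fst ` active S u \<subseteq> S" by (auto simp: active_def)
  show "finite S" using finI SI finite_subset by blast
qed

lemma active_disjoint:
  "disjoint_family_on (\<lambda>(a, b). {a, b} \<union> gap (I - S) x (\<lambda>i. (c i, u i)) a b) (active S u)"
proof (unfold disjoint_family_on_def, intro ballI impI, rule ccontr)
  fix p p' assume *: "p \<in> active S u" "p' \<in> active S u" "p \<noteq> p'"
    and "(case p of (a, b) \<Rightarrow> {a, b} \<union> gap (I - S) x (\<lambda>i. (c i, u i)) a b)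
      \<inter> (case p' of (a, b) \<Rightarrow> {a, b} \<union> gap (I - S) x (\<lambda>i. (c i, u i)) a b) \<noteq> {}"
  moreover obtain a b a' b' where ab: "p = (a, b)" "p' = (a', b')" by fastforce
  ultimately obtain w where w: "w \<in> {a, b} \<union> gap (I - S) x (\<lambda>i. (c i, u i)) a b"
    "w \<in> {a', b'} \<union> gap (I - S) x (\<lambda>i. (c i, u i)) a' b'" by auto
  have h: "x a < x b" "x a' < x b'" "c a = c b" "c a' = c b'" "u a = u b" "u a' = u b'"
    using * Prs ab by (auto simp: active_def)
  have "x a \<le> x w \<and> x w \<le> x b \<and> c w = c a \<and> u w = u a" using w(1) h by (auto simp: gap_def)
  moreover have "x a' \<le> x w \<and> x w \<le> x b' \<and> c w = c a' \<and> u w = u a'" using w(2) h by (auto simp: gap_def)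
  ultimately have "a = a' \<and> b = b'" using * ab by (intro active_unique[of S _ _ u _ _ "x w"]) auto
  then show False using * ab by simp
qed

text \<open>The source of the bounded differences: one point can affect only active pairs whose
  interval contains it.\<close>

lemma card_le_one_pairs:
  assumes "Q \<subseteq> active S' u" "S' \<subseteq> S"
    and "\<And>a b. (a, b) \<in> Q \<Longrightarrow> x a \<le> x z \<and> x z \<le> x b \<and> c z = c a \<and> u z = u a"
  shows "card Q \<le> 1"
proof -
  have "p = p'" if "p \<in> Q" "p' \<in> Q" for p p'
  proof -
    obtain a b a' b' where ab: "p = (a, b)" "p' = (a', b')" by fastforce
    have 1: "x a \<le> x z \<and> x z \<le> x b \<and> c z = c a \<and> u z = u a" using assms(3)[of a b] that ab by simp
    have 2: "x a' \<le> x z \<and> x z \<le> x b' \<and> c z = c a' \<and> u z = u a'" using assms(3)[of a' b'] that ab by simp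
    have "(a, b) \<in> active S' u" "(a', b') \<in> active S' u" using that ab assms(1) by auto
    then have "a = a' \<and> b = b'" using 1 2 assms(2) by (intro active_unique[of S' _ _ u _ _ "x z"]) auto
    with ab show ?thesis by simp
  qed
  then show ?thesis by (metis card.infinite card_le_Suc0_iff_eq One_nat_def zero_le)
qed

lemma sum_wt_le_one_pair:
  assumes "finite Q" "card Q \<le> 1" "\<And>p. p \<in> Q \<Longrightarrow> f p \<le> d" "0 \<le> d"
  shows "sum f Q \<le> (d :: real)"
proof -
  have "sum f Q \<le> card Q * d" using assms(3) by (intro sum_bounded_above) auto
  also have "\<dots> \<le> 1 * d" using assms(2,4) by (intro mult_right_mono) auto
  finally show ?thesis by simp
qed

text \<open>Both values are compared with the sum for \<open>S - {z}\<close>. Deleting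
  \<open>z\<close> removes at most one active pair, that with end \<open>z\<close>, and creates at
  most one, whose ends \<open>z\<close> separated; each has weight at most 1 / T.\<close>

lemma R_change_S:
  assumes "z \<in> S"
  shows "\<bar>R (u(z := \<alpha>)) - R (u(z := \<beta>))\<bar> \<le> 2 / T"
proof -
  define R0 where "R0 = (\<lambda>u. \<Sum>p\<in>active (S - {z}) u. wt u p)"
  have "R0 (u(z := \<alpha>)) = R0 (u(z := \<beta>))"
  proof -
    have "active (S - {z}) (u(z := \<alpha>)) = active (S - {z}) (u(z := \<beta>))"
      by (intro active_cong) auto
    moreover have "wt (u(z := \<alpha>)) p = wt (u(z := \<beta>)) p" if "p \<in> active (S - {z}) (u(z := \<beta>))" for p
    proof -
      have "gp (u(z := \<alpha>)) p = gp (u(z := \<beta>)) p"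
        using that assms by (auto simp: gp_def gap_def active_def)
      then show ?thesis by (simp add: wt_def)
    qed
    ultimately show ?thesis unfolding R0_def by (intro sum.cong) auto
  qed
  moreover have "\<bar>R u - R0 u\<bar> \<le> 1 / T" for u
  proof -
    define En where "En = {(a, b) \<in> active S u. a = z \<or> b = z}"
    define Bl where "Bl = {(a, b) \<in> active (S - {z}) u. x a < x z \<and> x z < x b \<and> c z = c a \<and> u z = u a}"
    have ab: "x a < x b \<and> c a = c b \<and> u a = u b" if "(a, b) \<in> active S u" for a b
      using that Prs by (auto simp: active_def)
    have fin: "finite En" "finite Bl" by (auto simp: En_def Bl_def intro: finite_subset[OF _ finite_active])
    have "card En \<le> 1" by (rule card_le_one_pairs[of _ S u z]) (use ab in \<open>auto simp: En_def dest: less_imp_le\<close>)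
    then have E: "sum (wt u) En \<le> 1 / T" by (intro sum_wt_le_one_pair fin wt_bounds) (use T in auto)
    have "card Bl \<le> 1" by (rule card_le_one_pairs[of _ "S - {z}" u z]) (auto simp: Bl_def)
    then have B: "sum (wt u) Bl \<le> 1 / T" by (intro sum_wt_le_one_pair fin wt_bounds) (use T in auto)
    have eq: "active S u - En = active (S - {z}) u - Bl"
      using assms by (auto simp: active_def En_def Bl_def)
    have "En \<subseteq> active S u" "Bl \<subseteq> active (S - {z}) u" by (auto simp: En_def Bl_def)
    then have "R u = sum (wt u) En + sum (wt u) (active S u - En)"
      "R0 u = sum (wt u) Bl + sum (wt u) (active (S - {z}) u - Bl)"
      unfolding R_def R0_def by (simp_all add: sum.subset_diff)
    moreover have "0 \<le> sum (wt u) En" "0 \<le> sum (wt u) Bl" by (intro sum_nonneg wt_bounds)+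
    ultimately show ?thesis using E B eq by (simp add: abs_le_iff)
  qed
  from this[of "u(z := \<alpha>)"] this[of "u(z := \<beta>)"]
  have "\<bar>R (u(z := \<alpha>)) - R0 (u(z := \<alpha>))\<bar> \<le> 1 / T" "\<bar>R (u(z := \<beta>)) - R0 (u(z := \<beta>))\<bar> \<le> 1 / T" .
  ultimately show ?thesis by (simp add: abs_le_iff)
qed

text \<open>\<open>q\<close> lies in the gap of at most one active pair. Adding it to that gap
  changes the weight from 1 / y to 1 / (y + 1) with y \<ge> T, that is, by at most
  \<open>1 / T\<^sup>2\<close>.\<close>

lemma R_change_Q:
  assumes "q \<in> I - S"
  shows "\<bar>R (u(q := \<alpha>)) - R (u(q := \<beta>))\<bar> \<le> 1 / T\<^sup>2"
proof -
  define R0 where "R0 = (\<lambda>u. \<Sum>p\<in>active S u. 1 / (card (gp u p - {q}) + T))"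
  have "R0 (u(q := \<alpha>)) = R0 (u(q := \<beta>))"
  proof -
    have "active S (u(q := \<alpha>)) = active S (u(q := \<beta>))"
      using assms by (intro active_cong) auto
    moreover have "gp (u(q := \<alpha>)) p - {q} = gp (u(q := \<beta>)) p - {q}" if "p \<in> active S (u(q := \<beta>))" for p
      using that assms by (auto simp: gp_def gap_def active_def)
    ultimately show ?thesis unfolding R0_def by (intro sum.cong) auto
  qed
  moreover have "0 \<le> R0 u - R u \<and> R0 u - R u \<le> 1 / T\<^sup>2" for u
  proof -
    define Q where "Q = {p \<in> active S u. q \<in> gp u p}"
    define f where "f = (\<lambda>p. 1 / (card (gp u p - {q}) + T) - wt u p)"
    have f: "0 \<le> f p \<and> f p \<le> 1 / T\<^sup>2" if "q \<in> gp u p" for p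
    proof -
      define y where "y = card (gp u p - {q}) + T"
      have y: "y \<ge> T" by (simp add: y_def)
      have c1: "real (card (gp u p)) = real (card (gp u p - {q})) + 1"
        using card_Suc_Diff1[OF finite_gp that] by simp
      have "f p = 1 / y - 1 / (y + 1)" by (simp add: f_def wt_def y_def c1 algebra_simps)
      also have "\<dots> = 1 / (y * (y + 1))" using y T by (simp add: field_simps)
      finally have "f p = 1 / (y * (y + 1))" .
      moreover have "T * T \<le> y * (y + 1)" using y T by (intro mult_mono) auto
      ultimately show ?thesis using T y by (simp add: power2_eq_square frac_le)
    qed
    have f0: "f p = 0" if "q \<notin> gp u p" for p
      using that by (simp add: f_def wt_def)
    have "card Q \<le> 1"
      by (rule card_le_one_pairs[of _ S u q]) (auto simp: Q_def gp_def gap_def)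
    moreover have fQ: "finite Q" by (simp add: Q_def)
    ultimately have "sum f Q \<le> 1 / T\<^sup>2" using f by (intro sum_wt_le_one_pair) (auto simp: Q_def)
    moreover have "0 \<le> sum f Q" using f by (intro sum_nonneg) (auto simp: Q_def)
    moreover have "sum f (active S u) = sum f Q"
      unfolding Q_def by (rule sum.mono_neutral_right) (auto simp: f0)
    moreover have "R0 u - R u = sum f (active S u)"
      by (simp add: R0_def R_def f_def sum_subtractf)
    ultimately show ?thesis by simp
  qed
  from this[of "u(q := \<alpha>)"] this[of "u(q := \<beta>)"]
  have "0 \<le> R0 (u(q := \<alpha>)) - R (u(q := \<alpha>)) \<and> R0 (u(q := \<alpha>)) - R (u(q := \<alpha>)) \<le> 1 / T\<^sup>2"
    "0 \<le> R0 (u(q := \<beta>)) - R (u(q := \<beta>)) \<and> R0 (u(q := \<beta>)) - R (u(q := \<beta>)) \<le> 1 / T\<^sup>2" .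
  ultimately show ?thesis by (simp add: abs_le_iff)
qed

text \<open>A pair becomes active with probability at least (1 / k) * (1 - |Gs| / k): its ends
  agree, and a union bound handles the points of \<open>S\<close> between them. Given activity, the
  expected gap is |Gq| / k, and Jensen's inequality for 1 / y, through its tangent
  \<open>2 / \<mu> - y / \<mu>\<^sup>2\<close> at \<mu>, bounds the mean weight from below.\<close>

lemma avg_active_wt_ge:
  assumes p: "(a, b) \<in> Prs" and k: "k > 0"
  shows "(1 / k) * (1 - card (gap S x c a b) / k) / (card (gap (I - S) x c a b) / k + T)
    \<le> avg I k (\<lambda>u. of_bool ((a, b) \<in> active S u) * wt u (a, b))"
proof -
  define F where "F = (\<lambda>u. of_bool ((a, b) \<in> active S u) :: real)"
  define Gq where "Gq = gap (I - S) x c a b"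
  define Gs where "Gs = gap S x c a b"
  define \<mu> where "\<mu> = card Gq / k + T"
  have \<mu>: "\<mu> > 0" using T by (simp add: \<mu>_def add_nonneg_pos)
  have ab: "a \<in> S" "b \<in> S" "a \<in> I" "b \<in> I" "a \<noteq> b" "x a < x b" "c a = c b"
    using Prs[OF p] AB SI by auto
  have fin: "finite Gq" "finite Gs" using finI finite_subset[OF SI] by (auto simp: Gq_def Gs_def gap_def)
  have F: "avg I k F \<ge> (1 / k) * (1 - card Gs / k)"
  proof -
    have "(1 / k) * (1 - card Gs / k) = 1 / k - (\<Sum>z\<in>Gs. 1 / k / k)" by (simp add: algebra_simps)
    also have "\<dots> = avg I k (\<lambda>u. 1 * of_bool (u b = u a))
        - (\<Sum>z\<in>Gs. avg I k (\<lambda>u. of_bool (u b = u a) * of_bool (u z = u a)))"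
    proof -
      have 1: "avg I k (\<lambda>u. 1 * of_bool (u b = u a)) = 1 / k"
        using ab k finI by (subst avg_agree) auto
      have 2: "avg I k (\<lambda>u. of_bool (u b = u a) * of_bool (u z = u a)) = 1 / k / k" if "z \<in> Gs" for z
      proof -
        have "z \<in> I" "z \<noteq> a" "z \<noteq> b" using that SI by (auto simp: Gs_def gap_def)
        then have "avg I k (\<lambda>u. of_bool (u b = u a) * of_bool (u z = u a)) = avg I k (\<lambda>u. of_bool (u b = u a)) / k"
          using ab k finI by (intro avg_agree) auto
        then show ?thesis using 1 by simp
      qed
      show ?thesis using 1 2 by simp
    qed
    also have "\<dots> = avg I k (\<lambda>u. of_bool (u b = u a) - (\<Sum>z\<in>Gs. of_bool (u b = u a) * of_bool (u z = u a)))"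
      by (simp only: avg_diff avg_sum mult_1)
    also have "\<dots> \<le> avg I k F"
    proof (rule avg_mono)
      fix u
      show "of_bool (u b = u a) - (\<Sum>z\<in>Gs. of_bool (u b = u a) * of_bool (u z = u a)) \<le> F u"
      proof (cases "u b = u a \<and> (\<exists>z\<in>Gs. u z = u a)")
        case True
        then obtain z where z: "z \<in> Gs" "u z = u a" by auto
        have "of_bool (u b = u a) * of_bool (u z = u a) \<le> (\<Sum>z\<in>Gs. of_bool (u b = u a) * of_bool (u z = u a) :: real)"
          by (rule member_le_sum[OF z(1)]) (auto simp: fin)
        then show ?thesis using z True by (simp add: F_def)
      next
        case False
        then show ?thesis
          using p ab by (auto simp: F_def active_def Gs_def gap_def intro: sum_nonneg)
      qed
    qed
    finally show ?thesis .
  qed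
  have "(1 / k) * (1 - card Gs / k) / \<mu> \<le> avg I k F / \<mu>"
    using F \<mu> by (intro divide_right_mono) auto
  also have "\<dots> = avg I k F * (2 / \<mu> - T / \<mu>\<^sup>2) - (1 / \<mu>\<^sup>2) * (\<Sum>q\<in>Gq. avg I k F / k)"
  proof -
    have "2 / \<mu> - T / \<mu>\<^sup>2 - card Gq / k / \<mu>\<^sup>2 = 2 / \<mu> - \<mu> / \<mu>\<^sup>2"
      by (simp add: \<mu>_def diff_divide_distrib add_divide_distrib)
    also have "\<dots> = 1 / \<mu>" using \<mu> by (simp add: power2_eq_square)
    finally have e: "1 / \<mu> = 2 / \<mu> - T / \<mu>\<^sup>2 - card Gq / k / \<mu>\<^sup>2" by simp
    have "avg I k F / \<mu> = avg I k F * (1 / \<mu>)" by simp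
    also have "\<dots> = avg I k F * (2 / \<mu> - T / \<mu>\<^sup>2) - avg I k F * (card Gq / k / \<mu>\<^sup>2)"
      unfolding e by (simp only: right_diff_distrib)
    finally show ?thesis by (simp add: mult_ac)
  qed
  also have "\<dots> = avg I k (\<lambda>u. (2 / \<mu> - T / \<mu>\<^sup>2) * F u - (1 / \<mu>\<^sup>2) * (\<Sum>q\<in>Gq. F u * of_bool (u q = u a)))"
  proof -
    \<comment> \<open>Activity only concerns the digits of points of \<open>S\<close>, so the digit
      of \<open>q\<close> is independent of it.\<close>
    have "avg I k (\<lambda>u. F u * of_bool (u q = u a)) = avg I k F / k" if "q \<in> Gq" for q
    proof (rule avg_agree)
      show "F (u(q := \<alpha>)) = F u" for u \<alpha>
        unfolding F_def by (subst active_cong[of S _ u]) (use that in \<open>auto simp: Gq_def gap_def\<close>)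
    qed (use that ab finI k in \<open>auto simp: Gq_def gap_def\<close>)
    then have e: "avg I k (\<lambda>u. \<Sum>q\<in>Gq. F u * of_bool (u q = u a)) = (\<Sum>q\<in>Gq. avg I k F / k)"
      unfolding avg_sum by (intro sum.cong refl)
    show ?thesis unfolding avg_diff avg_cmult e by (simp only: mult.commute)
  qed
  also have "\<dots> \<le> avg I k (\<lambda>u. F u * wt u (a, b))"
  proof (rule avg_mono)
    fix u
    show "(2 / \<mu> - T / \<mu>\<^sup>2) * F u - (1 / \<mu>\<^sup>2) * (\<Sum>q\<in>Gq. F u * of_bool (u q = u a)) \<le> F u * wt u (a, b)"
    proof (cases "F u = 0")
      case False
      then have F1: "F u = 1" by (auto simp: F_def)
      define y where "y = card (gp u (a, b)) + T"
      have y: "y > 0" using T by (simp add: y_def add_nonneg_pos)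
      have "gp u (a, b) = Gq \<inter> {q. u q = u a}" by (auto simp: gp_def gap_def Gq_def)
      then have s: "(\<Sum>q\<in>Gq. of_bool (u q = u a)) = real (card (gp u (a, b)))"
        using fin by (simp add: of_bool_def sum.If_cases)
      have "2 / \<mu> - y / \<mu>\<^sup>2 \<le> 1 / y"
      proof -
        have "1 / y - (2 / \<mu> - y / \<mu>\<^sup>2) = (\<mu> - y)\<^sup>2 / (y * \<mu>\<^sup>2)"
          using y \<mu> by (simp add: field_simps power2_eq_square)
        also have "\<dots> \<ge> 0" using y by simp
        finally show ?thesis by simp
      qed
      then show ?thesis using F1 s by (simp add: wt_def y_def add_divide_distrib)
    qed simp
  qed
  finally show ?thesis by (simp add: F_def \<mu>_def Gq_def Gs_def)
qed

lemma avg_R_ge: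
  assumes "k > 0"
  shows "(\<Sum>(a, b)\<in>Prs. (1 / k) * (1 - card (gap S x c a b) / k) / (card (gap (I - S) x c a b) / k + T)) \<le> avg I k R"
proof -
  have "R = (\<lambda>u. \<Sum>p\<in>Prs. of_bool (p \<in> active S u) * wt u p)"
  proof
    fix u show "R u = (\<Sum>p\<in>Prs. of_bool (p \<in> active S u) * wt u p)"
      unfolding R_def using finite_Prs
      by (intro sum.mono_neutral_cong_left) (auto simp: active_def)
  qed
  then have "avg I k R = (\<Sum>p\<in>Prs. avg I k (\<lambda>u. of_bool (p \<in> active S u) * wt u p))"
    by (simp only: avg_sum)
  also have "\<dots> \<ge> (\<Sum>(a, b)\<in>Prs. (1 / k) * (1 - card (gap S x c a b) / k) / (card (gap (I - S) x c a b) / k + T))"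
    using avg_active_wt_ge[OF _ assms] by (intro sum_mono) auto
  finally show ?thesis .
qed

text \<open>For fixed \<open>u\<close> the second half of the digit gives exp (- R u / 8) up to
  rounding. Averaging over the first half uses the bounded differences of \<open>R\<close>; the last
  two terms are the price paid for \<open>S\<close> and for its complement.\<close>

lemma avg_avg_blocked_le:
  assumes "k > 0" "V > 0"
  shows "avg I k (\<lambda>u. avg I V (\<lambda>v. of_bool (blocked I x S (\<lambda>i. (c i, u i)) v)))
    \<le> exp (card S / (2 * V) - avg I k R / 8 + (card S / (16 * T\<^sup>2) + card I / (64 * T ^ 4)))"
proof -
  have finS: "finite S" using finI SI finite_subset by blast
  have "avg I k (\<lambda>u. avg I V (\<lambda>v. of_bool (blocked I x S (\<lambda>i. (c i, u i)) v)))
      \<le> avg I k (\<lambda>u. exp (card S / (2 * V)) * exp (- (R u / 8)))"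
  proof (rule avg_mono)
    fix u :: "'i \<Rightarrow> nat"
    let ?g = "\<lambda>a b. real (card (gap (I - S) x (\<lambda>i. (c i, u i)) a b))"
    have "avg I V (\<lambda>v. of_bool (blocked I x S (\<lambda>i. (c i, u i)) v))
        \<le> exp (- (\<Sum>(a, b)\<in>active S u. 1 / (8 * (?g a b + 1)) - 1 / (2 * real V)))"
      using Prs by (intro avg_blocked_le finI SI assms active_disjoint finite_active) (auto simp: active_def)
    also have "\<dots> \<le> exp (card S / (2 * V) + - (R u / 8))"
    proof -
      have "R u / 8 - card S / (2 * V) \<le> (\<Sum>p\<in>active S u. wt u p / 8) - card (active S u) * (1 / (2 * V))"
        using card_active_le[of u] by (simp add: R_def sum_divide_distrib divide_right_mono)
      also have "\<dots> = (\<Sum>p\<in>active S u. wt u p / 8 - 1 / (2 * V))" by (simp add: sum_subtractf)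
      also have "\<dots> \<le> (\<Sum>(a, b)\<in>active S u. 1 / (8 * (?g a b + 1)) - 1 / (2 * real V))"
        using T by (intro sum_mono) (auto simp: wt_def gp_def intro!: divide_left_mono mult_pos_pos add_nonneg_pos)
      finally show ?thesis by simp
    qed
    finally show "avg I V (\<lambda>v. of_bool (blocked I x S (\<lambda>i. (c i, u i)) v))
        \<le> exp (card S / (2 * V)) * exp (- (R u / 8))"
      by (simp only: exp_add)
  qed
  also have "\<dots> = exp (card S / (2 * V)) * avg I k (\<lambda>u. exp (- (R u / 8)))" by (rule avg_cmult)
  \<comment> \<open>The differences 2 / T and \<open>1 / T\<^sup>2\<close> of \<open>R\<close>,
    divided by 8.\<close>
  also have "\<dots> \<le> exp (card S / (2 * V)) * exp (- avg I k (\<lambda>u. R u / 8)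
      + (\<Sum>i\<in>I. (if i \<in> S then 1 / (4 * T) else 1 / (8 * T\<^sup>2))\<^sup>2))"
  proof (intro mult_left_mono avg_exp_bounded_diff finI assms)
    fix i assume "i \<in> I"
    have "1 \<le> T\<^sup>2" using T by simp
    then have "1 \<le> 8 * T\<^sup>2" "1 \<le> 4 * T" using T by linarith+
    then show "(if i \<in> S then 1 / (4 * T) else 1 / (8 * T\<^sup>2)) \<le> 1" by simp
  next
    fix u i a b assume "i \<in> I"
    then show "\<bar>R (u(i := a)) / 8 - R (u(i := b)) / 8\<bar> \<le> (if i \<in> S then 1 / (4 * T) else 1 / (8 * T\<^sup>2))"
      using R_change_S[of i u a b] R_change_Q[of i u a b] T
      by (auto simp: diff_divide_distrib[symmetric] abs_divide field_simps)
  qed auto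
  also have "(\<Sum>i\<in>I. (if i \<in> S then 1 / (4 * T) else 1 / (8 * T\<^sup>2))\<^sup>2)
      = card S * (1 / (16 * T\<^sup>2)) + card (I - S) * (1 / (64 * T ^ 4))"
  proof -
    have "(if i \<in> S then 1 / (4 * T) else 1 / (8 * T\<^sup>2))\<^sup>2 = (if i \<in> S then 1 / (16 * T\<^sup>2) else 1 / (64 * T ^ 4))" for i
      by (simp add: power_divide power_mult_distrib flip: power_mult)
    moreover have "I \<inter> S = S" "I \<inter> - S = I - S" using SI by auto
    ultimately show ?thesis using finI by (simp add: sum.If_cases)
  qed
  also have "avg I k (\<lambda>u. R u / 8) = avg I k R / 8"
    using avg_cmult[of I k "1 / 8" R] by simp
  also have "exp (card S / (2 * V)) * exp (- (avg I k R / 8) + (card S * (1 / (16 * T\<^sup>2)) + card (I - S) * (1 / (64 * T ^ 4))))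
      \<le> exp (card S / (2 * V) - avg I k R / 8 + (card S / (16 * T\<^sup>2) + card I / (64 * T ^ 4)))"
  proof -
    have "card (I - S) * (1 / (64 * T ^ 4)) \<le> card I * (1 / (64 * T ^ 4))"
      using finI by (intro mult_right_mono) (auto simp: card_mono)
    then show ?thesis by (simp add: mult_exp_exp)
  qed
  finally show ?thesis by (simp only: of_nat_mult of_nat_numeral)
qed

end


section \<open>The probability that a fixed set is separated\<close>

locale cell_ranks =
  fixes S :: "'i set" and x :: "'i \<Rightarrow> nat" and c :: "'i \<Rightarrow> 'c"
  assumes finS: "finite S" and injS: "inj_on x S"
begin

section \<open>Ranks inside a cell and pairs at a given rank distance\<close>

definition rk :: "'i \<Rightarrow> nat" where
  "rk s = card {s' \<in> S. c s' = c s \<and> x s' < x s}"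

definition cell :: "'c \<Rightarrow> 'i set" where
  "cell y = {s \<in> S. c s = y}"

text \<open>Even rank and odd difference make left ends even and right ends odd, as
  \<open>matched_pairs\<close> requires. The index \<open>j\<close> is the scale: 2 * j points of
  \<open>S\<close> in the cell lie between the ends.\<close>

definition pairs_at :: "nat \<Rightarrow> ('i \<times> 'i) set" where
  "pairs_at j = {(a, b) \<in> S \<times> S. c a = c b \<and> even (rk a) \<and> rk b = rk a + (2 * j + 1)}"

lemma rk_less: "s \<in> S \<Longrightarrow> c s = c s' \<Longrightarrow> x s < x s' \<Longrightarrow> rk s < rk s'"
  unfolding rk_def by (intro psubset_card_mono) (use finS in auto)

lemma rk_less_iff:
  assumes "s \<in> S" "s' \<in> S" "c s = c s'"
  shows "rk s < rk s' \<longleftrightarrow> x s < x s'"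
proof
  assume *: "rk s < rk s'"
  show "x s < x s'"
  proof (rule ccontr)
    assume "\<not> x s < x s'"
    then consider "x s' < x s" | "s = s'" using assms inj_onD[OF injS] by fastforce
    then show False using * rk_less[of s' s] assms by cases auto
  qed
qed (use assms rk_less in auto)

lemma rk_inj:
  assumes "s \<in> S" "s' \<in> S" "c s = c s'" "rk s = rk s'"
  shows "s = s'"
proof -
  have "\<not> x s < x s'" "\<not> x s' < x s"
    using rk_less_iff[of s s'] rk_less_iff[of s' s] assms by simp_all
  then show ?thesis using inj_onD[OF injS _ assms(1,2)] by simp
qed

lemma rk_image_cell: "rk ` cell y = {..<card (cell y)}"
proof (rule card_subset_eq)
  show "rk ` cell y \<subseteq> {..<card (cell y)}"
  proof safe
    fix s assume s: "s \<in> cell y"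
    have "rk s < card (cell y)"
      unfolding rk_def by (intro psubset_card_mono) (use s finS in \<open>auto simp: cell_def\<close>)
    then show "rk s < card (cell y)" .
  qed
  have "inj_on rk (cell y)" by (rule inj_onI) (auto simp: cell_def intro: rk_inj)
  then show "card (rk ` cell y) = card {..<card (cell y)}" by (simp add: card_image)
qed simp

lemma pairs_at_less: "(a, b) \<in> pairs_at j \<Longrightarrow> x a < x b"
  using rk_less_iff[of a b] by (auto simp: pairs_at_def)

lemma finite_pairs_at: "finite (pairs_at j)"
  by (rule finite_subset[of _ "S \<times> S"]) (auto simp: pairs_at_def finS)

lemma pairs_at_unique: "(a, b) \<in> pairs_at j \<Longrightarrow> (a, b') \<in> pairs_at j' \<Longrightarrow> j = j' \<Longrightarrow> b = b'"
  by (rule rk_inj) (auto simp: pairs_at_def)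

lemma card_even_ge: "L \<le> 2 * card {t. t < L \<and> even (t :: nat)}"
proof (induction L)
  case (Suc L)
  have eq: "{t. t < Suc L \<and> even t} = (if even L then insert L {t. t < L \<and> even t} else {t. t < L \<and> even t})"
    by (auto simp: less_Suc_eq)
  show ?case
  proof (cases "even L")
    case True
    then show ?thesis using Suc unfolding eq by simp
  next
    case False
    then obtain M where L: "L = Suc (2 * M)" by (metis oddE Suc_eq_plus1)
    then have "M + 1 \<le> card {t. t < L \<and> even t}" using Suc by simp
    then show ?thesis using L False unfolding eq by simp
  qed
qed simp

text \<open>In each cell at most the last 2 * j + 1 ranks have no partner, and at least half of the
  other ranks are even.\<close>

lemma card_pairs_at_ge: "card S \<le> 2 * card (pairs_at j) + (2 * j + 1) * card (c ` S)"
proof -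
  define D where "D = {a \<in> S. even (rk a) \<and> rk a + (2 * j + 1) < card (cell (c a))}"
  have "D \<subseteq> fst ` pairs_at j"
  proof
    fix a assume a: "a \<in> D"
    then have "rk a + (2 * j + 1) \<in> rk ` cell (c a)" unfolding rk_image_cell by (simp add: D_def)
    then obtain b where "b \<in> cell (c a)" "rk b = rk a + (2 * j + 1)" by auto
    then have "(a, b) \<in> pairs_at j" using a by (auto simp: D_def pairs_at_def cell_def)
    then show "a \<in> fst ` pairs_at j" by force
  qed
  then have D: "card D \<le> card (pairs_at j)"
    using card_mono[OF finite_imageI[OF finite_pairs_at]] card_image_le[OF finite_pairs_at] order_trans by blast
  have finD: "finite D" by (simp add: D_def finS)
  have cell_ge: "card (cell y) \<le> 2 * card {a \<in> D. c a = y} + (2 * j + 1)" for y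
  proof -
    have "{t. t < card (cell y) - (2 * j + 1) \<and> even t} \<subseteq> rk ` {a \<in> D. c a = y}"
    proof
      fix t assume t: "t \<in> {t. t < card (cell y) - (2 * j + 1) \<and> even t}"
      then have "t \<in> rk ` cell y" unfolding rk_image_cell by auto
      then obtain a where "a \<in> cell y" "t = rk a" by auto
      then show "t \<in> rk ` {a \<in> D. c a = y}" using t by (auto simp: D_def cell_def)
    qed
    then have "card {t. t < card (cell y) - (2 * j + 1) \<and> even t} \<le> card {a \<in> D. c a = y}"
      using finD by (intro order.trans[OF card_mono card_image_le]) auto
    then show ?thesis using card_even_ge[of "card (cell y) - (2 * j + 1)"] by linarith
  qed
  have sums: "(\<Sum>y\<in>c ` S. card {a \<in> Z. c a = y}) = card Z" if "Z \<subseteq> S" for Z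
  proof -
    have "(\<Sum>y\<in>c ` S. \<Sum>a\<in>{a \<in> Z. c a = y}. 1) = (\<Sum>a\<in>Z. 1 :: nat)"
      by (rule sum.group) (use that finS finite_subset in auto)
    then show ?thesis by simp
  qed
  have "card S = (\<Sum>y\<in>c ` S. card (cell y))" using sums[of S] by (simp add: cell_def)
  also have "\<dots> \<le> (\<Sum>y\<in>c ` S. 2 * card {a \<in> D. c a = y} + (2 * j + 1))" by (intro sum_mono cell_ge)
  also have "\<dots> = 2 * card D + (2 * j + 1) * card (c ` S)"
  proof -
    have "D \<subseteq> S" by (auto simp: D_def)
    from sums[OF this] have "(\<Sum>y\<in>c ` S. 2 * card {a \<in> D. c a = y}) = 2 * card D"
      unfolding sum_distrib_left[symmetric] by simp
    then show ?thesis unfolding sum.distrib by (simp add: mult.commute)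
  qed
  finally show ?thesis using D by linarith
qed

lemma card_gap_S_le:
  assumes "(a, b) \<in> pairs_at j"
  shows "card (gap S x c a b) \<le> 2 * j"
proof -
  have "card (gap S x c a b) \<le> card {rk a<..<rk b}"
  proof (rule card_inj_on_le)
    show "inj_on rk (gap S x c a b)" by (rule inj_onI) (auto simp: gap_def intro: rk_inj)
    show "rk ` gap S x c a b \<subseteq> {rk a<..<rk b}"
    proof
      fix t assume "t \<in> rk ` gap S x c a b"
      then obtain z where z: "t = rk z" "z \<in> S" "x a < x z" "x z < x b" "c z = c a" by (auto simp: gap_def)
      have "a \<in> S" "b \<in> S" "c a = c b" using assms by (auto simp: pairs_at_def)
      then show "t \<in> {rk a<..<rk b}"
        using z rk_less_iff[of a z] rk_less_iff[of z b] by simp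
    qed
  qed simp
  then show ?thesis using assms by (auto simp: pairs_at_def)
qed

text \<open>Double counting: a point \<open>q\<close> preceded by \<rho> points of \<open>S\<close>
  in its cell lies in the gap of (a, b) only if rk a < \<rho> \<le> rk a + 2 * j + 1, and
  \<open>rk a\<close> determines the pair within the cell.\<close>

lemma sum_card_gap_le:
  assumes "finite Q"
  shows "(\<Sum>(a, b)\<in>pairs_at j. card (gap Q x c a b)) \<le> (2 * j + 1) * card Q"
proof -
  have "(\<Sum>(a, b)\<in>pairs_at j. card (gap Q x c a b)) = (\<Sum>(a, b)\<in>pairs_at j. \<Sum>q\<in>Q. of_bool (q \<in> gap Q x c a b))"
    using assms by (intro sum.cong refl) (auto simp: of_bool_def sum.If_cases gap_def Int_def)
  also have "\<dots> = (\<Sum>q\<in>Q. \<Sum>(a, b)\<in>pairs_at j. of_bool (q \<in> gap Q x c a b))"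
    unfolding case_prod_unfold by (rule sum.swap)
  also have "\<dots> \<le> (\<Sum>q\<in>Q. 2 * j + 1)"
  proof (rule sum_mono)
    fix q
    define Pq where "Pq = {(a, b) \<in> pairs_at j. q \<in> gap Q x c a b}"
    define \<rho> where "\<rho> = card {s \<in> S. c s = c q \<and> x s < x q}"
    have "(\<Sum>(a, b)\<in>pairs_at j. of_bool (q \<in> gap Q x c a b)) = card Pq"
      by (simp add: Pq_def of_bool_def sum.If_cases finite_pairs_at case_prod_unfold Int_def)
    also have "\<dots> \<le> card {\<rho> - (2 * j + 1)..<\<rho>}"
    proof (rule card_inj_on_le)
      show "inj_on (\<lambda>p. rk (fst p)) Pq"
      proof (rule inj_onI)
        fix p p' assume *: "p \<in> Pq" "p' \<in> Pq" "rk (fst p) = rk (fst p')"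
        obtain a b a' b' where ab: "p = (a, b)" "p' = (a', b')" by fastforce
        have "a = a'" using * ab by (intro rk_inj) (auto simp: Pq_def pairs_at_def gap_def)
        moreover from this have "b = b'" using * ab by (intro pairs_at_unique[of a b j b' j]) (auto simp: Pq_def)
        ultimately show "p = p'" using ab by simp
      qed
      show "(\<lambda>p. rk (fst p)) ` Pq \<subseteq> {\<rho> - (2 * j + 1)..<\<rho>}"
      proof
        fix t assume "t \<in> (\<lambda>p. rk (fst p)) ` Pq"
        then obtain a b where ab: "(a, b) \<in> pairs_at j" "q \<in> gap Q x c a b" "t = rk a" by (auto simp: Pq_def)
        have "rk a < \<rho>" unfolding rk_def \<rho>_def
          by (intro psubset_card_mono) (use ab finS in \<open>auto simp: gap_def pairs_at_def\<close>)
        moreover have "\<rho> \<le> rk b" unfolding rk_def \<rho>_def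
          by (intro card_mono) (use ab finS in \<open>auto simp: gap_def pairs_at_def\<close>)
        ultimately show "t \<in> {\<rho> - (2 * j + 1)..<\<rho>}" using ab by (auto simp: pairs_at_def)
      qed
    qed simp
    also have "\<dots> \<le> 2 * j + 1" by simp
    finally show "(\<Sum>(a, b)\<in>pairs_at j. of_bool (q \<in> gap Q x c a b)) \<le> 2 * j + 1" .
  qed
  also have "\<dots> = (2 * j + 1) * card Q" by (simp add: mult.commute)
  finally show ?thesis .
qed

end

text \<open>Comparison with the integral of 1 / y, one step being ln (1 + z) \<le> z. The logarithm
  is the gain from summing over all scales \<open>j\<close>.\<close>

lemma sum_odd_reciprocals_ge:
  fixes T :: real
  assumes "T > 0"
  shows "(ln (2 * real J + 1 + T) - ln (1 + T)) / 2 \<le> (\<Sum>j<J. 1 / (real (2 * j + 1) + T))"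
proof (induction J)
  case (Suc J)
  define y where "y = 2 * real J + 1 + T"
  have y: "y > 0" using assms by (simp add: y_def)
  have "ln (y + 2) - ln y = ln (1 + 2 / y)"
    using y ln_div[of "y + 2" y] by (simp add: add_divide_distrib)
  also have "\<dots> \<le> 2 / y" using y by (intro ln_add_one_self_le_self) auto
  finally have "(ln (y + 2) - ln y) / 2 \<le> 1 / y" by simp
  then have "(ln (y + 2) - ln (1 + T)) / 2 \<le> (ln y - ln (1 + T)) / 2 + 1 / y" by (simp add: field_simps)
  also have "\<dots> \<le> (\<Sum>j<J. 1 / (real (2 * j + 1) + T)) + 1 / y" using Suc by (simp add: y_def)
  finally show ?case by (simp add: y_def algebra_simps)
qed simp

text \<open>Both halves of a digit in base \<open>k * k\<close>, given the cells \<open>c\<close>.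
  There are at least m / 4 pairs at each scale j < k div 4; each becomes active with probability at
  least 1 / (2 * k), the expected gap after refinement is O(2 * j + 1) on average over these pairs,
  and summing over the scales yields ln k. By \<open>cells\<close> a cell holds at least
  \<open>k\<close> points of \<open>S\<close> on average.\<close>

lemma avg_avg_blocked_cells_le:
  fixes x :: "'i \<Rightarrow> nat" and c :: "'i \<Rightarrow> 'c" and k :: nat
  assumes finI: "finite I" and inj: "inj_on x I" and SI: "S \<subseteq> I" and k: "k > 0"
    and n: "card I \<le> card S * k" and cells: "card (c ` S) * k \<le> card S"
  shows "avg I k (\<lambda>u. avg I k (\<lambda>v. of_bool (blocked I x S (\<lambda>i. (c i, u i)) v)))
    \<le> exp (- (card S / k * (ln k / 1024 - 1)))"
proof -
  define m where "m = card S"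
  \<comment> \<open>A compromise: the harmonic sum from \<open>T\<close> to \<open>k\<close> still
    has order ln k, while the error terms with \<open>T\<^sup>2\<close> and \<open>T ^ 4\<close> in
    \<open>avg_avg_blocked_le\<close> are only O(m / k).\<close>
  define T where "T = sqrt k"
  \<comment> \<open>For j < J at most half of the points of \<open>S\<close> are lost as ranks
    without partner, and at most k / 2 points of \<open>S\<close> separate a pair.\<close>
  define J where "J = k div 4"
  have Tk: "T \<ge> 1" "T\<^sup>2 = k" "T ^ 4 = (real k)\<^sup>2" using k by (simp_all add: T_def)
    (metis of_nat_0_le_iff power4_eq_xxxx power2_eq_square mult.assoc real_sqrt_mult_self abs_of_nonneg)
  interpret cell_ranks S x c
    using finI SI inj by unfold_locales (auto intro: finite_subset inj_on_subset)
  define Prs where "Prs = (\<Union>j<J. pairs_at j)"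
  define A where "A = {s \<in> S. even (rk s)}"
  define B where "B = {s \<in> S. odd (rk s)}"
  interpret matched_pairs I S A B x c Prs T
  proof
    fix a b assume "(a, b) \<in> Prs"
    then obtain j where "(a, b) \<in> pairs_at j" by (auto simp: Prs_def)
    then show "a \<in> A \<and> b \<in> B \<and> x a < x b \<and> c a = c b"
      using pairs_at_less by (auto simp: A_def B_def pairs_at_def)
  qed (use finI inj SI Tk in \<open>auto simp: A_def B_def\<close>)
  have J: "real J \<ge> k / 4 - 1" "4 * J \<le> k" by (auto simp: J_def)
  have level: "(1 / (2 * k)) * (m / (16 * (real (2 * j + 1) + T)))
      \<le> (\<Sum>(a, b)\<in>pairs_at j. (1 / k) * (1 - card (gap S x c a b) / k) / (card (gap (I - S) x c a b) / k + T))"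
    if j: "j < J" for j
  proof -
    define i where "i = real (2 * j + 1)"
    define G where "G = (\<lambda>(a, b). card (gap (I - S) x c a b) / k + T)"
    define N where "N = card (pairs_at j)"
    \<comment> \<open>An upper bound for the mean of \<open>G\<close> over the pairs, by m \<le> 4 *
      N; the tangent to 1 / y at \<mu> then bounds the sum of 1 / G from below.\<close>
    define \<mu> where "\<mu> = 4 * (i + T)"
    have i: "i \<ge> 1" by (simp add: i_def)
    have \<mu>: "\<mu> > 0" using i T by (simp add: \<mu>_def)
    have jk: "2 * (2 * j + 1) \<le> k" by (rule order.trans[OF _ J(2)]) (use j in simp)
    have "2 * ((2 * j + 1) * card (c ` S)) \<le> k * card (c ` S)"
      using mult_right_mono[OF jk, of "card (c ` S)"] by (simp add: mult_ac)
    then have "2 * ((2 * j + 1) * card (c ` S)) \<le> m" using cells by (simp add: m_def mult.commute)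
    then have N: "m \<le> 4 * N" using card_pairs_at_ge[of j] by (simp add: N_def m_def)
    have Gpos: "G p > 0" for p using T by (auto simp: G_def case_prod_unfold add_nonneg_pos)
    have sumG: "(\<Sum>p\<in>pairs_at j. G p) \<le> N * \<mu>"
    proof -
      have "(\<Sum>p\<in>pairs_at j. G p) = real (\<Sum>(a, b)\<in>pairs_at j. card (gap (I - S) x c a b)) / k + N * T"
        by (simp add: G_def case_prod_unfold sum.distrib N_def sum_divide_distrib)
      also have "\<dots> \<le> real ((2 * j + 1) * card I) / k + N * T"
      proof -
        have "(2 * j + 1) * card (I - S) \<le> (2 * j + 1) * card I"
          using finI by (intro mult_left_mono card_mono) auto
        then have "(\<Sum>(a, b)\<in>pairs_at j. card (gap (I - S) x c a b)) \<le> (2 * j + 1) * card I"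
          using sum_card_gap_le[of "I - S" j] finI by (meson finite_Diff le_trans)
        then show ?thesis by (intro add_right_mono divide_right_mono of_nat_mono) auto
      qed
      also have "real ((2 * j + 1) * card I) / k = i * (card I / k)"
        by (simp only: i_def of_nat_mult times_divide_eq_right)
      also have "i * (card I / k) \<le> i * m"
        using n k i by (intro mult_left_mono) (auto simp: m_def field_simps simp flip: of_nat_mult)
      also have "i * m \<le> i * (4 * N)" using N i by (intro mult_left_mono) auto
      also have "i * (4 * N) + N * T \<le> N * \<mu>" using T by (simp add: \<mu>_def algebra_simps)
      finally show ?thesis by simp
    qed
    have "m / (4 * \<mu>) \<le> N / \<mu>" using N \<mu> by (simp add: field_simps)
    also have "\<dots> \<le> N * (2 / \<mu>) - (\<Sum>p\<in>pairs_at j. G p) / \<mu>\<^sup>2"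
    proof -
      have "(\<Sum>p\<in>pairs_at j. G p) / \<mu>\<^sup>2 \<le> N * \<mu> / \<mu>\<^sup>2" using sumG by (intro divide_right_mono) auto
      also have "\<dots> = N / \<mu>" using \<mu> by (simp add: power2_eq_square)
      finally have "(\<Sum>p\<in>pairs_at j. G p) / \<mu>\<^sup>2 \<le> N / \<mu>" .
      moreover have "N * (2 / \<mu>) = N / \<mu> + N / \<mu>" by (simp add: field_simps)
      ultimately show ?thesis by linarith
    qed
    also have "\<dots> = (\<Sum>p\<in>pairs_at j. 2 / \<mu> - G p / \<mu>\<^sup>2)"
      by (simp add: N_def sum_subtractf sum_divide_distrib)
    also have "\<dots> \<le> (\<Sum>p\<in>pairs_at j. 1 / G p)"
    proof (rule sum_mono)
      fix p
      have "1 / G p - (2 / \<mu> - G p / \<mu>\<^sup>2) = (\<mu> - G p)\<^sup>2 / (G p * \<mu>\<^sup>2)"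
        using Gpos[of p] \<mu> by (simp add: field_simps power2_eq_square)
      also have "\<dots> \<ge> 0" using Gpos[of p] by simp
      finally show "2 / \<mu> - G p / \<mu>\<^sup>2 \<le> 1 / G p" by simp
    qed
    finally have "(1 / (2 * k)) * (m / (4 * \<mu>)) \<le> (1 / (2 * k)) * (\<Sum>p\<in>pairs_at j. 1 / G p)"
      by (intro mult_left_mono) auto
    also have "\<dots> = (\<Sum>p\<in>pairs_at j. (1 / k) * (1 / 2) / G p)"
    proof -
      have "(1 / (2 * k)) * (1 / g) = (1 / k) * (1 / 2) / g" for g :: real by simp
      then show ?thesis by (simp only: sum_distrib_left)
    qed
    also have "\<dots> \<le> (\<Sum>p\<in>pairs_at j. (1 / k) * (1 - card (gap S x c (fst p) (snd p)) / k) / G p)"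
    proof (intro sum_mono divide_right_mono mult_left_mono)
      fix p assume "p \<in> pairs_at j"
      then have "card (gap S x c (fst p) (snd p)) \<le> 2 * j" by (intro card_gap_S_le) simp
      then have "2 * card (gap S x c (fst p) (snd p)) \<le> k"
        by (intro order.trans[OF _ jk]) simp
      then have "2 * real (card (gap S x c (fst p) (snd p))) \<le> k" by linarith
      then show "1 / 2 \<le> 1 - card (gap S x c (fst p) (snd p)) / k" using k by (simp add: field_simps)
      show "0 \<le> G p" using Gpos[of p] by simp
    qed simp
    finally show ?thesis by (simp add: \<mu>_def i_def G_def case_prod_unfold)
  qed
  \<comment> \<open>The factors are 32 from \<open>level\<close>, 4 from the sum over the scales,
    and afterwards 8 from \<open>avg_avg_blocked_le\<close>; together they give 1024.\<close>
  have "m / k * (ln k / 128 - 1 / 32) \<le> avg I k R"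
  proof -
    have "(ln k / 4 - 1) \<le> (\<Sum>j<J. 1 / (real (2 * j + 1) + T))"
    proof -
      have l4: "ln (4 :: real) \<le> 2" 
        using exp_ge_add_one_self[of 1] ln_mult[of 2 "2 :: real"] ln2_le_25_over_36 by simp
      have "ln k / 4 - 1 \<le> (ln (k / 2) - ln (2 * T)) / 2"
        using k T l4 ln_mult[of 2 "2 :: real"] by (simp add: T_def ln_div ln_mult ln_sqrt field_simps)
      also have "\<dots> \<le> (ln (2 * real J + 1 + T) - ln (1 + T)) / 2"
        using J T k by (intro divide_right_mono diff_mono ln_mono) auto
      also have "\<dots> \<le> (\<Sum>j<J. 1 / (real (2 * j + 1) + T))"
        using T by (intro sum_odd_reciprocals_ge) auto
      finally show ?thesis .
    qed
    then have "m / (32 * k) * (ln k / 4 - 1) \<le> m / (32 * k) * (\<Sum>j<J. 1 / (real (2 * j + 1) + T))"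
      by (intro mult_left_mono) auto
    also have "\<dots> = (\<Sum>j<J. (1 / (2 * k)) * (m / (16 * (real (2 * j + 1) + T))))"
    proof -
      have "m / (32 * k) * (1 / d) = (1 / (2 * k)) * (m / (16 * d))" for d :: real by simp
      then show ?thesis by (simp only: sum_distrib_left)
    qed
    also have "\<dots> \<le> (\<Sum>j<J. \<Sum>(a, b)\<in>pairs_at j. (1 / k) * (1 - card (gap S x c a b) / k) / (card (gap (I - S) x c a b) / k + T))"
      by (intro sum_mono level) auto
    also have "\<dots> = (\<Sum>(a, b)\<in>Prs. (1 / k) * (1 - card (gap S x c a b) / k) / (card (gap (I - S) x c a b) / k + T))"
      unfolding Prs_def by (rule sum.UNION_disjoint[symmetric])
        (auto simp: finite_pairs_at, auto simp: pairs_at_def)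
    also have "\<dots> \<le> avg I k R" by (rule avg_R_ge[OF k])
    finally have "m / (32 * k) * (ln k / 4 - 1) \<le> avg I k R" .
    moreover have "m / k * (l / 128 - 1 / 32) = m / (32 * k) * (l / 4 - 1)" for l :: real
      using k by (simp add: field_simps)
    ultimately show ?thesis by simp
  qed
  then have Rge: "m / k * (ln k / 1024 - 1 / 256) \<le> avg I k R / 8" by (simp add: algebra_simps)
  have "avg I k (\<lambda>u. avg I k (\<lambda>v. of_bool (blocked I x S (\<lambda>i. (c i, u i)) v)))
      \<le> exp (m / (2 * k) - avg I k R / 8 + (m / (16 * T\<^sup>2) + card I / (64 * T ^ 4)))"
    using avg_avg_blocked_le[OF k k] by (simp add: m_def)
  also have "\<dots> \<le> exp (- (m / k * (ln k / 1024 - 1)))"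
  proof -
    have "card I / (64 * T ^ 4) \<le> (m * k) / (64 * T ^ 4)"
      using n by (intro divide_right_mono) (auto simp: m_def simp flip: of_nat_mult)
    also have "\<dots> = m / k / 64" unfolding Tk(2,3) by (simp add: power2_eq_square)
    finally have "m / (2 * k) - avg I k R / 8 + (m / (16 * T\<^sup>2) + card I / (64 * T ^ 4))
        \<le> m / k / 2 - m / k * (ln k / 1024 - 1 / 256) + (m / k / 16 + m / k / 64)"
      using Rge unfolding Tk(2,3) by (simp add: mult.commute)
    also have "\<dots> \<le> - (m / k * (ln k / 1024 - 1))"
    proof -
      have "a / 2 - a * (l - 1 / 256) + (a / 16 + a / 64) \<le> - (a * (l - 1))" if "0 \<le> a" for a l :: real
        using that by (simp add: algebra_simps)
      note aux = this
      have "0 \<le> real m / real k" by simp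
      then show ?thesis by (rule aux)
    qed
    finally show ?thesis by simp
  qed
  finally show ?thesis by (simp add: m_def)
qed

text \<open>If the prefixes satisfy a s < a p, so do the full numbers, and the prefix of a blocking
  number is weakly between. If \<open>s\<close> and \<open>p\<close> share a prefix, a number
  between theirs has the same prefix, so the blocking point lies in the refined cell.\<close>

lemma blocked_digits:
  assumes "blocked I x S e (\<lambda>i. a i * K + b i)" "\<And>i. i \<in> I \<Longrightarrow> b i < K" "S \<subseteq> I"
  shows "blocked I x S e a" "blocked I x S (\<lambda>i. (e i, a i)) b"
proof -
  have lt: "a s * K + b s < a p * K + b p" if "s \<in> I" "p \<in> I" "a s < a p" for s p
  proof -
    have "a s * K + b s < (a s + 1) * K" using assms(2)[OF that(1)] by simp
    also have "\<dots> \<le> a p * K" using that by (intro mult_right_mono) auto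
    finally show ?thesis by simp
  qed
  have le: "a s \<le> a p" if "s \<in> I" "p \<in> I" "a s * K + b s \<le> a p * K + b p" for s p
    using lt[of p s] that by (meson leD leI order_less_le_trans)
  show "blocked I x S e a"
    unfolding blocked_def
  proof (intro ballI impI)
    fix s p assume *: "s \<in> S" "p \<in> S" "x s < x p" "e s = e p" "a s < a p"
    then have "a s * K + b s < a p * K + b p" using assms(3) lt by auto
    then obtain q where "q \<in> I - S" "x s < x q" "x q < x p" "e q = e s"
      "a s * K + b s \<le> a q * K + b q" "a q * K + b q \<le> a p * K + b p"
      using assms(1) * unfolding blocked_def by blast
    then show "\<exists>q\<in>I - S. x s < x q \<and> x q < x p \<and> e q = e s \<and> a s \<le> a q \<and> a q \<le> a p"
      using le[of s q] le[of q p] assms(3) * by blast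
  qed
  show "blocked I x S (\<lambda>i. (e i, a i)) b"
    unfolding blocked_def
  proof (intro ballI impI)
    fix s p assume *: "s \<in> S" "p \<in> S" "x s < x p" "(e s, a s) = (e p, a p)" "b s < b p"
    then have "a s * K + b s < a p * K + b p" by simp
    then obtain q where q: "q \<in> I - S" "x s < x q" "x q < x p" "e q = e s"
      "a s * K + b s \<le> a q * K + b q" "a q * K + b q \<le> a p * K + b p"
      using assms(1) * unfolding blocked_def by blast
    then have "a q = a s" using le[of s q] le[of q p] assms(3) * by force
    then show "\<exists>q\<in>I - S. x s < x q \<and> x q < x p \<and> (e q, a q) = (e s, a s) \<and> b s \<le> b q \<and> b q \<le> b p"
      using q * by auto
  qed
qed

text \<open>Quotient and remainder of a uniform number are independent and uniform. Outside
  \<open>I\<close> the combined function need not have the default value \<open>undefined\<close>,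
  so \<open>f\<close> has to depend on \<open>I\<close> only.\<close>

lemma avg_digits:
  assumes "finite I" "K > 0" "depends_on I f"
  shows "avg I (L * K) f = avg I L (\<lambda>y. avg I K (\<lambda>d. f (\<lambda>i. y i * K + d i)))"
  using assms(1,3)
proof (induction I arbitrary: f rule: finite_induct)
  case empty
  have "f (\<lambda>_. undefined) = f (\<lambda>i. undefined * K + undefined)"
    by (rule depends_onD[OF empty.prems]) auto
  then show ?case by simp
next
  case (insert i I)
  have dep: "depends_on I (\<lambda>u. f (u(i := a)))" for a
    unfolding depends_on_def
    by (intro allI impI depends_onD[OF insert.prems]) auto
  have upd: "(\<lambda>j. (y(i := b)) j * K + (d(i := a)) j) = (\<lambda>j. y j * K + d j)(i := b * K + a)" for y d b a
    by auto
  have "avg (insert i I) (L * K) f = (\<Sum>a<L * K. avg I (L * K) (\<lambda>u. f (u(i := a)))) / real (L * K)"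
    by (rule avg_insert[OF insert.hyps])
  also have "\<dots> = (\<Sum>b<L. \<Sum>a<K. avg I (L * K) (\<lambda>u. f (u(i := b * K + a)))) / real (L * K)"
  proof -
    have "(\<Sum>a<L * K. avg I (L * K) (\<lambda>u. f (u(i := a))))
        = (\<Sum>b<L. sum (\<lambda>a. avg I (L * K) (\<lambda>u. f (u(i := a)))) {b * K..<b * K + K})"
      by (rule sum.nat_group[symmetric])
    also have "\<dots> = (\<Sum>b<L. \<Sum>a<K. avg I (L * K) (\<lambda>u. f (u(i := b * K + a))))"
    proof (rule sum.cong[OF refl])
      fix b
      show "(\<Sum>a = b * K..<b * K + K. avg I (L * K) (\<lambda>u. f (u(i := a))))
          = (\<Sum>a<K. avg I (L * K) (\<lambda>u. f (u(i := b * K + a))))"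
        using sum.shift_bounds_nat_ivl[of "\<lambda>a. avg I (L * K) (\<lambda>u. f (u(i := a)))" 0 "b * K" K]
        unfolding lessThan_atLeast0 by (simp only: add_0 add.commute)
    qed
    finally show ?thesis by simp
  qed
  also have "\<dots> = (\<Sum>b<L. \<Sum>a<K. avg I L (\<lambda>y. avg I K (\<lambda>d. f ((\<lambda>j. y j * K + d j)(i := b * K + a))))) / real (L * K)"
    by (simp only: insert.IH[OF dep])
  also have "\<dots> = avg (insert i I) L (\<lambda>y. avg (insert i I) K (\<lambda>d. f (\<lambda>i. y i * K + d i)))"
  proof -
    have "avg I L (\<lambda>y. (\<Sum>a<K. g a y) / K) = (\<Sum>a<K. avg I L (g a)) / K" for g :: "nat \<Rightarrow> ('a \<Rightarrow> nat) \<Rightarrow> real"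
      using avg_cmult[of I L "1 / K" "\<lambda>y. \<Sum>a<K. g a y"] by (simp add: avg_sum)
    then show ?thesis
      unfolding avg_insert[OF insert.hyps] upd
      by (simp only: of_nat_mult sum_divide_distrib[symmetric] divide_divide_eq_left mult.commute)
  qed
  finally show ?case .
qed

lemma depends_on_blocked: "depends_on I (\<lambda>v. of_bool (blocked I x S e v) :: real)" if "S \<subseteq> I"
proof -
  have "blocked I x S e u \<Longrightarrow> blocked I x S e v" if *: "\<And>i. i \<in> I \<Longrightarrow> u i = v i" for u v
    unfolding blocked_def
  proof (intro ballI impI)
    fix s p assume H: "\<forall>s\<in>S. \<forall>p\<in>S. x s < x p \<longrightarrow> e s = e p \<longrightarrow> u s < u p \<longrightarrow>
      (\<exists>q\<in>I - S. x s < x q \<and> x q < x p \<and> e q = e s \<and> u s \<le> u q \<and> u q \<le> u p)"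
      and sp: "s \<in> S" "p \<in> S" "x s < x p" "e s = e p" "v s < v p"
    have eq: "u s = v s" "u p = v p" using * sp \<open>S \<subseteq> I\<close> by auto
    then obtain q where "q \<in> I - S" "x s < x q" "x q < x p" "e q = e s" "u s \<le> u q" "u q \<le> u p"
      using H[rule_format, OF sp(1-4)] sp(5) by auto
    then show "\<exists>q\<in>I - S. x s < x q \<and> x q < x p \<and> e q = e s \<and> v s \<le> v q \<and> v q \<le> v p"
      using eq * by (intro bexI[of _ q]) auto
  qed
  note imp = this
  show ?thesis
    unfolding depends_on_def
  proof (intro allI impI)
    fix u v :: "'a \<Rightarrow> nat" assume "\<forall>i\<in>I. u i = v i"
    then have "blocked I x S e u \<longleftrightarrow> blocked I x S e v" using imp[of u v] imp[of v u] by auto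
    then show "of_bool (blocked I x S e u) = (of_bool (blocked I x S e v) :: real)" by simp
  qed
qed

text \<open>Induction over the digits, most significant first: by \<open>blocked_digits\<close> both
  the prefix and the next digit must be blocked, and given the prefix the latter has probability at
  most \<theta>. A prefix of \<open>b\<close> digits creates at most \<open>k ^ (2 * b)\<close>
  cells, few enough by \<open>cells\<close>.\<close>

lemma avg_blocked_iterate:
  fixes x :: "'i \<Rightarrow> nat" and k :: nat
  assumes finI: "finite I" and inj: "inj_on x I" and SI: "S \<subseteq> I" and k: "k > 0"
    and n: "card I \<le> card S * k" and cells: "\<And>b. b < B \<Longrightarrow> k ^ (2 * b) * k \<le> card S"
  shows "avg I (k ^ (2 * B)) (\<lambda>y. of_bool (blocked I x S (\<lambda>_. ()) y))
    \<le> exp (- (card S / k * (ln k / 1024 - 1))) ^ B"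
  using cells
proof (induction B)
  case 0
  have "avg I 1 (\<lambda>y. of_bool (blocked I x S (\<lambda>_. ()) y)) \<le> avg I 1 (\<lambda>_. 1)"
    by (rule avg_mono) auto
  then show ?case using finI by simp
next
  case (Suc B)
  define \<theta> where "\<theta> = exp (- (card S / k * (ln k / 1024 - 1)))"
  let ?b = "\<lambda>y. of_bool (blocked I x S (\<lambda>_. ()) y) :: real"
  have kk: "k * k > 0" using k by simp
  have block: "avg I (k * k) (\<lambda>d. of_bool (blocked I x S c d)) \<le> \<theta>"
    if c: "card (c ` S) * k \<le> card S" for c :: "'i \<Rightarrow> unit \<times> nat"
  proof -
    have "avg I (k * k) (\<lambda>d. of_bool (blocked I x S c d))
        = avg I k (\<lambda>u. avg I k (\<lambda>v. of_bool (blocked I x S c (\<lambda>i. u i * k + v i))))"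
      by (rule avg_digits[OF finI k depends_on_blocked[OF SI]])
    also have "\<dots> \<le> avg I k (\<lambda>u. avg I k (\<lambda>v. of_bool (blocked I x S (\<lambda>i. (c i, u i)) v)))"
    proof (intro avg_mono)
      fix u v :: "'i \<Rightarrow> nat" assume "v \<in> PiE I (\<lambda>_. {..<k})"
      then have v: "\<And>i. i \<in> I \<Longrightarrow> v i < k" by auto
      have "blocked I x S c (\<lambda>i. u i * k + v i) \<Longrightarrow> blocked I x S (\<lambda>i. (c i, u i)) v"
        by (rule blocked_digits(2)[OF _ v SI])
      then show "of_bool (blocked I x S c (\<lambda>i. u i * k + v i)) \<le> (of_bool (blocked I x S (\<lambda>i. (c i, u i)) v) :: real)"
        by auto
    qed
    also have "\<dots> \<le> \<theta>" unfolding \<theta>_def by (rule avg_avg_blocked_cells_le[OF finI inj SI k n c])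
    finally show ?thesis .
  qed
  have "avg I (k ^ (2 * Suc B)) ?b = avg I (k ^ (2 * B) * (k * k)) ?b"
    by (simp add: mult_ac power2_eq_square)
  also have "\<dots> = avg I (k ^ (2 * B)) (\<lambda>y. avg I (k * k) (\<lambda>d. ?b (\<lambda>i. y i * (k * k) + d i)))"
    by (rule avg_digits[OF finI kk depends_on_blocked[OF SI]])
  also have "\<dots> \<le> avg I (k ^ (2 * B)) (\<lambda>y. \<theta> * ?b y)"
  proof (rule avg_mono)
    fix y assume y: "y \<in> PiE I (\<lambda>_. {..<k ^ (2 * B)})"
    have "avg I (k * k) (\<lambda>d. ?b (\<lambda>i. y i * (k * k) + d i))
        \<le> avg I (k * k) (\<lambda>d. ?b y * of_bool (blocked I x S (\<lambda>i. ((), y i)) d))"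
    proof (rule avg_mono)
      fix d assume "d \<in> PiE I (\<lambda>_. {..<k * k})"
      then have d: "\<And>i. i \<in> I \<Longrightarrow> d i < k * k" by auto
      show "?b (\<lambda>i. y i * (k * k) + d i) \<le> ?b y * of_bool (blocked I x S (\<lambda>i. ((), y i)) d)"
        using blocked_digits[OF _ d SI, of x "\<lambda>_. ()" y] by auto
    qed
    also have "\<dots> = ?b y * avg I (k * k) (\<lambda>d. of_bool (blocked I x S (\<lambda>i. ((), y i)) d))" by (rule avg_cmult)
    also have "\<dots> \<le> ?b y * \<theta>"
    proof (intro mult_left_mono block)
      have "(\<lambda>i. ((), y i)) ` S \<subseteq> {()} \<times> {..<k ^ (2 * B)}" using y SI by auto
      then have "card ((\<lambda>i. ((), y i)) ` S) \<le> card ({()} \<times> {..<k ^ (2 * B)})" by (intro card_mono) auto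
      then have "card ((\<lambda>i. ((), y i)) ` S) * k \<le> k ^ (2 * B) * k" by simp
      then show "card ((\<lambda>i. ((), y i)) ` S) * k \<le> card S" using Suc.prems[OF lessI] by (rule order.trans)
    qed simp
    finally show "avg I (k * k) (\<lambda>d. ?b (\<lambda>i. y i * (k * k) + d i)) \<le> \<theta> * ?b y" by (simp only: mult.commute)
  qed
  also have "\<dots> = \<theta> * avg I (k ^ (2 * B)) ?b" by (rule avg_cmult)
  also have "\<dots> \<le> \<theta> * \<theta> ^ B"
    using Suc.IH Suc.prems by (intro mult_left_mono) (auto simp: \<theta>_def)
  finally show ?case by (simp add: \<theta>_def)
qed


section \<open>Staircases\<close>

text \<open>Strict records towards small \<open>h\<close>, in the order of \<open>x\<close>, among
  the points with digit in \<open>Z\<close>. In the induction below, the first record replaces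
  \<open>Z\<close> by the digits below its own.\<close>

definition recs :: "'i set \<Rightarrow> ('i \<Rightarrow> real) \<Rightarrow> nat set \<Rightarrow> (nat \<Rightarrow> real) \<Rightarrow> ('i \<Rightarrow> nat) \<Rightarrow> 'i set" where
  "recs I x Z h y = {q \<in> I. y q \<in> Z \<and> (\<forall>r\<in>I. x r < x q \<longrightarrow> y r \<in> Z \<longrightarrow> h (y q) < h (y r))}"

text \<open>Exchanging the two digits shows that at most half of all ordered pairs are
  counted.\<close>

lemma two_sum_card_below_le:
  fixes h :: "nat \<Rightarrow> real"
  assumes "finite Z"
  shows "2 * (\<Sum>\<alpha>\<in>Z. card {\<beta> \<in> Z. h \<beta> < h \<alpha>}) \<le> card Z * card Z"
proof -
  have c: "card {\<beta> \<in> Z. h \<beta> < h \<alpha>} = (\<Sum>\<beta>\<in>Z. of_bool (h \<beta> < h \<alpha>))" for \<alpha>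
    using assms by (simp add: of_bool_def sum.If_cases Int_def)
  have "(\<Sum>\<alpha>\<in>Z. card {\<beta> \<in> Z. h \<beta> < h \<alpha>}) = (\<Sum>\<alpha>\<in>Z. \<Sum>\<beta>\<in>Z. of_bool (h \<beta> < h \<alpha>))"
    by (simp only: c)
  moreover from this have "(\<Sum>\<alpha>\<in>Z. card {\<beta> \<in> Z. h \<beta> < h \<alpha>}) = (\<Sum>\<alpha>\<in>Z. \<Sum>\<beta>\<in>Z. of_bool (h \<alpha> < h \<beta>))"
    using sum.swap[of "\<lambda>\<alpha> \<beta>. of_bool (h \<beta> < h \<alpha>) :: nat" Z Z] by simp
  ultimately have "2 * (\<Sum>\<alpha>\<in>Z. card {\<beta> \<in> Z. h \<beta> < h \<alpha>})
      = (\<Sum>\<alpha>\<in>Z. \<Sum>\<beta>\<in>Z. of_bool (h \<beta> < h \<alpha>) + of_bool (h \<alpha> < h \<beta>))"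
    unfolding sum.distrib by linarith
  also have "\<dots> \<le> (\<Sum>\<alpha>\<in>Z. \<Sum>\<beta>\<in>Z. 1)" by (intro sum_mono) (auto simp: of_bool_def)
  finally show ?thesis by simp
qed

text \<open>An exponential moment, for Markov's inequality. The leftmost point is a record as soon
  as its digit lies in \<open>Z\<close>; it then doubles the power and leaves only the digits below
  its own. These are on average at most half of \<open>Z\<close>, which compensates the doubling, so
  the bound grows by card Z / K per point. For full \<open>Z\<close> it is card I + 1, the exact
  value for a uniformly random order.\<close>

lemma avg_two_pow_card_recs_le:
  fixes x :: "'i \<Rightarrow> real"
  assumes "finite I" "inj_on x I" "Z \<subseteq> {..<K}" "K > 0"
  shows "avg I K (\<lambda>y. 2 ^ card (recs I x Z h y)) \<le> 1 + card I * card Z / K"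
  using assms(1-3)
\<comment> \<open>Ranking by - x makes the inserted point the leftmost one.\<close>
proof (induction I arbitrary: Z rule: finite_ranking_induct[where f = "\<lambda>i. - x i"])
  case empty
  then show ?case by (simp add: recs_def)
next
  case (insert i I)
  show ?case
  proof (cases "i \<in> I")
    case True
    then show ?thesis using insert.IH[of Z] insert.prems by (simp add: insert_absorb)
  next
    case False
    have less: "x i < x j" if "j \<in> I" for j
    proof -
      have "x i \<le> x j" using insert.hyps(2)[OF that] by simp
      moreover have "x i \<noteq> x j" using insert.prems(1) that False by (auto simp: inj_on_def)
      ultimately show ?thesis by simp
    qed
    define Za where "Za = (\<lambda>\<alpha>. {\<beta> \<in> Z. h \<beta> < h \<alpha>})"
    define N where "N = real (card I)"
    define z where "z = real (card Z)"
    have finZ: "finite Z" using insert.prems(2) finite_subset by blast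
    have injI: "inj_on x I" using insert.prems(1) by (rule inj_on_subset) auto
    have out: "recs (insert i I) x Z h (y(i := \<alpha>)) = recs I x Z h y" if "\<alpha> \<notin> Z" for \<alpha> y
      using that False by (auto simp: recs_def)
    have into: "recs (insert i I) x Z h (y(i := \<alpha>)) = insert i (recs I x (Za \<alpha>) h y)" if "\<alpha> \<in> Z" for \<alpha> y
    proof (intro equalityI subsetI)
      fix q assume q: "q \<in> recs (insert i I) x Z h (y(i := \<alpha>))"
      show "q \<in> insert i (recs I x (Za \<alpha>) h y)"
      proof (cases "q = i")
        case False
        then have "q \<in> I" "y q \<in> Z" using q by (auto simp: recs_def)
        moreover have "h (y q) < h \<alpha>" using q False less[OF \<open>q \<in> I\<close>] \<open>\<alpha> \<in> Z\<close> by (auto simp: recs_def)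
        moreover have "h (y q) < h (y r)" if "r \<in> I" "x r < x q" "y r \<in> Z" for r
        proof -
          have "r \<noteq> i" using that \<open>i \<notin> I\<close> by auto
          have "\<forall>r\<in>insert i I. x r < x q \<longrightarrow> (y(i := \<alpha>)) r \<in> Z \<longrightarrow> h ((y(i := \<alpha>)) q) < h ((y(i := \<alpha>)) r)"
            using q unfolding recs_def by blast
          from this[rule_format, of r] show ?thesis using that False \<open>r \<noteq> i\<close> by simp
        qed
        ultimately show ?thesis by (auto simp: recs_def Za_def)
      qed simp
    next
      fix q assume q: "q \<in> insert i (recs I x (Za \<alpha>) h y)"
      show "q \<in> recs (insert i I) x Z h (y(i := \<alpha>))"
      proof (cases "q = i")
        case True
        have "\<not> x r < x i" if "r \<in> insert i I" for r using that less[of r] by force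
        then show ?thesis using True \<open>\<alpha> \<in> Z\<close> by (simp add: recs_def)
      next
        case False
        then have *: "q \<in> I" "y q \<in> Z" "h (y q) < h \<alpha>"
          "\<And>r. r \<in> I \<Longrightarrow> x r < x q \<Longrightarrow> y r \<in> Z \<Longrightarrow> h (y r) < h \<alpha> \<Longrightarrow> h (y q) < h (y r)"
          using q by (auto simp: recs_def Za_def)
        have "h (y q) < h ((y(i := \<alpha>)) r)" if "r \<in> insert i I" "x r < x q" "(y(i := \<alpha>)) r \<in> Z" for r
          using that *(3) *(4)[of r] by (cases "r = i"; cases "h (y r) < h \<alpha>") auto
        then show ?thesis using * False by (simp add: recs_def)
      qed
    qed
    have i_notin: "i \<notin> recs I x Z' h y" for Z' y using False by (simp add: recs_def)
    have fin_recs: "finite (recs I x Z' h y)" for Z' y using insert.hyps(1) by (simp add: recs_def)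
    have step: "avg I K (\<lambda>y. 2 ^ card (recs (insert i I) x Z h (y(i := \<alpha>))))
        \<le> (if \<alpha> \<in> Z then 2 * (1 + N * card (Za \<alpha>) / K) else 1 + N * z / K)" for \<alpha>
    proof (cases "\<alpha> \<in> Z")
      case True
      have "avg I K (\<lambda>y. 2 ^ card (recs (insert i I) x Z h (y(i := \<alpha>)))) = 2 * avg I K (\<lambda>y. 2 ^ card (recs I x (Za \<alpha>) h y))"
        unfolding into[OF True] by (simp add: i_notin fin_recs avg_cmult)
      also have "\<dots> \<le> 2 * (1 + N * card (Za \<alpha>) / K)"
      proof -
        have "Za \<alpha> \<subseteq> {..<K}" using insert.prems(2) by (auto simp: Za_def)
        from insert.IH[OF injI this] show ?thesis by (simp add: N_def)
      qed
      finally show ?thesis using True by simp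
    next
      case False
      then show ?thesis using insert.IH[OF injI insert.prems(2)] by (simp add: out N_def z_def)
    qed
    have zK: "z \<le> K" unfolding z_def using card_mono[OF _ insert.prems(2)] by simp
    have pairs: "2 * (\<Sum>\<alpha>\<in>Z. real (card (Za \<alpha>))) \<le> z * z"
    proof -
      have "real (2 * (\<Sum>\<alpha>\<in>Z. card (Za \<alpha>))) \<le> real (card Z * card Z)"
        unfolding Za_def by (intro of_nat_mono two_sum_card_below_le finZ)
      then show ?thesis by (simp add: z_def)
    qed
    have "avg (insert i I) K (\<lambda>y. 2 ^ card (recs (insert i I) x Z h y))
        \<le> (\<Sum>\<alpha><K. if \<alpha> \<in> Z then 2 * (1 + N * card (Za \<alpha>) / K) else 1 + N * z / K) / K"
      unfolding avg_insert[OF insert.hyps(1) False] by (intro divide_right_mono sum_mono step) simp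
    also have "(\<Sum>\<alpha><K. if \<alpha> \<in> Z then 2 * (1 + N * card (Za \<alpha>) / K) else 1 + N * z / K)
        = (\<Sum>\<alpha>\<in>Z. 2 * (1 + N * card (Za \<alpha>) / K)) + (K - z) * (1 + N * z / K)"
    proof -
      have "{..<K} \<inter> {\<alpha>. \<alpha> \<in> Z} = Z" "{..<K} \<inter> - {\<alpha>. \<alpha> \<in> Z} = {..<K} - Z" using insert.prems(2) by auto
      moreover have "real (card ({..<K} - Z)) = K - z"
        using insert.prems(2) finZ zK by (simp add: card_Diff_subset z_def of_nat_diff)
      ultimately show ?thesis by (simp add: sum.If_cases)
    qed
    also have "(\<Sum>\<alpha>\<in>Z. 2 * (1 + N * card (Za \<alpha>) / K)) = 2 * z + N / K * (2 * (\<Sum>\<alpha>\<in>Z. real (card (Za \<alpha>))))"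
      by (simp add: sum.distrib sum_distrib_left sum_divide_distrib z_def mult_ac distrib_left)
    also have "((2 * z + N / K * (2 * (\<Sum>\<alpha>\<in>Z. real (card (Za \<alpha>))))) + (K - z) * (1 + N * z / K)) / K
        \<le> ((2 * z + N / K * (z * z)) + (K - z) * (1 + N * z / K)) / K"
      using pairs by (intro divide_right_mono add_right_mono add_left_mono mult_left_mono) (auto simp: N_def)
    also have "\<dots> = 1 + (N + 1) * z / K"
      using assms(4) by (simp add: field_simps)
    also have "\<dots> = 1 + card (insert i I) * card Z / K"
      using insert.hyps(1) False by (simp add: N_def z_def distrib_right)
    finally show ?thesis .
  qed
qed

lemma avg_marginal:
  assumes "finite I" "J \<subseteq> I" "depends_on J f" "K > 0"
  shows "avg I K f = avg J K f"
proof -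
  have "avg (D \<union> J) K f = avg J K f" if "finite D" "D \<inter> J = {}" for D
    using that
  proof (induction D rule: finite_induct)
    case (insert i D)
    have fin: "finite (D \<union> J)" "i \<notin> D \<union> J"
      using insert assms(1,2) finite_subset by auto
    have "f (u(i := a)) = f u" for u a
      using insert.prems by (intro depends_on_upd_irrelevant[OF assms(3)]) auto
    then show ?case using insert assms(4) avg_insert[OF fin, of K f] by simp
  qed simp
  moreover have "(I - J) \<inter> J = {}" "I - J \<union> J = I" using assms(2) by auto
  ultimately show ?thesis using assms(1) by (metis finite_Diff)
qed

text \<open>The signs \<open>sx\<close> and \<open>sy\<close> select a quadrant around
  \<open>v\<close>. Read by increasing distance from \<open>v\<close> along the first axis, the
  staircase consists of the records towards \<open>v\<close> along the second axis.\<close>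

definition stair :: "'i set \<Rightarrow> ('i \<Rightarrow> real) \<Rightarrow> ('i \<Rightarrow> real) \<Rightarrow> real \<Rightarrow> real \<Rightarrow> 'i \<Rightarrow> 'i set" where
  "stair I x y sx sy v = {q \<in> I. sx * x v < sx * x q \<and> sy * y v < sy * y q \<and>
     (\<forall>r\<in>I. sx * x v < sx * x r \<longrightarrow> sx * x r < sx * x q \<longrightarrow> sy * y v < sy * y r \<longrightarrow> sy * y q < sy * y r)}"

text \<open>Given the digit \<beta> of \<open>v\<close>, the staircase is the set of records among
  the points beyond \<open>v\<close> along the first axis with digits in \<open>Z \<beta>\<close>.
  Markov's inequality is applied to 2 to the power of its size.\<close>

lemma avg_card_stair_ge_le:
  fixes x :: "'i \<Rightarrow> real"
  assumes "finite I" "inj_on x I" "v \<in> I" "K > 0" "sx \<noteq> 0"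
  shows "avg I K (\<lambda>y. of_bool (t \<le> card (stair I x (\<lambda>i. y i) sx sy v))) \<le> (1 + card I) / 2 ^ t"
proof -
  define J where "J = {j \<in> I. sx * x v < sx * x j}"
  define Z where "Z = (\<lambda>\<beta>. {\<alpha> \<in> {..<K}. sy * real \<beta> < sy * real \<alpha>})"
  let ?r = "\<lambda>\<beta>. recs J (\<lambda>i. sx * x i) (Z \<beta>) (\<lambda>\<alpha>. sy * real \<alpha>)"
  define I' where "I' = I - {v}"
  have I: "I = insert v I'" "finite I'" "v \<notin> I'" "J \<subseteq> I'" using assms(1,3) by (auto simp: I'_def J_def)
  have finJ: "finite J" using I(2,4) finite_subset by blast
  have eq: "stair I x (\<lambda>i. y i) sx sy v = ?r (y v) y"
    if "y \<in> PiE I (\<lambda>_. {..<K})" for y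
    using that by (auto simp: stair_def recs_def J_def Z_def)
  have injx: "inj_on (\<lambda>i. sx * x i) J"
    using assms(2,5) by (auto simp: inj_on_def J_def)
  have dep: "depends_on J (\<lambda>y. 2 ^ card (?r \<beta> y) :: real)" for \<beta>
  proof -
    have "?r \<beta> y = ?r \<beta> y'"
      if "\<forall>i\<in>J. y i = y' i" for y y'
      using that by (auto simp: recs_def)
    then show ?thesis unfolding depends_on_def by metis
  qed
  have "avg I K (\<lambda>y. of_bool (t \<le> card (stair I x (\<lambda>i. y i) sx sy v)))
      \<le> avg I K (\<lambda>y. (1 / 2 ^ t) * 2 ^ card (?r (y v) y))"
  proof (rule avg_mono)
    fix y assume y: "y \<in> PiE I (\<lambda>_. {..<K})"
    show "of_bool (t \<le> card (stair I x (\<lambda>i. y i) sx sy v))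
        \<le> (1 / 2 ^ t) * (2 ^ card (?r (y v) y) :: real)"
      unfolding eq[OF y] by (auto simp: field_simps intro!: power_increasing)
  qed
  also have "\<dots> = (1 / 2 ^ t) * avg I K (\<lambda>y. 2 ^ card (?r (y v) y))"
    by (rule avg_cmult)
  also have "avg I K (\<lambda>y. 2 ^ card (?r (y v) y))
      = (\<Sum>\<beta><K. avg I' K (\<lambda>y. 2 ^ card (?r \<beta> y))) / K"
  proof -
    have "v \<notin> J" using I by auto
    then have "?r \<beta> (y(v := \<beta>)) = ?r \<beta> y"
      for \<beta> y by (auto simp: recs_def)
    then show ?thesis unfolding I(1) avg_insert[OF I(2,3)] by simp
  qed
  also have "\<dots> \<le> (\<Sum>\<beta><K. 1 + real (card I)) / K"
  proof (intro divide_right_mono sum_mono)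
    fix \<beta>
    have "avg I' K (\<lambda>y. 2 ^ card (?r \<beta> y))
        = avg J K (\<lambda>y. 2 ^ card (?r \<beta> y))"
      by (rule avg_marginal[OF I(2,4) dep assms(4)])
    also have "\<dots> \<le> 1 + card J * card (Z \<beta>) / K"
      by (rule avg_two_pow_card_recs_le[OF finJ injx _ assms(4)]) (auto simp: Z_def)
    also have "\<dots> \<le> 1 + card I"
    proof -
      have "card J \<le> card I" using assms(1) I by (intro card_mono) auto
      moreover have "card (Z \<beta>) \<le> card {..<K}" by (intro card_mono) (auto simp: Z_def)
      ultimately have "real (card J) * card (Z \<beta>) \<le> real (card I) * K" by (intro mult_mono) auto
      then show ?thesis using assms(4) by (simp add: field_simps)
    qed
    finally show "avg I' K (\<lambda>y. 2 ^ card (?r \<beta> y)) \<le> 1 + real (card I)" by simp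
  qed simp
  also have "\<dots> = 1 + card I" using assms(4) by simp
  finally show ?thesis by (simp add: field_simps)
qed


section \<open>Colouring locally sparse graphs\<close>

definition colorings :: "('a \<Rightarrow> 'a \<Rightarrow> bool) \<Rightarrow> nat \<Rightarrow> 'a set \<Rightarrow> ('a \<Rightarrow> nat) set" where
  "colorings adj q X = {\<phi> \<in> PiE X (\<lambda>_. {..<q}). \<forall>u\<in>X. \<forall>w\<in>X. adj u w \<longrightarrow> \<phi> u \<noteq> \<phi> w}"

definition avail :: "('a \<Rightarrow> 'a \<Rightarrow> bool) \<Rightarrow> nat \<Rightarrow> 'a set \<Rightarrow> ('a \<Rightarrow> nat) \<Rightarrow> 'a \<Rightarrow> nat set" where
  "avail adj q X \<phi> v = {..<q} - \<phi> ` {w \<in> X. adj v w}"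

lemma finite_avail [simp]: "finite (avail adj q X \<phi> v)"
  by (simp add: avail_def)

lemma avail_antimono: "X \<subseteq> Y \<Longrightarrow> avail adj q Y \<phi> v \<subseteq> avail adj q X \<phi> v"
  by (auto simp: avail_def)

lemma avail_cong: "(\<And>w. w \<in> X \<Longrightarrow> \<phi> w = \<psi> w) \<Longrightarrow> avail adj q X \<phi> v = avail adj q X \<psi> v"
  by (auto simp: avail_def image_iff)

lemma avail_upd [simp]: "u \<notin> X \<Longrightarrow> avail adj q X (\<phi>(u := c)) v = avail adj q X \<phi> v"
  by (rule avail_cong) auto

lemma finite_colorings: "finite X \<Longrightarrow> finite (colorings adj q X)"
  unfolding colorings_def by (rule finite_subset[of _ "PiE X (\<lambda>_. {..<q})"]) (auto intro: finite_PiE)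

text \<open>Extending by a free colour of \<open>v\<close> is a bijection; this plays the role of
  resampling the colour of one vertex.\<close>

lemma sum_colorings_insert:
  fixes h :: "('a \<Rightarrow> nat) \<Rightarrow> real"
  assumes "finite X" "v \<notin> X" "symp adj" "irreflp adj"
  shows "(\<Sum>\<phi>\<in>colorings adj q (insert v X). h \<phi>)
       = (\<Sum>\<psi>\<in>colorings adj q X. \<Sum>c\<in>avail adj q X \<psi> v. h (\<psi>(v := c)))"
proof -
  let ?S = "SIGMA \<psi>:colorings adj q X. avail adj q X \<psi> v"
  have inj: "inj_on (\<lambda>(\<psi>, c). \<psi>(v := c)) ?S"
  proof (rule inj_onI; clarify)
    fix \<psi> c \<psi>' c'
    assume *: "\<psi> \<in> colorings adj q X" "\<psi>' \<in> colorings adj q X" "\<psi>(v := c) = \<psi>'(v := c')"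
    have "c = c'" using fun_cong[OF *(3), of v] by simp
    moreover have "\<psi> x = \<psi>' x" for x
      using *(1,2) fun_cong[OF *(3), of x] assms(2)
      by (cases "x = v") (auto simp: colorings_def PiE_def extensional_def)
    ultimately show "\<psi> = \<psi>' \<and> c = c'" by auto
  qed
  have "colorings adj q (insert v X) = (\<lambda>(\<psi>, c). \<psi>(v := c)) ` ?S" (is "?L = ?R")
  proof
    show "?R \<subseteq> ?L"
      using assms(2-4)
      by (auto simp: colorings_def avail_def symp_def irreflp_def image_iff intro!: PiE_fun_upd)
        (metis PiE_mem lessThan_iff)+
    show "?L \<subseteq> ?R"
    proof
      fix \<phi> assume \<phi>: "\<phi> \<in> ?L"
      have "\<phi> = (restrict \<phi> X)(v := \<phi> v)"
        using \<phi> by (auto simp: colorings_def PiE_def extensional_def fun_eq_iff)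
      moreover have "restrict \<phi> X \<in> colorings adj q X"
        using \<phi> by (auto simp: colorings_def)
      moreover have "\<phi> v \<in> avail adj q X (restrict \<phi> X) v"
        using \<phi> by (auto simp: colorings_def avail_def)
      ultimately show "\<phi> \<in> ?R" by (force intro!: image_eqI[of _ _ "(restrict \<phi> X, \<phi> v)"])
    qed
  qed
  then have "(\<Sum>\<phi>\<in>colorings adj q (insert v X). h \<phi>) = (\<Sum>(\<psi>, c)\<in>?S. h (\<psi>(v := c)))"
    by (simp only: sum.reindex[OF inj]) (simp add: case_prod_unfold)
  also have "\<dots> = (\<Sum>\<psi>\<in>colorings adj q X. \<Sum>c\<in>avail adj q X \<psi> v. h (\<psi>(v := c)))"
    using assms(1) by (subst sum.Sigma) (auto simp: finite_colorings)
  finally show ?thesis .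
qed

text \<open>Chain rule for the event that no vertex of \<open>M\<close> with a long list gets colour \<open>c\<close>; the lists
  are computed outside \<open>N\<close>, and the weight \<open>w\<close> makes the induction on \<open>M\<close> work.\<close>

lemma sum_colorings_avoid:
  fixes w :: "('a \<Rightarrow> nat) \<Rightarrow> real" and t :: real and q c :: nat
  assumes "finite Y" "N \<subseteq> Y" "symp adj" "irreflp adj"
    and deg: "\<And>u. u \<in> N \<Longrightarrow> real (card {z \<in> N. adj u z}) \<le> t / 2" and "t \<ge> 4"
    and "finite M" "M \<subseteq> N"
    and "\<And>\<phi>. w \<phi> \<ge> 0" and "\<And>\<phi> \<psi>. (\<And>z. z \<in> Y - N \<Longrightarrow> \<phi> z = \<psi> z) \<Longrightarrow> w \<phi> = w \<psi>"
  defines "lst \<equiv> (\<lambda>\<phi> u. avail adj q (Y - N) \<phi> u)"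
  defines "fac \<equiv> (\<lambda>\<phi> u. if t < card (lst \<phi> u) \<and> c \<in> lst \<phi> u then 1 - 2 / real (card (lst \<phi> u)) else 1)"
  shows "(\<Sum>\<phi>\<in>colorings adj q Y. w \<phi> * (\<Prod>u\<in>M. fac \<phi> u))
      \<le> (\<Sum>\<phi>\<in>colorings adj q Y. w \<phi> * of_bool (\<forall>u\<in>M. t < card (lst \<phi> u) \<longrightarrow> \<phi> u \<noteq> c))"
  using assms(7-10)
proof (induction M arbitrary: w rule: finite_induct)
  case empty
  show ?case by simp
next
  case (insert u M)
  have fac_pos: "fac \<phi> z \<ge> 0" for \<phi> z
    using \<open>t \<ge> 4\<close> by (auto simp: fac_def field_simps)
  have lst_cong: "lst \<phi> z = lst \<psi> z" if "\<And>z. z \<in> Y - N \<Longrightarrow> \<phi> z = \<psi> z" for \<phi> \<psi> z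
    unfolding lst_def by (rule avail_cong) (use that in auto)
  have fac_cong: "fac \<phi> z = fac \<psi> z" if "\<And>z. z \<in> Y - N \<Longrightarrow> \<phi> z = \<psi> z" for \<phi> \<psi> z
    by (simp only: fac_def lst_cong[OF that])
  have u: "u \<in> N" "u \<notin> M" using insert.hyps(2) insert.prems(1) by auto
  define B where "B = (\<lambda>\<phi>. of_bool (\<forall>z\<in>M. t < card (lst \<phi> z) \<longrightarrow> \<phi> z \<noteq> c) :: real)"
  have "(\<Sum>\<phi>\<in>colorings adj q Y. w \<phi> * (\<Prod>u\<in>insert u M. fac \<phi> u))
      = (\<Sum>\<phi>\<in>colorings adj q Y. (w \<phi> * fac \<phi> u) * (\<Prod>u\<in>M. fac \<phi> u))"
    using insert.hyps by (simp add: mult_ac)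
  also have "\<dots> \<le> (\<Sum>\<phi>\<in>colorings adj q Y. (w \<phi> * fac \<phi> u) * B \<phi>)"
    unfolding B_def
  proof (rule insert.IH)
    show "w \<phi> * fac \<phi> u = w \<psi> * fac \<psi> u" if "\<And>z. z \<in> Y - N \<Longrightarrow> \<phi> z = \<psi> z" for \<phi> \<psi>
      by (simp only: insert.prems(3)[OF that] fac_cong[OF that])
    show "M \<subseteq> N" using insert.prems(1) by auto
    show "0 \<le> w \<phi> * fac \<phi> u" for \<phi> by (intro mult_nonneg_nonneg insert.prems(2) fac_pos)
  qed
  also have "\<dots> \<le> (\<Sum>\<phi>\<in>colorings adj q Y. w \<phi> * B \<phi> * of_bool (t < card (lst \<phi> u) \<longrightarrow> \<phi> u \<noteq> c))"
  proof -
    define X where "X = Y - {u}"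
    have X: "finite X" "u \<notin> X" "Y = insert u X" "Y - N \<subseteq> X" using assms(1,2) u(1) by (auto simp: X_def)
    have "(\<Sum>d\<in>avail adj q X \<psi> u. w (\<psi>(u := d)) * fac (\<psi>(u := d)) u * B (\<psi>(u := d)))
        \<le> (\<Sum>d\<in>avail adj q X \<psi> u. w (\<psi>(u := d)) * B (\<psi>(u := d)) *
              of_bool (t < card (lst (\<psi>(u := d)) u) \<longrightarrow> (\<psi>(u := d)) u \<noteq> c))" for \<psi>
    proof -
      have out: "\<And>z. z \<in> Y - N \<Longrightarrow> (\<psi>(u := d)) z = \<psi> z" for d using u by auto
      have eqs: "w (\<psi>(u := d)) = w \<psi>" "fac (\<psi>(u := d)) u = fac \<psi> u" "lst (\<psi>(u := d)) z = lst \<psi> z" for d z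
        by (simp_all only: insert.prems(3)[OF out] fac_cong[OF out] lst_cong[OF out])
      have B: "B (\<psi>(u := d)) = B \<psi>" for d
        unfolding B_def eqs using u(2) by (intro arg_cong[of _ _ of_bool] ball_cong) auto
      let ?A = "avail adj q X \<psi> u" and ?L = "lst \<psi> u"
      \<comment> \<open>\<open>?A\<close> is what the colours of the neighbours in \<open>N\<close>
        leave of \<open>?L\<close>. They remove at most t / 2 colours, less than half of a long
        list, so forbidding \<open>c\<close> costs a share of at most 1 / card ?A \<le> 2 / card
        ?L.\<close>
      have main: "fac \<psi> u * card ?A \<le> (\<Sum>d\<in>?A. of_bool (t < card ?L \<longrightarrow> d \<noteq> c))"
      proof (cases "t < card ?L \<and> c \<in> ?A")
        case True
        have sub: "?A \<subseteq> ?L" unfolding lst_def by (rule avail_antimono) (use X in auto)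
        have "?L \<subseteq> ?A \<union> \<psi> ` {z \<in> N. adj u z}" using X(3,4) u assms(4) unfolding lst_def avail_def X_def irreflp_def by blast
        then have "card ?L \<le> card (?A \<union> \<psi> ` {z \<in> N. adj u z})"
          by (intro card_mono finite_UnI) (use assms(1,2) in \<open>auto dest: finite_subset\<close>)
        also have "\<dots> \<le> card ?A + card {z \<in> N. adj u z}"
          using card_Un_le card_image_le[of "{z \<in> N. adj u z}" \<psi>] assms(1,2)
          by (smt (verit) add_left_mono finite_subset mem_Collect_eq order_trans subsetI)
        finally have "real (card ?L) \<le> card ?A + t / 2" using deg[OF u(1)] by linarith
        then have c2: "real (card ?L) \<le> 2 * card ?A" using True by linarith
        have "(\<Sum>d\<in>?A. of_bool (t < card ?L \<longrightarrow> d \<noteq> c)) = real (card (?A - {c}))"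
          using True by (simp add: of_bool_def sum.If_cases Int_def set_diff_eq)
        also have "\<dots> = real (card ?A) - 1"
          using True card_Suc_Diff1[OF finite_avail, of c adj q X \<psi> u] by linarith
        finally have r: "(\<Sum>d\<in>?A. of_bool (t < card ?L \<longrightarrow> d \<noteq> c)) = card ?A - (1::real)" .
        have "fac \<psi> u = 1 - 2 / card ?L" using True sub by (auto simp: fac_def)
        moreover have "(1 - 2 / real (card ?L)) * card ?A \<le> real (card ?A) - 1"
          using c2 True \<open>t \<ge> 4\<close> by (simp add: field_simps)
        ultimately show ?thesis unfolding r by simp
      next
        case False
        then have "(\<Sum>d\<in>?A. of_bool (t < card ?L \<longrightarrow> d \<noteq> c)) = (\<Sum>d\<in>?A. 1 :: real)"
          by (intro sum.cong) auto
        moreover have "fac \<psi> u \<le> 1" by (auto simp: fac_def)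
        ultimately show ?thesis by (simp add: mult_left_le_one_le fac_pos)
      qed
      have "0 \<le> w \<psi> * B \<psi>" using insert.prems(2)[of \<psi>] by (auto simp: B_def)
      from mult_left_mono[OF main this] show ?thesis
        unfolding eqs B fun_upd_same sum_distrib_left[symmetric] by (simp only: sum_constant mult_ac)
    qed
    then show ?thesis
      unfolding X(3) sum_colorings_insert[OF X(1,2) assms(3,4)] by (rule sum_mono)
  qed
  also have "\<dots> = (\<Sum>\<phi>\<in>colorings adj q Y. w \<phi> * of_bool (\<forall>z\<in>insert u M. t < card (lst \<phi> z) \<longrightarrow> \<phi> z \<noteq> c))"
    by (intro sum.cong) (auto simp: B_def)
  finally show ?case .
qed

text \<open>As 1 - p \<ge> exp (- 2 * p) for 0 \<le> p \<le> 1 / 2, the product is at least exp (- s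
  c). Every vertex contributes at most 2 to the sum of \<open>p\<close> over the colours, so the
  mean of \<open>s c\<close> is at most \<mu> = 4 * \<Delta> / q, and convexity of exp gives the
  bound.\<close>

lemma sum_prod_lists_ge:
  fixes t :: real and q \<Delta> :: nat and M :: "'a set"
  assumes "finite M" "card M \<le> \<Delta>" "t \<ge> 4" "q > 0" "\<And>u. L u \<subseteq> {..<q}"
  shows "q * exp (- (4 * \<Delta> / q))
    \<le> (\<Sum>c<q. \<Prod>u\<in>M. if t < card (L u) \<and> c \<in> L u then 1 - 2 / real (card (L u)) else 1)"
proof -
  define p where "p = (\<lambda>c u. if t < card (L u) \<and> c \<in> L u then 2 / real (card (L u)) else 0)"
  define s where "s = (\<lambda>c. 2 * (\<Sum>u\<in>M. p c u))"
  define \<mu> where "\<mu> = 4 * \<Delta> / real q"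
  have p: "0 \<le> p c u" "p c u \<le> 1 / 2" for c u
    using assms(3) by (auto simp: p_def field_simps)
  have step: "exp (- s c) \<le> (\<Prod>u\<in>M. 1 - p c u)" for c
  proof -
    have "exp (- s c) = (\<Prod>u\<in>M. exp (- 2 * p c u))"
      unfolding s_def using assms(1) by (subst exp_sum[symmetric]) (simp_all add: sum_distrib_left sum_negf)
    also have "\<dots> \<le> (\<Prod>u\<in>M. 1 - p c u)"
    proof (intro prod_mono conjI)
      fix u assume "u \<in> M"
      have "1 + 2 * p c u \<le> exp (2 * p c u)" by (rule exp_ge_add_one_self_aux) (use p in simp)
      moreover have "1 \<le> (1 - p c u) * (1 + 2 * p c u)"
        using mult_left_mono[OF p(2), of "p c u"] p(1) by (simp add: field_simps)
      ultimately have "1 \<le> (1 - p c u) * exp (2 * p c u)"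
        using p(2)[of c u] by (smt (verit) mult_left_mono field_sum_of_halves)
      then show "exp (- 2 * p c u) \<le> 1 - p c u" by (simp add: exp_minus field_simps)
    qed simp
    finally show ?thesis .
  qed
  have "(\<Sum>c<q. s c) = 2 * (\<Sum>u\<in>M. \<Sum>c<q. p c u)"
    unfolding s_def by (simp add: sum_distrib_left[symmetric] sum.swap[of _ _ M])
  also have "\<dots> \<le> 2 * (\<Sum>u\<in>M. 2)"
  proof (intro mult_left_mono sum_mono)
    fix u assume "u \<in> M"
    have "(\<Sum>c<q. p c u) = (\<Sum>c\<in>L u. p c u)"
      using assms(5)[of u] by (intro sum.mono_neutral_right) (auto simp: p_def)
    also have "\<dots> \<le> (\<Sum>c\<in>L u. 2 / real (card (L u)))" by (intro sum_mono) (auto simp: p_def)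
    also have "\<dots> \<le> 2" by simp
    finally show "(\<Sum>c<q. p c u) \<le> 2" .
  qed auto
  also have "\<dots> \<le> q * \<mu>" using assms(2,4) by (simp add: \<mu>_def)
  finally have s: "(\<Sum>c<q. s c) \<le> q * \<mu>" .
  have "q * exp (- \<mu>) \<le> exp (- \<mu>) * (q - ((\<Sum>c<q. s c) - q * \<mu>))"
    using s by (simp add: algebra_simps)
  also have "\<dots> = (\<Sum>c<q. exp (- \<mu>) * (1 + (\<mu> - s c)))"
    by (simp add: sum_distrib_left[symmetric] sum.distrib sum_subtractf)
  also have "\<dots> \<le> (\<Sum>c<q. exp (- s c))"
  proof (rule sum_mono)
    fix c
    have "exp (- \<mu>) * (1 + (\<mu> - s c)) \<le> exp (- \<mu>) * exp (\<mu> - s c)"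
      by (intro mult_left_mono exp_ge_add_one_self) auto
    then show "exp (- \<mu>) * (1 + (\<mu> - s c)) \<le> exp (- s c)" by (simp add: mult_exp_exp)
  qed
  also have "\<dots> \<le> (\<Sum>c<q. \<Prod>u\<in>M. 1 - p c u)" by (intro sum_mono step)
  also have "\<dots> = (\<Sum>c<q. \<Prod>u\<in>M. if t < card (L u) \<and> c \<in> L u then 1 - 2 / real (card (L u)) else 1)"
    by (intro sum.cong prod.cong refl) (simp add: p_def)
  finally show ?thesis by (simp add: \<mu>_def)
qed

text \<open>Rosenfeld's counting method, following Hurley and Pirot: adding a vertex multiplies the
  number of proper colourings by at least \<open>R\<close>. Inductively, few colourings leave fewer than \<open>t\<close>
  colours for a given neighbour of \<open>v\<close>; such neighbours, and those with many common neighbours with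
  \<open>v\<close>, cost one colour each.\<close>

lemma card_colorings_insert_ge:
  fixes t R H :: real and q \<Delta> D :: nat and V :: "'a set"
  assumes fin: "finite V" and adj: "symp adj" "irreflp adj"
    and deg: "\<And>v. v \<in> V \<Longrightarrow> card {w \<in> V. adj v w} \<le> \<Delta>"
    and hubs: "\<And>v. v \<in> V \<Longrightarrow> card {u \<in> V. adj v u \<and> card {w \<in> V. adj v w \<and> adj u w} > D} \<le> H"
    and t: "t \<ge> 4" "2 * D \<le> t" and R: "R > 0" and q: "q > 0"
    and bound: "q * exp (- (4 * \<Delta> / q)) - H - \<Delta> * (t / R) \<ge> R"
    and X: "X \<subseteq> V" "v \<in> V - X"
  shows "R * card (colorings adj q X) \<le> card (colorings adj q (insert v X))"
  using finite_subset[OF X(1) fin] X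
\<comment> \<open>The ratio is needed for every smaller set and every new vertex:
  \<open>small\<close> applies it to \<open>X - {u}\<close> and \<open>u\<close>.\<close>
proof (induction X arbitrary: v rule: finite_psubset_induct)
  case (psubset X)
  let ?C = "colorings adj q"
  have X: "finite X" "X \<subseteq> V" "v \<in> V" "v \<notin> X" using psubset.hyps psubset.prems by auto
  define Nv where "Nv = {u \<in> X. adj v u}"
  define Hb where "Hb = {u \<in> Nv. card {w \<in> V. adj v w \<and> adj u w} > D}"
  define N where "N = Nv - Hb"
  define L where "L = (\<lambda>\<phi> u. avail adj q (X - N) \<phi> u)"
  let ?free = "\<lambda>\<phi> c. of_bool (\<forall>u\<in>N. t < card (L \<phi> u) \<longrightarrow> \<phi> u \<noteq> c) :: real"
  have fins: "finite Nv" "finite Hb" "finite N" and NX: "N \<subseteq> X"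
    using X(1) by (auto simp: Nv_def Hb_def N_def)
  have cardN: "card N \<le> \<Delta>"
  proof -
    have "card N \<le> card {w \<in> V. adj v w}"
      by (intro card_mono) (use X fin in \<open>auto simp: N_def Nv_def\<close>)
    then show ?thesis using deg[OF X(3)] by simp
  qed
  have cardHb: "card Hb \<le> H"
  proof -
    have "card Hb \<le> card {u \<in> V. adj v u \<and> card {w \<in> V. adj v w \<and> adj u w} > D}"
      by (intro card_mono) (use X fin in \<open>auto simp: Hb_def Nv_def\<close>)
    then show ?thesis using hubs[OF X(3)] by linarith
  qed
  have degN: "real (card {z \<in> N. adj u z}) \<le> t / 2" if "u \<in> N" for u
  proof -
    have "card {z \<in> N. adj u z} \<le> card {w \<in> V. adj v w \<and> adj u w}"
      by (intro card_mono) (use X fin in \<open>auto simp: N_def Nv_def\<close>)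
    also have "\<dots> \<le> D" using that by (auto simp: N_def Hb_def)
    finally show ?thesis using t(2) by linarith
  qed
  \<comment> \<open>If at most \<open>t\<close> colours are left for \<open>u\<close>, a colouring
    of \<open>X - {u}\<close> has at most \<open>t\<close> extensions to \<open>u\<close>, whereas
    by induction there are at least \<open>R\<close> on average.\<close>
  have small: "(\<Sum>\<phi>\<in>?C X. of_bool (card (L \<phi> u) \<le> t)) \<le> t / R * card (?C X)" if u: "u \<in> N" for u
  proof -
    define Z where "Z = X - {u}"
    have Z: "finite Z" "u \<notin> Z" "X = insert u Z" "X - N \<subseteq> Z" "Z \<subset> X" "Z \<subseteq> V" "u \<in> V - Z"
      using X u NX by (auto simp: Z_def)
    have "(\<Sum>\<phi>\<in>?C X. of_bool (card (L \<phi> u) \<le> t)) \<le> (\<Sum>\<phi>\<in>?C X. of_bool (card (avail adj q Z \<phi> u) \<le> t) :: real)"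
    proof (intro sum_mono)
      fix \<phi>
      have "card (avail adj q Z \<phi> u) \<le> card (L \<phi> u)"
        unfolding L_def by (intro card_mono avail_antimono Z) auto
      then show "of_bool (card (L \<phi> u) \<le> t) \<le> (of_bool (card (avail adj q Z \<phi> u) \<le> t) :: real)" by auto
    qed
    also have "\<dots> = (\<Sum>\<psi>\<in>?C Z. \<Sum>c\<in>avail adj q Z \<psi> u. of_bool (card (avail adj q Z \<psi> u) \<le> t))"
      unfolding Z(3) sum_colorings_insert[OF Z(1,2) adj] using Z(2) by simp
    also have "\<dots> \<le> (\<Sum>\<psi>\<in>?C Z. t)" using t by (intro sum_mono) (auto simp: of_bool_def)
    also have "\<dots> = t / R * (R * card (?C Z))" using R by simp
    also have "\<dots> \<le> t / R * card (?C X)"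
      using psubset.IH[OF Z(5,6,7)] t R unfolding Z(3)[symmetric] by (intro mult_left_mono) auto
    finally show ?thesis .
  qed
  have pointwise: "(\<Sum>c<q. ?free \<phi> c) - H - (\<Sum>u\<in>N. of_bool (card (L \<phi> u) \<le> t))
       \<le> real (card (avail adj q X \<phi> v))" for \<phi>
  proof -
    define G where "G = {c \<in> {..<q}. \<forall>u\<in>N. t < card (L \<phi> u) \<longrightarrow> \<phi> u \<noteq> c}"
    define Sm where "Sm = {u \<in> N. card (L \<phi> u) \<le> t}"
    have "G \<subseteq> avail adj q X \<phi> v \<union> \<phi> ` Hb \<union> \<phi> ` Sm"
      by (force simp: G_def Sm_def avail_def N_def Nv_def)
    then have "card G \<le> card (avail adj q X \<phi> v \<union> \<phi> ` Hb \<union> \<phi> ` Sm)"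
      using fins by (intro card_mono) (auto simp: Sm_def)
    also have "\<dots> \<le> card (avail adj q X \<phi> v) + card (\<phi> ` Hb) + card (\<phi> ` Sm)"
      by (meson add_le_mono1 card_Un_le order_trans)
    also have "\<dots> \<le> card (avail adj q X \<phi> v) + card Hb + card Sm"
      using fins by (intro add_mono card_image_le) (auto simp: Sm_def)
    finally have "real (card G) \<le> card (avail adj q X \<phi> v) + H + card Sm" using cardHb by linarith
    moreover have "(\<Sum>c<q. ?free \<phi> c) = real (card G)"
      by (simp add: G_def of_bool_def sum.If_cases Int_def)
    moreover have "(\<Sum>u\<in>N. of_bool (card (L \<phi> u) \<le> t)) = real (card Sm)"
      using fins by (simp add: Sm_def of_bool_def sum.If_cases Int_def)
    ultimately show ?thesis by linarith
  qed
  define Pr where "Pr = (\<lambda>\<phi> c. \<Prod>u\<in>N. if t < card (L \<phi> u) \<and> c \<in> L \<phi> u then 1 - 2 / real (card (L \<phi> u)) else 1)"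
  have "(\<Sum>\<phi>\<in>?C X. q * exp (- (4 * \<Delta> / q))) \<le> (\<Sum>\<phi>\<in>?C X. \<Sum>c<q. Pr \<phi> c)"
    unfolding Pr_def using fins cardN t q
    by (intro sum_mono sum_prod_lists_ge) (auto simp: L_def avail_def)
  also have "\<dots> = (\<Sum>c<q. \<Sum>\<phi>\<in>?C X. Pr \<phi> c)" by (rule sum.swap)
  also have "\<dots> \<le> (\<Sum>c<q. \<Sum>\<phi>\<in>?C X. ?free \<phi> c)"
  proof (rule sum_mono)
    fix c
    show "(\<Sum>\<phi>\<in>?C X. Pr \<phi> c) \<le> (\<Sum>\<phi>\<in>?C X. ?free \<phi> c)"
      using sum_colorings_avoid[OF X(1) NX adj degN t(1) fins(3) order_refl, of "\<lambda>_. 1" q c]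
      unfolding Pr_def L_def by simp
  qed
  also have "\<dots> = (\<Sum>\<phi>\<in>?C X. \<Sum>c<q. ?free \<phi> c)" by (rule sum.swap)
  finally have A: "card (?C X) * (q * exp (- (4 * \<Delta> / q)))
      \<le> (\<Sum>\<phi>\<in>?C X. \<Sum>c<q. ?free \<phi> c)" by simp
  have B: "(\<Sum>\<phi>\<in>?C X. \<Sum>u\<in>N. of_bool (card (L \<phi> u) \<le> t)) \<le> card (?C X) * (\<Delta> * (t / R))"
  proof -
    have "(\<Sum>\<phi>\<in>?C X. \<Sum>u\<in>N. of_bool (card (L \<phi> u) \<le> t)) = (\<Sum>u\<in>N. \<Sum>\<phi>\<in>?C X. of_bool (card (L \<phi> u) \<le> t) :: real)"
      by (rule sum.swap)
    also have "\<dots> \<le> (\<Sum>u\<in>N. t / R * card (?C X))" by (intro sum_mono small)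
    also have "\<dots> = card N * (t / R * card (?C X))" by simp
    also have "\<dots> \<le> \<Delta> * (t / R * card (?C X))" using cardN t R by (intro mult_right_mono) auto
    finally show ?thesis by (simp add: mult_ac)
  qed
  have "R * card (?C X) \<le> (q * exp (- (4 * \<Delta> / q)) - H - \<Delta> * (t / R)) * card (?C X)"
    using bound by (intro mult_right_mono) auto
  also have "\<dots> \<le> (\<Sum>\<phi>\<in>?C X. \<Sum>c<q. ?free \<phi> c) - H * card (?C X)
      - (\<Sum>\<phi>\<in>?C X. \<Sum>u\<in>N. of_bool (card (L \<phi> u) \<le> t))"
  proof -
    have "(q * exp (- (4 * \<Delta> / q)) - H - \<Delta> * (t / R)) * card (?C X) = card (?C X) * (q * exp (- (4 * \<Delta> / q)))
        - H * card (?C X) - card (?C X) * (\<Delta> * (t / R))"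
      unfolding left_diff_distrib by (simp only: mult.commute)
    moreover have "a = p - h - r \<Longrightarrow> p \<le> s1 \<Longrightarrow> s2 \<le> r \<Longrightarrow> a \<le> s1 - h - s2" for a p h r s1 s2 :: real
      by linarith
    ultimately show ?thesis using A B by blast
  qed
  also have "\<dots> = (\<Sum>\<phi>\<in>?C X. (\<Sum>c<q. ?free \<phi> c) - H
      - (\<Sum>u\<in>N. of_bool (card (L \<phi> u) \<le> t)))"
    by (simp add: sum_subtractf mult_ac)
  also have "\<dots> \<le> (\<Sum>\<phi>\<in>?C X. real (card (avail adj q X \<phi> v)))" by (intro sum_mono pointwise)
  also have "\<dots> = real (card (?C (insert v X)))"
    using sum_colorings_insert[OF X(1,4) adj, of "\<lambda>_. 1" q] by simp
  finally show ?case .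
qed

corollary coloring_exists:
  fixes t R H :: real and q \<Delta> D :: nat and V :: "'a set"
  assumes fin: "finite V" and adj: "symp adj" "irreflp adj"
    and deg: "\<And>v. v \<in> V \<Longrightarrow> card {w \<in> V. adj v w} \<le> \<Delta>"
    and hubs: "\<And>v. v \<in> V \<Longrightarrow> card {u \<in> V. adj v u \<and> card {w \<in> V. adj v w \<and> adj u w} > D} \<le> H"
    and t: "t \<ge> 4" "2 * D \<le> t" and R: "R > 0" and q: "q > 0"
    and bound: "q * exp (- (4 * \<Delta> / q)) - H - \<Delta> * (t / R) \<ge> R"
  shows "\<exists>f \<in> V \<rightarrow> {..<q}. \<forall>u\<in>V. \<forall>v\<in>V. adj u v \<longrightarrow> f u \<noteq> f v"
proof -
  have "finite X \<Longrightarrow> X \<subseteq> V \<Longrightarrow> card (colorings adj q X) > 0" for X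
  proof (induction X rule: finite_induct)
    case empty
    then show ?case by (simp add: colorings_def)
  next
    case (insert v X)
    then have "R * card (colorings adj q X) \<le> card (colorings adj q (insert v X))"
      by (intro card_colorings_insert_ge[OF assms]) auto
    moreover have "R * card (colorings adj q X) > 0" using insert R by simp
    ultimately show ?case by simp
  qed
  from this[OF fin order_refl] obtain f where "f \<in> colorings adj q V"
    by (metis card_gt_0_iff ex_in_conv)
  then show ?thesis by (auto simp: colorings_def)
qed


section \<open>Neighbourhoods in box-Delaunay graphs\<close>

definition mid :: "real \<Rightarrow> real \<Rightarrow> real \<Rightarrow> bool" where
  "mid a b c \<longleftrightarrow> (a \<le> b \<and> b \<le> c) \<or> (c \<le> b \<and> b \<le> a)"

text \<open>Coordinates as functions make the exchange of the two axes a mere substitution, which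
  halves the case analysis in \<open>card_nb_edges_le\<close>.\<close>

definition empty_box :: "'i set \<Rightarrow> ('i \<Rightarrow> real) \<Rightarrow> ('i \<Rightarrow> real) \<Rightarrow> 'i \<Rightarrow> 'i \<Rightarrow> bool" where
  "empty_box P x y p q \<longleftrightarrow> p \<noteq> q \<and> (\<forall>r\<in>P. mid (x p) (x r) (x q) \<longrightarrow> mid (y p) (y r) (y q) \<longrightarrow> r = p \<or> r = q)"

lemma empty_box_swap_axes: "empty_box P x y p q \<longleftrightarrow> empty_box P y x p q"
  by (auto simp: empty_box_def)

lemma empty_box_sym: "empty_box P x y p q \<longleftrightarrow> empty_box P x y q p"
proof -
  have "mid a b c \<longleftrightarrow> mid c b a" for a b c by (auto simp: mid_def)
  then show ?thesis unfolding empty_box_def by blast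
qed

definition nb :: "'i set \<Rightarrow> ('i \<Rightarrow> real) \<Rightarrow> ('i \<Rightarrow> real) \<Rightarrow> 'i \<Rightarrow> 'i set" where
  "nb P x y v = {w \<in> P. empty_box P x y v w}"

lemma nb_swap_axes: "nb P x y v = nb P y x v"
  by (simp add: nb_def empty_box_swap_axes[of P x])

definition quad :: "'i set \<Rightarrow> ('i \<Rightarrow> real) \<Rightarrow> ('i \<Rightarrow> real) \<Rightarrow> real \<Rightarrow> real \<Rightarrow> 'i \<Rightarrow> 'i set" where
  "quad P x y sx sy v = {q \<in> P. sx * x v < sx * x q \<and> sy * y v < sy * y q}"

lemma quad_swap_axes: "quad P x y sx sy v = quad P y x sy sx v"
  by (auto simp: quad_def)

lemma mid_scale:
  assumes "s = 1 \<or> s = - (1 :: real)"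
  shows "mid (s * a) (s * b) (s * c) \<longleftrightarrow> mid a b c"
  using assms by (auto simp: mid_def)

lemma nb_subset_quads:
  assumes "inj_on x P" "inj_on y P" "v \<in> P"
  shows "nb P x y v \<subseteq> (\<Union>sx\<in>{1, -1}. \<Union>sy\<in>{1, -1}. quad P x y sx sy v)"
proof
  fix q assume "q \<in> nb P x y v"
  then have q: "q \<in> P" "q \<noteq> v" by (auto simp: nb_def empty_box_def)
  then have "x q \<noteq> x v" "y q \<noteq> y v" using assms by (auto dest: inj_onD)
  then show "q \<in> (\<Union>sx\<in>{1, -1}. \<Union>sy\<in>{1, -1}. quad P x y sx sy v)"
    using q by (auto simp: quad_def not_less)
qed

text \<open>A point of the quadrant that precedes \<open>q\<close> along the first axis without
  being farther along the second would lie in the box of \<open>v\<close> and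
  \<open>q\<close>.\<close>

lemma nb_quad_subset_stair:
  assumes "sx = 1 \<or> sx = -1" "sy = 1 \<or> sy = -1" "inj_on y P"
  shows "nb P x y v \<inter> quad P x y sx sy v \<subseteq> stair P x y sx sy v"
proof
  fix q assume q: "q \<in> nb P x y v \<inter> quad P x y sx sy v"
  have "sy * y q < sy * y r" if r: "r \<in> P" "sx * x v < sx * x r" "sx * x r < sx * x q" "sy * y v < sy * y r" for r
  proof (rule ccontr)
    assume "\<not> sy * y q < sy * y r"
    then have "mid (sy * y v) (sy * y r) (sy * y q)" "mid (sx * x v) (sx * x r) (sx * x q)"
      using r by (auto simp: mid_def)
    then have "r = v \<or> r = q" using q r mid_scale[OF assms(1)] mid_scale[OF assms(2)]
      by (auto simp: nb_def empty_box_def)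
    then show False using r by auto
  qed
  then show "q \<in> stair P x y sx sy v" using q by (auto simp: stair_def quad_def)
qed

lemma card_nb_le:
  assumes "finite P" "inj_on x P" "inj_on y P" "v \<in> P"
    and "\<And>sx sy. sx \<in> {1, -1} \<Longrightarrow> sy \<in> {1, -1} \<Longrightarrow> card (stair P x y sx sy v) \<le> t"
  shows "card (nb P x y v) \<le> 4 * t"
proof -
  have "nb P x y v \<subseteq> (\<Union>sx\<in>{1, -1}. \<Union>sy\<in>{1, -1}. stair P x y sx sy v)"
  proof
    fix q assume q: "q \<in> nb P x y v"
    then obtain sx sy where s: "sx \<in> {1, -1 :: real}" "sy \<in> {1, -1 :: real}" "q \<in> quad P x y sx sy v"
      using nb_subset_quads[OF assms(2-4)] by blast
    then have "q \<in> stair P x y sx sy v"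
      using nb_quad_subset_stair[OF _ _ assms(3), of sx sy x v] q by auto
    then show "q \<in> (\<Union>sx\<in>{1, -1}. \<Union>sy\<in>{1, -1}. stair P x y sx sy v)" using s by blast
  qed
  then have "card (nb P x y v) \<le> card (\<Union>sx\<in>{1, -1}. \<Union>sy\<in>{1, -1}. stair P x y sx sy v)"
    by (rule card_mono[rotated]) (use assms(1) in \<open>auto simp: stair_def\<close>)
  also have "\<dots> \<le> (\<Sum>sx\<in>{1, -1}. card (\<Union>sy\<in>{1, -1}. stair P x y sx sy v))" by (rule card_UN_le) simp
  also have "\<dots> \<le> (\<Sum>sx\<in>{1, -1 :: real}. \<Sum>sy\<in>{1, -1 :: real}. card (stair P x y sx sy v))"
    by (intro sum_mono card_UN_le) simp
  also have "\<dots> \<le> (\<Sum>sx\<in>{1, -1 :: real}. \<Sum>sy\<in>{1, -1 :: real}. t)" using assms(5) by (intro sum_mono) auto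
  finally show ?thesis by simp
qed

text \<open>An edge between two neighbours of \<open>v\<close> lying on the same side of \<open>v\<close> along the first axis is
  charged to the endpoint \<open>w\<close> farther from \<open>v\<close> along that axis: of two candidates in one quadrant for the
  other endpoint, the one closer to \<open>w\<close> would lie in the box of the other one and \<open>w\<close>.\<close>

lemma charged_unique:
  assumes sx: "sx = 1 \<or> sx = -1" and sy: "sy = 1 \<or> sy = -1" and "inj_on x P" "inj_on y P" "v \<in> P"
    and w: "w \<in> nb P x y v"
    and u: "u \<in> nb P x y v" "u \<in> quad P x y sx sy v" "empty_box P x y u w" "sx * x u < sx * x w"
    and u': "u' \<in> nb P x y v" "u' \<in> quad P x y sx sy v" "empty_box P x y u' w" "sx * x u' < sx * x w"
  shows "\<not> sx * x u < sx * x u'"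
proof
  assume lt: "sx * x u < sx * x u'"
  define X where "X = (\<lambda>i. sx * x i)"
  define Y where "Y = (\<lambda>i. sy * y i)"
  have inP: "u \<in> P" "u' \<in> P" "w \<in> P" "w \<noteq> v" using u u' w by (auto simp: nb_def empty_box_def)
  have ord: "X v < X u" "X u < X u'" "X u' < X w" "Y v < Y u" "Y v < Y u'"
    using lt u(2) u'(2,4) by (auto simp: X_def Y_def quad_def)
  have eb: "r = p \<or> r = q" if "empty_box P x y p q" "r \<in> P" "mid (X p) (X r) (X q)" "mid (Y p) (Y r) (Y q)" for p q r
    using that mid_scale[OF sx] mid_scale[OF sy] by (auto simp: empty_box_def X_def Y_def)
  have nv: "empty_box P x y v u'" "empty_box P x y v w" using u' w by (auto simp: nb_def)
  \<comment> \<open>Emptiness of the boxes of \<open>v\<close> with \<open>u'\<close> and with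
    \<open>w\<close> forces Y w < Y u' < Y u, which puts \<open>u'\<close> into the box of
    \<open>u\<close> and \<open>w\<close>. Here \<open>w\<close> may lie on the other side of
    \<open>v\<close> along the second axis.\<close>
  have 1: "Y u' < Y u"
  proof (rule ccontr)
    assume "\<not> Y u' < Y u"
    then have "u = v \<or> u = u'" using ord by (intro eb[OF nv(1) inP(1)]) (auto simp: mid_def)
    then show False using ord by auto
  qed
  have 2: "Y w < Y u'"
  proof (rule ccontr)
    assume "\<not> Y w < Y u'"
    then have "u' = v \<or> u' = w" using ord by (intro eb[OF nv(2) inP(2)]) (auto simp: mid_def)
    then show False using ord by auto
  qed
  have "u' = u \<or> u' = w" using ord 1 2 by (intro eb[OF u(3) inP(2)]) (auto simp: mid_def)
  then show False using ord by auto
qed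

definition charged :: "'i set \<Rightarrow> ('i \<Rightarrow> real) \<Rightarrow> ('i \<Rightarrow> real) \<Rightarrow> 'i \<Rightarrow> real \<Rightarrow> real \<Rightarrow> ('i \<times> 'i) set" where
  "charged P x y v sx sy = {(u, w). u \<in> nb P x y v \<and> w \<in> nb P x y v \<and> u \<in> quad P x y sx sy v \<and>
     empty_box P x y u w \<and> sx * x u < sx * x w}"

lemma card_charged_le:
  assumes "finite P" "sx = 1 \<or> sx = -1" "sy = 1 \<or> sy = -1" "inj_on x P" "inj_on y P" "v \<in> P"
  shows "card (charged P x y v sx sy) \<le> card (nb P x y v)"
proof (rule card_inj_on_le)
  show "inj_on snd (charged P x y v sx sy)"
  proof (rule inj_onI)
    fix p p' assume p: "p \<in> charged P x y v sx sy" "p' \<in> charged P x y v sx sy" "snd p = snd p'"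
    obtain u u' w where uw: "p = (u, w)" "p' = (u', w)" using p(3) by (metis prod.collapse)
    have "\<not> sx * x u < sx * x u'" "\<not> sx * x u' < sx * x u"
      using p(1,2) uw charged_unique[OF assms(2-6), of w] by (auto simp: charged_def)
    then have "x u = x u'" using assms(2) by auto
    then have "u = u'" using p(1,2) uw assms(4) by (auto simp: charged_def nb_def dest: inj_onD)
    then show "p = p'" using uw by simp
  qed
qed (use assms(1) in \<open>auto simp: charged_def nb_def\<close>)

text \<open>Two adjacent neighbours of \<open>v\<close> are never in opposite quadrants, as
  \<open>v\<close> would lie in their box, so they are on the same side of \<open>v\<close> along
  some axis and their edge is charged. The constant is 2 axes times 4 quadrants times 2
  orientations.\<close>

lemma card_nb_edges_le:
  assumes "finite P" "inj_on x P" "inj_on y P" "v \<in> P"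
  shows "card {(u, w). u \<in> nb P x y v \<and> w \<in> nb P x y v \<and> empty_box P x y u w} \<le> 16 * card (nb P x y v)"
proof -
  let ?N = "nb P x y v"
  let ?s = "{1, -1} :: real set"
  define A where "A = (\<Union>sx\<in>?s. \<Union>sy\<in>?s. charged P x y v sx sy)"
  define B where "B = (\<Union>sx\<in>?s. \<Union>sy\<in>?s. charged P y x v sx sy)"
  have fin: "finite (charged P x y v sx sy)" "finite (charged P y x v sx sy)" for sx sy
    using assms(1) by (auto simp: charged_def nb_def intro: finite_subset[of _ "P \<times> P"])
  have cA: "card A \<le> 4 * card ?N"
  proof -
    have "card A \<le> (\<Sum>sx\<in>?s. \<Sum>sy\<in>?s. card (charged P x y v sx sy))" unfolding A_def
      by (rule order.trans[OF card_UN_le sum_mono[OF card_UN_le]]) auto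
    also have "\<dots> \<le> (\<Sum>sx\<in>?s. \<Sum>sy\<in>?s. card ?N)"
      using assms by (intro sum_mono card_charged_le) auto
    finally show ?thesis by simp
  qed
  have cB: "card B \<le> 4 * card ?N"
  proof -
    have "card B \<le> (\<Sum>sx\<in>?s. \<Sum>sy\<in>?s. card (charged P y x v sx sy))" unfolding B_def
      by (rule order.trans[OF card_UN_le sum_mono[OF card_UN_le]]) auto
    also have "\<dots> \<le> (\<Sum>sx\<in>?s. \<Sum>sy\<in>?s. card ?N)"
      unfolding nb_swap_axes[of P x] using assms by (intro sum_mono card_charged_le) auto
    finally show ?thesis by simp
  qed
  have sub: "{(u, w). u \<in> ?N \<and> w \<in> ?N \<and> empty_box P x y u w} \<subseteq> (A \<union> B) \<union> prod.swap ` (A \<union> B)"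
  proof
    fix p assume "p \<in> {(u, w). u \<in> ?N \<and> w \<in> ?N \<and> empty_box P x y u w}"
    then obtain u w where p: "p = (u, w)" and uw: "u \<in> ?N" "w \<in> ?N" "empty_box P x y u w" by auto
    have wu: "empty_box P x y w u" using uw(3) empty_box_sym by metis
    have inP: "u \<in> P" "w \<in> P" "u \<noteq> w" "u \<noteq> v" "w \<noteq> v" using uw by (auto simp: nb_def empty_box_def)
    have ne: "x u \<noteq> x w" "y u \<noteq> y w" using inP assms(2,3) by (auto dest: inj_onD)
    obtain sx sy where s: "sx \<in> ?s" "sy \<in> ?s" "u \<in> quad P x y sx sy v"
      using nb_subset_quads[OF assms(2-4)] uw(1) by blast
    obtain tx ty where t: "tx \<in> ?s" "ty \<in> ?s" "w \<in> quad P x y tx ty v"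
      using nb_subset_quads[OF assms(2-4)] uw(2) by blast
    have "sx = tx \<or> sy = ty"
    proof (rule ccontr)
      assume "\<not> (sx = tx \<or> sy = ty)"
      then have "mid (x u) (x v) (x w)" "mid (y u) (y v) (y w)" using s t by (auto simp: quad_def mid_def)
      then show False using uw(3) assms(4) inP by (auto simp: empty_box_def)
    qed
    then show "p \<in> (A \<union> B) \<union> prod.swap ` (A \<union> B)"
    proof
      assume eq: "sx = tx"
      have "sx * x u < sx * x w \<or> sx * x w < sx * x u" using s(1) ne by auto
      then have "(u, w) \<in> A \<or> (w, u) \<in> A"
        using s t uw wu eq unfolding A_def charged_def by blast
      then show ?thesis using p by (auto intro: image_eqI[of _ _ "(w, u)"])
    next
      assume eq: "sy = ty"
      have "sy * y u < sy * y w \<or> sy * y w < sy * y u" using s(2) ne by auto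
      moreover have "u \<in> nb P y x v" "w \<in> nb P y x v" "empty_box P y x u w" "empty_box P y x w u"
        "u \<in> quad P y x sy sx v" "w \<in> quad P y x ty tx v"
        using uw wu s t nb_swap_axes[of P x] empty_box_swap_axes[of P x] quad_swap_axes[of P x] by metis+
      ultimately have "(u, w) \<in> B \<or> (w, u) \<in> B"
        using s t eq unfolding B_def charged_def by blast
      then show ?thesis using p by (auto intro: image_eqI[of _ _ "(w, u)"])
    qed
  qed
  have finAB: "finite (A \<union> B)" unfolding A_def B_def using fin by auto
  then have "card {(u, w). u \<in> ?N \<and> w \<in> ?N \<and> empty_box P x y u w} \<le> card ((A \<union> B) \<union> prod.swap ` (A \<union> B))"
    by (intro card_mono sub) auto
  also have "\<dots> \<le> card (A \<union> B) + card (A \<union> B)"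
    using card_Un_le card_image_le[OF finAB, of prod.swap] by (meson add_left_mono order_trans)
  also have "card (A \<union> B) \<le> 8 * card ?N" using card_Un_le[of A B] cA cB by linarith
  finally show ?thesis by linarith
qed

text \<open>Every hub is the first entry of more than \<open>D\<close> of the ordered pairs counted
  by \<open>card_nb_edges_le\<close>.\<close>

lemma card_hubs_le:
  assumes "finite P" "inj_on x P" "inj_on y P" "v \<in> P"
  shows "card {u \<in> P. empty_box P x y v u \<and> card {w \<in> P. empty_box P x y v w \<and> empty_box P x y u w} > D} * D
    \<le> 16 * card (nb P x y v)"
proof -
  let ?N = "nb P x y v"
  define Hb where "Hb = {u \<in> P. empty_box P x y v u \<and> card {w \<in> P. empty_box P x y v w \<and> empty_box P x y u w} > D}"
  define C where "C = (\<lambda>u. {w \<in> ?N. empty_box P x y u w})"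
  have fin: "finite Hb" "finite (C u)" for u using assms(1) by (auto simp: Hb_def C_def nb_def)
  have "card Hb * D \<le> (\<Sum>u\<in>Hb. card (C u))"
    by (rule sum_bounded_below[where 'a = nat, simplified]) (auto simp: Hb_def C_def nb_def conj_assoc)
  also have "\<dots> = card (Sigma Hb C)" using fin by simp
  also have "\<dots> \<le> card {(u, w). u \<in> ?N \<and> w \<in> ?N \<and> empty_box P x y u w}"
  proof (rule card_mono)
    show "finite {(u, w). u \<in> ?N \<and> w \<in> ?N \<and> empty_box P x y u w}"
      by (rule finite_subset[of _ "P \<times> P"]) (auto simp: nb_def assms(1))
  qed (auto simp: Hb_def C_def nb_def)
  also have "\<dots> \<le> 16 * card ?N" by (rule card_nb_edges_le[OF assms])
  finally show ?thesis by (simp add: Hb_def)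
qed

lemma box_coloring_exists:
  fixes t R :: real and q \<Delta> D :: nat
  assumes fin: "finite P" and inj: "inj_on x P" "inj_on y P"
    and stair: "\<And>v sx sy. v \<in> P \<Longrightarrow> sx \<in> {1, -1} \<Longrightarrow> sy \<in> {1, -1} \<Longrightarrow> 4 * card (stair P x y sx sy v) \<le> \<Delta>"
    and t: "t \<ge> 4" "2 * D \<le> t" and R: "R > 0" and q: "q > 0" and D: "D > 0"
    and bound: "q * exp (- (4 * \<Delta> / q)) - 16 * \<Delta> / D - \<Delta> * (t / R) \<ge> R"
  shows "\<exists>f \<in> P \<rightarrow> {..<q}. \<forall>u\<in>P. \<forall>v\<in>P. empty_box P x y u v \<longrightarrow> f u \<noteq> f v"
proof (rule coloring_exists[OF fin _ _ _ _ t R q bound])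
  have nb: "card (nb P x y v) \<le> \<Delta>" if "v \<in> P" for v
  proof -
    have "card (nb P x y v) \<le> 4 * (\<Delta> div 4)"
    proof (rule card_nb_le[OF fin inj that])
      fix sx sy :: real assume "sx \<in> {1, -1}" "sy \<in> {1, -1}"
      then show "card (stair P x y sx sy v) \<le> \<Delta> div 4"
        using stair[OF that] by (simp add: less_eq_div_iff_mult_less_eq mult.commute)
    qed
    then show ?thesis by simp
  qed
  show "symp (empty_box P x y)" by (rule sympI) (rule empty_box_sym[THEN iffD1])
  show "irreflp (empty_box P x y)" by (auto simp: irreflp_def empty_box_def)
  show "card {w \<in> P. empty_box P x y v w} \<le> \<Delta>" if "v \<in> P" for v
    using nb[OF that] unfolding nb_def .
  show "real (card {u \<in> P. empty_box P x y v u \<and> D < card {w \<in> P. empty_box P x y v w \<and> empty_box P x y u w}}) \<le> 16 * \<Delta> / D"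
    (is "real ?H \<le> _") if "v \<in> P" for v
  proof -
    have "?H * D \<le> 16 * \<Delta>" using card_hubs_le[OF fin inj that, of D] nb[OF that] by linarith
    then have "real (?H * D) \<le> real (16 * \<Delta>)" by (rule of_nat_mono)
    then have "real ?H * D \<le> 16 * real \<Delta>" by (simp only: of_nat_mult of_nat_numeral)
    then show ?thesis using D by (simp only: pos_le_divide_eq of_nat_0_less_iff)
  qed
qed


section \<open>Graph parameters\<close>

text \<open>A box containing \<open>p\<close> and \<open>q\<close> contains their bounding box, so
  only the latter has to be tested.\<close>

lemma edge_box_delaunay_iff:
  fixes P :: "(real ^ 2) set"
  shows "{p, q} \<in> snd (box_delaunay_graph P) \<longleftrightarrow> p \<in> P \<and> q \<in> P \<and> empty_box P (\<lambda>p. p $ 1) (\<lambda>p. p $ 2) p q"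
proof -
  have box: "(\<exists>a b. cbox a b \<inter> P = {p, q}) \<longleftrightarrow>
      (\<forall>r\<in>P. mid (p $ 1) (r $ 1) (q $ 1) \<longrightarrow> mid (p $ 2) (r $ 2) (q $ 2) \<longrightarrow> r = p \<or> r = q)"
    if pq: "p \<in> P" "q \<in> P" for p q :: "real ^ 2"
  proof
    assume "\<exists>a b. cbox a b \<inter> P = {p, q}"
    then obtain a b where ab: "cbox a b \<inter> P = {p, q}" by auto
    show "\<forall>r\<in>P. mid (p $ 1) (r $ 1) (q $ 1) \<longrightarrow> mid (p $ 2) (r $ 2) (q $ 2) \<longrightarrow> r = p \<or> r = q"
    proof (intro ballI impI)
      fix r assume r: "r \<in> P" "mid (p $ 1) (r $ 1) (q $ 1)" "mid (p $ 2) (r $ 2) (q $ 2)"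
      have "p \<in> cbox a b" "q \<in> cbox a b" using ab by auto
      then have "r \<in> cbox a b" using r by (auto simp: mem_box_cart forall_2 mid_def)
      then show "r = p \<or> r = q" using ab r by auto
    qed
  next
    assume H: "\<forall>r\<in>P. mid (p $ 1) (r $ 1) (q $ 1) \<longrightarrow> mid (p $ 2) (r $ 2) (q $ 2) \<longrightarrow> r = p \<or> r = q"
    let ?a = "\<chi> i. min (p $ i) (q $ i)" and ?b = "\<chi> i. max (p $ i) (q $ i)"
    have "cbox ?a ?b \<inter> P = {p, q}"
    proof (intro equalityI subsetI)
      fix r assume r: "r \<in> cbox ?a ?b \<inter> P"
      then have "mid (p $ i) (r $ i) (q $ i)" for i
        by (auto simp: mem_box_cart mid_def min_def max_def dest: spec[of _ i] split: if_splits)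
      then show "r \<in> {p, q}" using H r by auto
    qed (use pq in \<open>auto simp: mem_box_cart\<close>)
    then show "\<exists>a b. cbox a b \<inter> P = {p, q}" by blast
  qed
  have sym: "empty_box P (\<lambda>p. p $ 1) (\<lambda>p. p $ 2) q' p'" if "empty_box P (\<lambda>p. p $ 1) (\<lambda>p. p $ 2) p' q'" for p' q'
    using that empty_box_sym by metis
  show ?thesis
  proof
    assume "{p, q} \<in> snd (box_delaunay_graph P)"
    then obtain p' q' where e: "{p, q} = {p', q'}" and *: "p' \<in> P" "q' \<in> P" "p' \<noteq> q'" "\<exists>a b. cbox a b \<inter> P = {p', q'}"
      by (auto simp: box_delaunay_graph_def)
    have "empty_box P (\<lambda>p. p $ 1) (\<lambda>p. p $ 2) p' q'" using * box[of p' q'] by (simp add: empty_box_def)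
    then show "p \<in> P \<and> q \<in> P \<and> empty_box P (\<lambda>p. p $ 1) (\<lambda>p. p $ 2) p q"
      using e * sym by (auto simp: doubleton_eq_iff)
  next
    assume *: "p \<in> P \<and> q \<in> P \<and> empty_box P (\<lambda>p. p $ 1) (\<lambda>p. p $ 2) p q"
    then have "p \<noteq> q" "\<exists>a b. cbox a b \<inter> P = {p, q}" using box[of p q] by (auto simp: empty_box_def)
    then show "{p, q} \<in> snd (box_delaunay_graph P)" using * unfolding box_delaunay_graph_def by auto
  qed
qed

lemma edge_hasse_iff:
  fixes P :: "'a::order set"
  shows "{p, q} \<in> snd (hasse_diagram P) \<longleftrightarrow> p \<in> P \<and> q \<in> P \<and> p \<noteq> q \<and> (p \<le> q \<or> q \<le> p) \<and>
    (\<forall>r\<in>P. (p \<le> r \<and> r \<le> q) \<or> (q \<le> r \<and> r \<le> p) \<longrightarrow> r = p \<or> r = q)" (is "?L \<longleftrightarrow> ?R")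
proof
  assume ?L
  then obtain p' q' where e: "{p, q} = {p', q'}" and *: "p' \<in> P" "q' \<in> P" "p' \<noteq> q'" "p' \<le> q'"
    "\<not> (\<exists>r \<in> P - {p', q'}. p' \<le> r \<and> r \<le> q')"
    by (auto simp: hasse_diagram_def)
  have "\<not> (q' \<le> r \<and> r \<le> p')" for r using * by (meson order.trans order_antisym)
  then show ?R using e * by (auto simp: doubleton_eq_iff)
next
  assume R: ?R
  then have "\<exists>p' q'. {p, q} = {p', q'} \<and> p' \<in> P \<and> q' \<in> P \<and> p' \<noteq> q' \<and> p' \<le> q' \<and>
    \<not> (\<exists>r \<in> P - {p', q'}. p' \<le> r \<and> r \<le> q')"
  proof (cases "p \<le> q")
    case True
    then show ?thesis using R by (intro exI[of _ p] exI[of _ q]) auto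
  next
    case False
    then show ?thesis using R by (intro exI[of _ q] exI[of _ p]) auto
  qed
  then show ?L by (simp add: hasse_diagram_def)
qed

text \<open>For comparable points the order interval is the bounding box.\<close>

lemma hasse_edge_imp_box_delaunay_edge:
  fixes P :: "(real ^ 2) set"
  assumes "{p, q} \<in> snd (hasse_diagram P)"
  shows "{p, q} \<in> snd (box_delaunay_graph P)"
proof -
  have h: "p \<in> P" "q \<in> P" "p \<noteq> q" "p \<le> q \<or> q \<le> p"
    and none: "\<And>r. r \<in> P \<Longrightarrow> (p \<le> r \<and> r \<le> q) \<or> (q \<le> r \<and> r \<le> p) \<Longrightarrow> r = p \<or> r = q"
    using assms unfolding edge_hasse_iff by auto
  have "r = p \<or> r = q" if r: "r \<in> P" "mid (p $ 1) (r $ 1) (q $ 1)" "mid (p $ 2) (r $ 2) (q $ 2)" for r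
  proof (rule none[OF r(1)])
    show "(p \<le> r \<and> r \<le> q) \<or> (q \<le> r \<and> r \<le> p)"
      using h(4) r(2,3) by (auto simp: less_eq_vec_def forall_2 mid_def)
  qed
  then show ?thesis using h unfolding edge_box_delaunay_iff empty_box_def by auto
qed

section \<open>Chromatic and independence numbers of finite graphs\<close>

lemma fst_graphs [simp]: "fst (box_delaunay_graph P) = P" "fst (hasse_diagram P') = P'"
  by (simp_all add: box_delaunay_graph_def hasse_diagram_def)

lemma chromatic_number_le:
  assumes "f \<in> fst G \<rightarrow> {..<k}" "proper_coloring G f"
  shows "chromatic_number G \<le> k"
  unfolding chromatic_number_def by (rule Least_le) (use assms in auto)

lemma finite_indep_cards:
  assumes "finite (fst G)"
  shows "finite {card S | S. S \<subseteq> fst G \<and> indep S (snd G)}"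
proof -
  have "{card S | S. S \<subseteq> fst G \<and> indep S (snd G)} \<subseteq> card ` Pow (fst G)" by auto
  then show ?thesis using assms finite_subset by blast
qed

lemma independence_number_ge:
  assumes "finite (fst G)" "S \<subseteq> fst G" "indep S (snd G)"
  shows "card S \<le> independence_number G"
  unfolding independence_number_def using assms by (intro Max_ge finite_indep_cards) auto

lemma independence_number_lt:
  assumes "finite (fst G)" "\<And>S. S \<subseteq> fst G \<Longrightarrow> card S = m \<Longrightarrow> \<not> indep S (snd G)"
  shows "independence_number G < m"
proof -
  let ?A = "{card S | S. S \<subseteq> fst G \<and> indep S (snd G)}"
  have "indep {} (snd G)" by (simp add: indep_def)
  then have "?A \<noteq> {}" by blast
  then have "independence_number G \<in> ?A"
    unfolding independence_number_def by (intro Max_in finite_indep_cards assms(1))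
  then obtain S where S: "S \<subseteq> fst G" "indep S (snd G)" "independence_number G = card S" by auto
  show ?thesis
  proof (rule ccontr)
    assume "\<not> independence_number G < m"
    then obtain T where T: "T \<subseteq> S" "card T = m" using S by (metis not_less obtain_subset_with_card_n)
    then have "indep T (snd G)" using smaller_indep S(2) by blast
    then show False using assms(2)[of T] T S(1) by auto
  qed
qed

lemma chromatic_number_coloring:
  assumes "f \<in> fst G \<rightarrow> {..<k}" "proper_coloring G f"
  obtains g where "g \<in> fst G \<rightarrow> {..<chromatic_number G}" "proper_coloring G g"
proof -
  have "\<exists>f \<in> fst G \<rightarrow> {..<chromatic_number G}. proper_coloring G f"
    unfolding chromatic_number_def by (rule LeastI[of _ k]) (use assms in auto)
  then show ?thesis using that by auto
qed

text \<open>Colour classes are independent. This turns an upper bound on either parameter into a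
  lower bound on the other.\<close>

lemma card_le_chromatic_times_independence:
  assumes "finite (fst G)" "f \<in> fst G \<rightarrow> {..<k}" "proper_coloring G f"
  shows "card (fst G) \<le> chromatic_number G * independence_number G"
proof -
  obtain g where g: "g \<in> fst G \<rightarrow> {..<chromatic_number G}" "proper_coloring G g"
    using chromatic_number_coloring assms by blast
  have "g ` fst G \<subseteq> {..<chromatic_number G}" using g(1) by blast
  then have "card (fst G) = (\<Sum>c<chromatic_number G. card {v \<in> fst G. g v = c})"
    using sum.group[of "fst G" "{..<chromatic_number G}" g "\<lambda>_. 1 :: nat"] assms(1) by simp
  also have "\<dots> \<le> (\<Sum>c<chromatic_number G. independence_number G)"
  proof (intro sum_mono independence_number_ge assms(1))
    show "indep {v \<in> fst G. g v = c} (snd G)" for c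
      unfolding indep_def
    proof (intro ballI impI notI)
      fix v w assume "v \<in> {v \<in> fst G. g v = c}" "w \<in> {v \<in> fst G. g v = c}" "{v, w} \<in> snd G"
      then show False using g(2)[unfolded proper_coloring_def, rule_format, of v w] by simp
    qed
  qed auto
  finally show ?thesis by simp
qed

text \<open>Measurability of the event needs that both graph parameters only depend on finitely many
  relations between the points, even when some of the points coincide.\<close>

lemma chromatic_number_index:
  assumes "fst G = \<omega> ` I"
  shows "chromatic_number G = (LEAST k. \<exists>g \<in> I \<rightarrow> {..<k}. \<forall>i\<in>I. \<forall>j\<in>I. {\<omega> i, \<omega> j} \<in> snd G \<longrightarrow> g i \<noteq> g j)"
proof -
  have "(\<exists>f \<in> fst G \<rightarrow> {..<k}. proper_coloring G f) \<longleftrightarrow>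
      (\<exists>g \<in> I \<rightarrow> {..<k}. \<forall>i\<in>I. \<forall>j\<in>I. {\<omega> i, \<omega> j} \<in> snd G \<longrightarrow> g i \<noteq> g j)" for k
  proof
    assume "\<exists>f \<in> fst G \<rightarrow> {..<k}. proper_coloring G f"
    then obtain f where "f \<in> fst G \<rightarrow> {..<k}" "proper_coloring G f" by auto
    then show "\<exists>g \<in> I \<rightarrow> {..<k}. \<forall>i\<in>I. \<forall>j\<in>I. {\<omega> i, \<omega> j} \<in> snd G \<longrightarrow> g i \<noteq> g j"
      using assms by (intro bexI[of _ "f \<circ> \<omega>"]) (auto simp: proper_coloring_def)
  next
    assume "\<exists>g \<in> I \<rightarrow> {..<k}. \<forall>i\<in>I. \<forall>j\<in>I. {\<omega> i, \<omega> j} \<in> snd G \<longrightarrow> g i \<noteq> g j"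
    then obtain g where g: "g \<in> I \<rightarrow> {..<k}" "\<And>i j. i \<in> I \<Longrightarrow> j \<in> I \<Longrightarrow> {\<omega> i, \<omega> j} \<in> snd G \<Longrightarrow> g i \<noteq> g j" by auto
    have inv: "inv_into I \<omega> p \<in> I" "\<omega> (inv_into I \<omega> p) = p" if "p \<in> fst G" for p
      using that assms by (auto simp: inv_into_into f_inv_into_f)
    show "\<exists>f \<in> fst G \<rightarrow> {..<k}. proper_coloring G f"
    proof (intro bexI[of _ "\<lambda>p. g (inv_into I \<omega> p)"])
      show "proper_coloring G (\<lambda>p. g (inv_into I \<omega> p))"
        unfolding proper_coloring_def using g(2) inv by metis
      show "(\<lambda>p. g (inv_into I \<omega> p)) \<in> fst G \<rightarrow> {..<k}" using g(1) inv by blast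
    qed
  qed
  then show ?thesis unfolding chromatic_number_def by simp
qed

lemma independence_number_index:
  assumes "fst G = \<omega> ` I"
  shows "independence_number G = Max {card J | J. J \<subseteq> I \<and>
    (\<forall>i\<in>J. \<forall>j\<in>J. i \<noteq> j \<longrightarrow> \<omega> i \<noteq> \<omega> j \<and> {\<omega> i, \<omega> j} \<notin> snd G)}"
proof -
  have "{card S | S. S \<subseteq> fst G \<and> indep S (snd G)} = {card J | J. J \<subseteq> I \<and>
    (\<forall>i\<in>J. \<forall>j\<in>J. i \<noteq> j \<longrightarrow> \<omega> i \<noteq> \<omega> j \<and> {\<omega> i, \<omega> j} \<notin> snd G)}" (is "?A = ?B")
  proof (intro equalityI subsetI)
    fix c assume "c \<in> ?A"
    then obtain S where S: "S \<subseteq> \<omega> ` I" "indep S (snd G)" "c = card S" using assms by auto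
    then obtain J where J: "J \<subseteq> I" "inj_on \<omega> J" "S = \<omega> ` J" by (auto simp: subset_image_inj)
    have "\<forall>i\<in>J. \<forall>j\<in>J. i \<noteq> j \<longrightarrow> \<omega> i \<noteq> \<omega> j \<and> {\<omega> i, \<omega> j} \<notin> snd G"
    proof (intro ballI impI)
      fix i j assume ij: "i \<in> J" "j \<in> J" "i \<noteq> j"
      then have "\<omega> i \<noteq> \<omega> j" using J(2) by (auto dest: inj_onD)
      then show "\<omega> i \<noteq> \<omega> j \<and> {\<omega> i, \<omega> j} \<notin> snd G" using ij J(3) S(2) by (auto simp: indep_def)
    qed
    then show "c \<in> ?B" using J S by (auto simp: card_image)
  next
    fix c assume "c \<in> ?B"
    then obtain J where J: "J \<subseteq> I" "c = card J" "\<forall>i\<in>J. \<forall>j\<in>J. i \<noteq> j \<longrightarrow> \<omega> i \<noteq> \<omega> j \<and> {\<omega> i, \<omega> j} \<notin> snd G" by auto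
    then have "inj_on \<omega> J" by (auto simp: inj_on_def)
    moreover have "indep (\<omega> ` J) (snd G)" using J(3) by (auto simp: indep_def)
    ultimately show "c \<in> ?A" using J assms by (auto intro!: exI[of _ "\<omega> ` J"] simp: card_image)
  qed
  then show ?thesis unfolding independence_number_def by simp
qed

lemma sets_graph_parameters:
  fixes \<Gamma> :: "(real ^ 2) set \<Rightarrow> (real ^ 2) graph" and I :: "'i set"
  assumes I: "finite I" and fst: "\<And>P. fst (\<Gamma> P) = P"
    and edge: "\<And>i j. i \<in> I \<Longrightarrow> j \<in> I \<Longrightarrow> {\<omega> \<in> space M. {\<omega> i, \<omega> j} \<in> snd (\<Gamma> (\<omega> ` I))} \<in> sets M"
    and eq: "\<And>i j. i \<in> I \<Longrightarrow> j \<in> I \<Longrightarrow> {\<omega> \<in> space M. \<omega> i = \<omega> j} \<in> sets M"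
  shows "{\<omega> \<in> space M. Q (chromatic_number (\<Gamma> (\<omega> ` I))) (independence_number (\<Gamma> (\<omega> ` I)))} \<in> sets M"
proof -
  \<comment> \<open>Index pairs forming an edge, and index pairs with equal points. As
    \<open>rel\<close> has finitely many values and determines both parameters, the event is a
    finite union of its level sets.\<close>
  define rel where "rel = (\<lambda>\<omega>. ({(i, j) \<in> I \<times> I. {\<omega> i, \<omega> j} \<in> snd (\<Gamma> (\<omega> ` I))}, {(i, j) \<in> I \<times> I. \<omega> i = \<omega> j}))"
  define \<chi>' where "\<chi>' = (\<lambda>(A, B :: ('i \<times> 'i) set). LEAST k. \<exists>g \<in> I \<rightarrow> {..<k}. \<forall>i\<in>I. \<forall>j\<in>I. (i, j) \<in> A \<longrightarrow> g i \<noteq> (g j :: nat))"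
  define \<alpha>' where "\<alpha>' = (\<lambda>(A, B). Max {card J | J. J \<subseteq> I \<and> (\<forall>i\<in>J. \<forall>j\<in>J. i \<noteq> j \<longrightarrow> (i, j) \<notin> B \<and> (i, j) \<notin> A)})"
  have \<chi>: "chromatic_number (\<Gamma> (\<omega> ` I)) = \<chi>' (rel \<omega>)" for \<omega>
    unfolding chromatic_number_index[OF fst[of "\<omega> ` I"]] rel_def \<chi>'_def by simp
  have \<alpha>: "independence_number (\<Gamma> (\<omega> ` I)) = \<alpha>' (rel \<omega>)" for \<omega>
  proof -
    have "J \<subseteq> I \<and> (\<forall>i\<in>J. \<forall>j\<in>J. i \<noteq> j \<longrightarrow> \<omega> i \<noteq> \<omega> j \<and> {\<omega> i, \<omega> j} \<notin> snd (\<Gamma> (\<omega> ` I))) \<longleftrightarrow>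
      J \<subseteq> I \<and> (\<forall>i\<in>J. \<forall>j\<in>J. i \<noteq> j \<longrightarrow> (i, j) \<notin> snd (rel \<omega>) \<and> (i, j) \<notin> fst (rel \<omega>))" for J
      unfolding rel_def by auto
    then show ?thesis
      unfolding independence_number_index[OF fst[of "\<omega> ` I"]] \<alpha>'_def case_prod_unfold by (simp only:)
  qed
  let ?F = "{\<rho> \<in> Pow (I \<times> I) \<times> Pow (I \<times> I). Q (\<chi>' \<rho>) (\<alpha>' \<rho>)}"
  have "{\<omega> \<in> space M. Q (chromatic_number (\<Gamma> (\<omega> ` I))) (independence_number (\<Gamma> (\<omega> ` I)))}
      = (\<Union>\<rho>\<in>?F. {\<omega> \<in> space M. rel \<omega> = \<rho>})"
  proof -
    have "rel \<omega> \<in> Pow (I \<times> I) \<times> Pow (I \<times> I)" for \<omega> by (auto simp: rel_def)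
    moreover have "{\<omega> \<in> \<Omega>. R (f \<omega>)} = (\<Union>\<rho>\<in>{\<rho> \<in> F. R \<rho>}. {\<omega> \<in> \<Omega>. f \<omega> = \<rho>})" if "\<And>\<omega>. f \<omega> \<in> F"
      for \<Omega> F R and f :: "('i \<Rightarrow> real ^ 2) \<Rightarrow> ('i \<times> 'i) set \<times> ('i \<times> 'i) set"
      using that by auto
    ultimately show ?thesis unfolding \<chi> \<alpha> by meson
  qed
  also have "\<dots> \<in> sets M"
  proof (rule sets.finite_UN)
    show "finite ?F" using I by simp
    fix \<rho> assume "\<rho> \<in> ?F"
    then obtain A B where \<rho>: "\<rho> = (A, B)" "A \<subseteq> I \<times> I" "B \<subseteq> I \<times> I" by auto
    have "rel \<omega> = (A, B) \<longleftrightarrow> (\<forall>i\<in>I. \<forall>j\<in>I. ({\<omega> i, \<omega> j} \<in> snd (\<Gamma> (\<omega> ` I)) \<longleftrightarrow> (i, j) \<in> A) \<and> (\<omega> i = \<omega> j \<longleftrightarrow> (i, j) \<in> B))" for \<omega>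
    proof -
      have "{(i, j) \<in> I \<times> I. p i j} = C \<longleftrightarrow> (\<forall>i\<in>I. \<forall>j\<in>I. p i j \<longleftrightarrow> (i, j) \<in> C)" if "C \<subseteq> I \<times> I" for p C
      proof
        assume "\<forall>i\<in>I. \<forall>j\<in>I. p i j \<longleftrightarrow> (i, j) \<in> C"
        then show "{(i, j) \<in> I \<times> I. p i j} = C" using that by (intro set_eqI) (clarsimp, blast)
      qed auto
      then show ?thesis using \<rho>(2,3) unfolding rel_def prod.inject by (simp only: ball_conj_distrib)
    qed
    then have "{\<omega> \<in> space M. rel \<omega> = \<rho>}
      = {\<omega> \<in> space M. \<forall>i\<in>I. \<forall>j\<in>I. ({\<omega> i, \<omega> j} \<in> snd (\<Gamma> (\<omega> ` I)) \<longleftrightarrow> (i, j) \<in> A) \<and> (\<omega> i = \<omega> j \<longleftrightarrow> (i, j) \<in> B)}"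
      unfolding \<rho>(1) by simp
    also have "\<dots> \<in> sets M"
    proof (intro sets.sets_Collect_finite_All sets.sets_Collect_conj I)
      have iff: "{\<omega> \<in> space M. P \<omega> \<longleftrightarrow> b} \<in> sets M" if "{\<omega> \<in> space M. P \<omega>} \<in> sets M" for P b
        using that by (cases b) (auto intro: sets.sets_Collect_neg)
      fix i j assume "i \<in> I" "j \<in> I"
      then show "{\<omega> \<in> space M. {\<omega> i, \<omega> j} \<in> snd (\<Gamma> (\<omega> ` I)) \<longleftrightarrow> (i, j) \<in> A} \<in> sets M"
        "{\<omega> \<in> space M. \<omega> i = \<omega> j \<longleftrightarrow> (i, j) \<in> B} \<in> sets M"
        by (intro iff edge eq; simp)+
    qed
    finally show "{\<omega> \<in> space M. rel \<omega> = \<rho>} \<in> sets M" .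
  qed
  finally show ?thesis .
qed


section \<open>Random points and their digits\<close>

text \<open>On the unit interval the cap \<open>M - 1\<close> only matters at z = 1, which would
  otherwise get the digit \<open>M\<close>.\<close>

definition dig :: "nat \<Rightarrow> real \<Rightarrow> nat" where
  "dig M z = nat (min (int M - 1) \<lfloor>real M * z\<rfloor>)"

lemma dig_less: "M > 0 \<Longrightarrow> dig M z < M"
  by (auto simp: dig_def nat_less_iff)

lemma dig_mono: "z \<le> z' \<Longrightarrow> dig M z \<le> dig M z'"
  unfolding dig_def by (intro nat_mono min.mono order.refl floor_mono mult_left_mono) auto

lemma dig_less_imp: "dig M z < dig M z' \<Longrightarrow> z < z'"
  using dig_mono by (meson not_less)

lemma dig_bounds:
  assumes "M > 0" "0 \<le> z" "z \<le> 1"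
  shows "real (dig M z) / M \<le> z" "z \<le> (real (dig M z) + 1) / M"
proof -
  have f0: "0 \<le> \<lfloor>real M * z\<rfloor>" using assms by simp
  have d: "real (dig M z) = min (real M - 1) (of_int \<lfloor>real M * z\<rfloor>)"
    using f0 assms(1) by (auto simp: dig_def min_def)
  have "real M * z \<le> real M" using assms by (simp add: mult_left_le)
  then have "real M * z \<le> real (dig M z) + 1" "real (dig M z) \<le> real M * z"
    unfolding d by (auto simp: min_def) linarith+
  then show "real (dig M z) / M \<le> z" "z \<le> (real (dig M z) + 1) / M"
    using assms(1) by (simp_all add: field_simps)
qed

abbreviation unif :: "(real ^ 2) measure" where
  "unif \<equiv> uniform_measure lborel (cbox 0 1)"

definition grid_cell :: "nat \<Rightarrow> nat \<Rightarrow> nat \<Rightarrow> nat \<Rightarrow> (real ^ 2) set" where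
  "grid_cell M N a b = {z. dig M (z $ 1) = a \<and> dig N (z $ 2) = b}"

lemma measurable_component: "(\<lambda>z :: real ^ 2. z $ i) \<in> borel_measurable borel"
  by (intro borel_measurable_continuous_onI linear_continuous_on bounded_linear_vec_nth)

lemma sets_grid_cell: "grid_cell M N a b \<in> sets borel"
proof -
  have [measurable]: "(\<lambda>z :: real ^ 2. z $ i) \<in> borel_measurable borel" for i
    by (rule measurable_component)
  have "dig M \<in> borel \<rightarrow>\<^sub>M count_space UNIV" for M
    unfolding dig_def by measurable
  then have [measurable]: "(\<lambda>z :: real ^ 2. dig M (z $ i)) \<in> borel \<rightarrow>\<^sub>M count_space UNIV" for M i
    by measurable
  have "{z \<in> space borel. dig M (z $ 1) = a \<and> dig N (z $ 2) = b} \<in> sets (borel :: (real ^ 2) measure)"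
    by measurable
  then show ?thesis by (simp add: grid_cell_def)
qed

section \<open>From uniform points to uniform digits\<close>

lemma measure_unit_square: "measure lborel (cbox 0 1 :: (real ^ 2) set) = 1"
proof -
  have "0 \<in> cbox 0 (1 :: real ^ 2)" by (simp add: mem_box_cart)
  then have "cbox 0 1 \<noteq> ({} :: (real ^ 2) set)" by blast
  then show ?thesis by (simp add: content_cbox_cart)
qed

lemma measure_grid_cell_le:
  assumes "M > 0" "N > 0"
  shows "measure unif (grid_cell M N a b) \<le> 1 / (real M * real N)"
proof -
  let ?p = "vector [real a / M, real b / N] :: real ^ 2"
  let ?q = "vector [(real a + 1) / M, (real b + 1) / N] :: real ^ 2"
  have cell: "cbox 0 1 \<inter> grid_cell M N a b \<subseteq> cbox ?p ?q"
  proof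
    fix z assume z: "z \<in> cbox 0 1 \<inter> grid_cell M N a b"
    then have "0 \<le> z $ i \<and> z $ i \<le> 1" for i by (auto simp: mem_box_cart)
    then show "z \<in> cbox ?p ?q"
      using z dig_bounds[OF assms(1), of "z $ 1"] dig_bounds[OF assms(2), of "z $ 2"]
      by (auto simp: mem_box_cart forall_2 grid_cell_def)
  qed
  have m0: "emeasure lborel (cbox 0 1 :: (real ^ 2) set) \<noteq> 0"
    using measure_unit_square by (auto simp: measure_def)
  have "measure unif (grid_cell M N a b) = measure lborel (cbox 0 1 \<inter> grid_cell M N a b)"
    using sets_grid_cell[of M N a b] measure_unit_square m0
    by (subst measure_uniform_measure) (auto simp: emeasure_lborel_cbox_eq)
  also have "\<dots> \<le> measure lborel (cbox ?p ?q)"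
    using sets_grid_cell[of M N a b] by (intro measure_mono_fmeasurable cell) auto
  also have "\<dots> \<le> 1 / (real M * real N)"
  proof (cases "cbox ?p ?q = {}")
    case False
    then have "measure lborel (cbox ?p ?q) = ((real a + 1) / M - real a / M) * ((real b + 1) / N - real b / N)"
      by (simp add: content_cbox_cart UNIV_2)
    also have "\<dots> = 1 / (real M * real N)" by (simp add: diff_divide_distrib[symmetric])
    finally show ?thesis by simp
  qed simp
  finally show ?thesis .
qed

text \<open>An event about digits is a finite union of products of grid cells, each of probability
  at most \<open>(1 / (real M * real N)) ^ n\<close>, the weight of one outcome in the double
  average. Only upper bounds are transferred, so closed boxes containing the cells are
  enough.\<close>

lemma prob_digits_le:
  fixes n :: nat and \<Phi> :: "(nat \<Rightarrow> nat) \<Rightarrow> (nat \<Rightarrow> nat) \<Rightarrow> bool"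
  assumes "M > 0" "N > 0"
  defines "bad \<equiv> {\<omega> \<in> space (uniform_points n).
      \<Phi> (\<lambda>i\<in>{..<n}. dig M (\<omega> i $ 1)) (\<lambda>i\<in>{..<n}. dig N (\<omega> i $ 2))}"
  shows "bad \<in> sets (uniform_points n)"
    and "measure (uniform_points n) bad \<le> avg {..<n} M (\<lambda>x. avg {..<n} N (\<lambda>y. of_bool (\<Phi> x y)))"
proof -
  define I where "I = {..<n}"
  define F where "F = {(x, y) \<in> PiE I (\<lambda>_. {..<M}) \<times> PiE I (\<lambda>_. {..<N}). \<Phi> x y}"
  define C where "C = (\<lambda>(x, y). PiE I (\<lambda>i. grid_cell M N (x i) (y i)))"
  have prob: "prob_space unif"
    using measure_unit_square by (intro prob_space_uniform_measure) (auto simp: measure_def emeasure_lborel_cbox_eq)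
  interpret finite_product_prob_space "\<lambda>_. unif" I
    using prob by (simp add: finite_product_prob_space_def finite_product_sigma_finite_def product_prob_space_def
        product_sigma_finite_def finite_product_sigma_finite_axioms_def product_prob_space_axioms_def I_def prob_space_imp_sigma_finite)
  have U: "uniform_points n = PiM I (\<lambda>_. unif)" by (simp add: uniform_points_def I_def)
  have finF: "finite F"
    unfolding F_def by (rule finite_subset[of _ "PiE I (\<lambda>_. {..<M}) \<times> PiE I (\<lambda>_. {..<N})"])
      (auto intro!: finite_cartesian_product finite_PiE simp: I_def)
  have sets_C: "C p \<in> sets (uniform_points n)" for p
    unfolding U C_def case_prod_unfold by (intro sets_PiM_I_finite) (auto simp: I_def sets_grid_cell)
  have bad: "bad = (\<Union>p\<in>F. C p)"
  proof (intro equalityI subsetI)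
    fix \<omega> assume \<omega>: "\<omega> \<in> bad"
    define p where "p = ((\<lambda>i\<in>I. dig M (\<omega> i $ 1)), (\<lambda>i\<in>I. dig N (\<omega> i $ 2)))"
    have "p \<in> F" using \<omega> assms(1,2) by (auto simp: F_def p_def bad_def I_def dig_less)
    moreover have "\<omega> \<in> C p" using \<omega> by (auto simp: C_def p_def bad_def U space_PiM grid_cell_def PiE_def)
    ultimately show "\<omega> \<in> (\<Union>p\<in>F. C p)" by auto
  next
    fix \<omega> assume "\<omega> \<in> (\<Union>p\<in>F. C p)"
    then obtain x y where xy: "(x, y) \<in> F" "\<omega> \<in> C (x, y)" by auto
    have "(\<lambda>i\<in>I. dig M (\<omega> i $ 1)) = x" "(\<lambda>i\<in>I. dig N (\<omega> i $ 2)) = y"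
      using xy by (auto simp: F_def C_def grid_cell_def PiE_def extensional_def fun_eq_iff Pi_def)
    moreover have "\<omega> \<in> space (uniform_points n)" using xy(2) sets_C sets.sets_into_space by blast
    ultimately show "\<omega> \<in> bad" using xy by (auto simp: bad_def F_def I_def)
  qed
  then show "bad \<in> sets (uniform_points n)" using finF sets_C by auto
  have "measure (uniform_points n) bad \<le> (\<Sum>p\<in>F. measure (uniform_points n) (C p))"
    unfolding bad using finF sets_C by (intro measure_UNION_le) auto
  also have "\<dots> \<le> (\<Sum>p\<in>F. (1 / (real M * real N)) ^ n)"
  proof (rule sum_mono)
    fix p
    have "measure (uniform_points n) (C p) = (\<Prod>i\<in>I. measure unif (grid_cell M N (fst p i) (snd p i)))"
      unfolding U C_def case_prod_unfold by (rule prob_times) (auto simp: sets_grid_cell)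
    also have "\<dots> \<le> (\<Prod>i\<in>I. 1 / (real M * real N))"
      using assms(1,2) by (intro prod_mono conjI measure_grid_cell_le) auto
    also have "\<dots> = (1 / (real M * real N)) ^ n" by (simp add: I_def)
    finally show "measure (uniform_points n) (C p) \<le> (1 / (real M * real N)) ^ n" .
  qed
  also have "\<dots> = (\<Sum>p\<in>F. 1) * (1 / (real M * real N)) ^ n" by simp
  also have "(\<Sum>p\<in>F. 1) = (\<Sum>p\<in>PiE I (\<lambda>_. {..<M}) \<times> PiE I (\<lambda>_. {..<N}). of_bool (\<Phi> (fst p) (snd p)) :: real)"
  proof -
    have "F = {p \<in> PiE I (\<lambda>_. {..<M}) \<times> PiE I (\<lambda>_. {..<N}). \<Phi> (fst p) (snd p)}"
      unfolding F_def by auto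
    moreover have "finite (PiE I (\<lambda>_. {..<M}) \<times> PiE I (\<lambda>_. {..<N}))"
      by (intro finite_cartesian_product finite_PiE) (auto simp: I_def)
    ultimately show ?thesis by (simp only: sum.inter_filter of_bool_def)
  qed
  also have "\<dots> = (\<Sum>x\<in>PiE I (\<lambda>_. {..<M}). \<Sum>y\<in>PiE I (\<lambda>_. {..<N}). of_bool (\<Phi> x y))"
    by (simp add: sum.cartesian_product case_prod_unfold)
  also have "\<dots> * (1 / (real M * real N)) ^ n = avg I M (\<lambda>x. avg I N (\<lambda>y. of_bool (\<Phi> x y)))"
    by (simp add: avg_def I_def sum_divide_distrib[symmetric] power_divide power_mult_distrib mult.commute)
  finally show "measure (uniform_points n) bad \<le> avg {..<n} M (\<lambda>x. avg {..<n} N (\<lambda>y. of_bool (\<Phi> x y)))"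
    by (simp add: I_def)
qed

section \<open>Union bounds over equal digits, candidate sets and staircases\<close>

lemma avg_of_bool_bex_le:
  assumes "finite J"
  shows "avg I K (\<lambda>x. of_bool (\<exists>j\<in>J. P j x)) \<le> (\<Sum>j\<in>J. avg I K (\<lambda>x. of_bool (P j x)))"
proof -
  have "of_bool (\<exists>j\<in>J. P j x) \<le> (\<Sum>j\<in>J. of_bool (P j x) :: real)" for x
  proof (cases "\<exists>j\<in>J. P j x")
    case True
    then obtain j where j: "j \<in> J" "P j x" by auto
    have "of_bool (P j x) \<le> (\<Sum>j\<in>J. of_bool (P j x) :: real)"
      by (rule member_le_sum[OF j(1)]) (auto simp: assms)
    then show ?thesis using j True by simp
  qed (simp add: sum_nonneg)
  then show ?thesis by (subst avg_sum[symmetric]) (rule avg_mono)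
qed

lemma avg_not_inj_le:
  assumes "finite I" "K > 0"
  shows "avg I K (\<lambda>x. of_bool (\<not> inj_on x I)) \<le> (real (card I))\<^sup>2 / K"
proof -
  define E where "E = {p \<in> I \<times> I. fst p \<noteq> snd p}"
  have finE: "finite E" using assms(1) by (simp add: E_def)
  have "(\<not> inj_on x I) = (\<exists>p\<in>E. x (fst p) = x (snd p))" for x :: "'a \<Rightarrow> nat"
    by (auto simp: inj_on_def E_def)
  then have "avg I K (\<lambda>x. of_bool (\<not> inj_on x I)) \<le> (\<Sum>p\<in>E. avg I K (\<lambda>x. of_bool (x (fst p) = x (snd p))))"
    using avg_of_bool_bex_le[OF finE, of I K "\<lambda>p x. x (fst p) = x (snd p)"] by simp
  also have "\<dots> = (\<Sum>p\<in>E. 1 / K)"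
  proof (rule sum.cong[OF refl])
    fix p assume "p \<in> E"
    then show "avg I K (\<lambda>x. of_bool (x (fst p) = x (snd p))) = 1 / K"
      using assms avg_agree[of I "fst p" "snd p" K "\<lambda>_. 1"] by (auto simp: E_def)
  qed
  also have "\<dots> \<le> (real (card I))\<^sup>2 / K"
  proof -
    have "card E \<le> card (I \<times> I)" by (rule card_mono) (use assms in \<open>auto simp: E_def\<close>)
    then have "real (card E) \<le> real (card I * card I)" by (simp only: card_cartesian_product of_nat_le_iff)
    then show ?thesis by (simp add: power2_eq_square divide_right_mono)
  qed
  finally show ?thesis .
qed

lemma avg_exists_blocked_le:
  assumes "finite I" "M > 0" "k > 0" and n: "card I \<le> m * k" and cells: "\<And>b. b < B \<Longrightarrow> k ^ (2 * b) * k \<le> m"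
  shows "avg I M (\<lambda>x. avg I (k ^ (2 * B)) (\<lambda>y. of_bool (\<not> inj_on x I \<or>
      (\<exists>S\<subseteq>I. card S = m \<and> blocked I x S (\<lambda>_. ()) y))))
    \<le> (real (card I))\<^sup>2 / M + (card I choose m) * exp (- (m / k * (ln k / 1024 - 1))) ^ B"
proof -
  define \<theta> where "\<theta> = exp (- (m / k * (ln k / 1024 - 1))) ^ B"
  let ?S = "{S. S \<subseteq> I \<and> card S = m}"
  have kB: "k ^ (2 * B) > 0" and finS: "finite ?S" using assms by simp_all
  have ex: "(\<exists>S\<subseteq>I. card S = m \<and> blocked I x S (\<lambda>_. ()) y) = (\<exists>S\<in>?S. blocked I x S (\<lambda>_. ()) y)" for x y
    by auto
  have "avg I (k ^ (2 * B)) (\<lambda>y. of_bool (\<not> inj_on x I \<or> (\<exists>S\<in>?S. blocked I x S (\<lambda>_. ()) y)))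
      \<le> of_bool (\<not> inj_on x I) + (card I choose m) * \<theta>" for x :: "'a \<Rightarrow> nat"
  proof (cases "inj_on x I")
    case True
    have "avg I (k ^ (2 * B)) (\<lambda>y. of_bool (\<exists>S\<in>?S. blocked I x S (\<lambda>_. ()) y))
        \<le> (\<Sum>S\<in>?S. avg I (k ^ (2 * B)) (\<lambda>y. of_bool (blocked I x S (\<lambda>_. ()) y)))"
      by (rule avg_of_bool_bex_le[OF finS])
    also have "\<dots> \<le> (\<Sum>S\<in>?S. \<theta>)"
      using avg_blocked_iterate[OF assms(1) True _ assms(3), of _ B] n cells
      by (intro sum_mono) (auto simp: \<theta>_def)
    also have "\<dots> = (card I choose m) * \<theta>" using assms(1) by (simp add: n_subsets)
    finally show ?thesis using True by simp
  next
    case False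
    then show ?thesis using assms(1) kB by (simp add: \<theta>_def)
  qed
  then have "avg I M (\<lambda>x. avg I (k ^ (2 * B)) (\<lambda>y. of_bool (\<not> inj_on x I \<or> (\<exists>S\<in>?S. blocked I x S (\<lambda>_. ()) y))))
      \<le> avg I M (\<lambda>x. of_bool (\<not> inj_on x I) + (card I choose m) * \<theta>)"
    by (rule avg_mono)
  also have "\<dots> = avg I M (\<lambda>x. of_bool (\<not> inj_on x I)) + (card I choose m) * \<theta>"
    using assms by (simp add: avg_add)
  finally show ?thesis using avg_not_inj_le[OF assms(1,2)] unfolding ex by (simp add: \<theta>_def)
qed

lemma avg_exists_stair_le:
  fixes I :: "'a set"
  assumes "finite I" "M > 0" "N > 0"
  shows "avg I M (\<lambda>x. avg I N (\<lambda>y. of_bool (\<not> inj_on x I \<or> \<not> inj_on y I \<or>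
      (\<exists>v\<in>I. \<exists>sx\<in>{1, -1}. \<exists>sy\<in>{1, -1}. t \<le> card (stair I (\<lambda>i. real (x i)) (\<lambda>i. real (y i)) sx sy v)))))
    \<le> (real (card I))\<^sup>2 / M + (real (card I))\<^sup>2 / N + 4 * card I * (1 + card I) / 2 ^ t"
proof -
  let ?s = "{1, -1} :: real set"
  define J where "J = I \<times> ?s \<times> ?s"
  define b where "b = 4 * card I * (1 + card I) / (2 :: real) ^ t"
  define P where "P = (\<lambda>(v, sx, sy) (x :: 'a \<Rightarrow> nat) (y :: 'a \<Rightarrow> nat).
    t \<le> card (stair I (\<lambda>i. real (x i)) (\<lambda>i. real (y i)) sx sy v))"
  have b0: "0 \<le> b" and finJ: "finite J" using assms(1) by (simp_all add: b_def J_def)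
  have cardJ: "real (card J) * ((1 + card I) / 2 ^ t) = b"
    by (simp add: J_def b_def card_cartesian_product algebra_simps)
  have ex: "(\<exists>v\<in>I. \<exists>sx\<in>?s. \<exists>sy\<in>?s. t \<le> card (stair I (\<lambda>i. real (x i)) (\<lambda>i. real (y i)) sx sy v))
      = (\<exists>p\<in>J. P p x y)" for x y
  proof -
    have "(\<exists>a\<in>A. \<exists>b\<in>B. \<exists>c\<in>C. Q a b c) = (\<exists>p\<in>A \<times> B \<times> C. case p of (a, b, c) \<Rightarrow> Q a b c)"
      for A :: "'a set" and B C :: "real set" and Q
      by auto
    then show ?thesis unfolding J_def P_def by (simp only: case_prod_unfold)
  qed
  have "avg I N (\<lambda>y. of_bool (\<not> inj_on x I \<or> \<not> inj_on y I \<or> (\<exists>p\<in>J. P p x y)))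
      \<le> of_bool (\<not> inj_on x I) + ((real (card I))\<^sup>2 / N + b)" for x :: "'a \<Rightarrow> nat"
  proof (cases "inj_on x I")
    case True
    have injr: "inj_on (\<lambda>i. real (x i)) I" using True by (auto simp: inj_on_def)
    have "avg I N (\<lambda>y. of_bool (\<not> inj_on x I \<or> \<not> inj_on y I \<or> (\<exists>p\<in>J. P p x y)))
        \<le> avg I N (\<lambda>y. of_bool (\<not> inj_on y I) + of_bool (\<exists>p\<in>J. P p x y))"
      using True by (intro avg_mono) (auto simp: of_bool_def)
    also have "\<dots> \<le> (real (card I))\<^sup>2 / N + (\<Sum>p\<in>J. avg I N (\<lambda>y. of_bool (P p x y)))"
      unfolding avg_add by (intro add_mono avg_not_inj_le avg_of_bool_bex_le assms finJ)
    also have "(\<Sum>p\<in>J. avg I N (\<lambda>y. of_bool (P p x y))) \<le> (\<Sum>p\<in>J. (1 + card I) / 2 ^ t)"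
    proof (rule sum_mono)
      fix p assume "p \<in> J"
      then obtain v sx sy where p: "p = (v, sx, sy)" "v \<in> I" "sx \<noteq> 0" by (auto simp: J_def)
      show "avg I N (\<lambda>y. of_bool (P p x y)) \<le> (1 + card I) / 2 ^ t"
        unfolding p(1) P_def using avg_card_stair_ge_le[OF assms(1) injr p(2) assms(3) p(3)] by simp
    qed
    finally show ?thesis using True cardJ by simp
  next
    case False
    then show ?thesis using assms b0 by simp
  qed
  then have "avg I M (\<lambda>x. avg I N (\<lambda>y. of_bool (\<not> inj_on x I \<or> \<not> inj_on y I \<or> (\<exists>p\<in>J. P p x y))))
      \<le> avg I M (\<lambda>x. of_bool (\<not> inj_on x I) + ((real (card I))\<^sup>2 / N + b))"
    by (rule avg_mono)
  also have "\<dots> = avg I M (\<lambda>x. of_bool (\<not> inj_on x I)) + ((real (card I))\<^sup>2 / N + b)"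
    using assms by (simp add: avg_add)
  finally show ?thesis using avg_not_inj_le[OF assms(1,2)] unfolding ex by (simp add: b_def)
qed

text \<open>Take a minimal \<open>r\<close> with s < r \<le> p. It covers \<open>s\<close>, so it is
  adjacent to \<open>s\<close> and hence not in \<open>S\<close>; in particular it is not
  \<open>p\<close>.\<close>

lemma hasse_indep_blocked:
  fixes P :: "'a::order set"
  assumes "finite P" "S \<subseteq> P" "indep S (snd (hasse_diagram P))" "s \<in> S" "p \<in> S" "s < p"
  shows "\<exists>q\<in>P - S. s < q \<and> q < p"
proof (rule ccontr)
  assume none: "\<not> ?thesis"
  define A where "A = {r \<in> P. s < r \<and> r \<le> p}"
  have "finite A" "A \<noteq> {}" using assms by (auto simp: A_def)
  then obtain r where r: "r \<in> A" and min: "\<And>b. b \<in> A \<Longrightarrow> b \<le> r \<Longrightarrow> r = b"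
    using finite_has_minimal[of A] by metis
  have "r \<in> S" using r none assms(2,5) by (cases "r = p") (auto simp: A_def)
  moreover have "{s, r} \<in> snd (hasse_diagram P)"
    unfolding edge_hasse_iff
  proof (intro conjI ballI impI)
    fix z assume z: "z \<in> P" "(s \<le> z \<and> z \<le> r) \<or> (r \<le> z \<and> z \<le> s)"
    have "\<not> (r \<le> z \<and> z \<le> s)" using r by (auto simp: A_def)
    then have "s \<le> z" "z \<le> r" using z by auto
    moreover have "r \<le> p" using r by (simp add: A_def)
    ultimately have "z \<noteq> s \<Longrightarrow> z \<in> A" using z(1) by (auto simp: A_def intro: order.trans)
    then show "z = s \<or> z = r" using min[of z] \<open>z \<le> r\<close> by auto
  qed (use r assms in \<open>auto simp: A_def\<close>)
  ultimately show False using assms(3,4) r by (auto simp: indep_def A_def)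
qed


section \<open>Asymptotics\<close>

definition enough_colors :: "nat \<Rightarrow> nat \<Rightarrow> bool" where
  "enough_colors q \<Delta> \<longleftrightarrow> (\<exists>(t :: real) (R :: real) (D :: nat). t \<ge> 4 \<and> 2 * D \<le> t \<and> R > 0 \<and> q > 0 \<and> D > 0 \<and>
     q * exp (- (4 * \<Delta> / q)) - 16 * \<Delta> / D - \<Delta> * (t / R) \<ge> R)"

text \<open>The witnesses are t = \<Delta> powr (1/5), D about t / 2 and R = \<Delta> powr (1/2).
  For q near 40 * \<Delta> / ln \<Delta> the exponential is at least \<Delta> powr (-1/10), which
  leaves 40 * \<Delta> powr (9/10) / ln \<Delta> colours; hubs cost at most 64 * \<Delta> powr (4/5)
  of them and short lists \<Delta> powr (7/10).\<close>

lemma eventually_enough_colors: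
  "\<forall>\<^sub>F \<Delta> :: nat in sequentially. enough_colors (nat \<lceil>40 * real \<Delta> / ln (real \<Delta>)\<rceil>) \<Delta>"
proof -
  have 1: "\<forall>\<^sub>F \<Delta> :: nat in sequentially. real \<Delta> powr (1/5) \<ge> 8" by real_asymp
  have 2: "\<forall>\<^sub>F \<Delta> :: nat in sequentially.
      40 * real \<Delta> powr (9/10) / ln \<Delta> - 64 * real \<Delta> powr (4/5) - real \<Delta> powr (7/10) \<ge> real \<Delta> powr (1/2)"
    by real_asymp
  have 3: "\<forall>\<^sub>F \<Delta> :: nat in sequentially. \<Delta> \<ge> 2" by (rule eventually_ge_at_top)
  from 1 2 3 show ?thesis
  proof eventually_elim
    case (elim \<Delta>)
    define x where "x = real \<Delta>"
    define q where "q = nat \<lceil>40 * x / ln x\<rceil>"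
    define D where "D = nat \<lfloor>x powr (1/5) / 2\<rfloor>"
    have x: "x \<ge> 2" "ln x > 0" using elim(3) by (auto simp: x_def)
    have q: "real q \<ge> 40 * x / ln x" "q > 0"
    proof -
      have pos: "40 * x / ln x > 0" using x by simp
      then show "real q \<ge> 40 * x / ln x" unfolding q_def by linarith
      then show "q > 0" using pos by linarith
    qed
    have D: "real D \<ge> x powr (1/5) / 4" "2 * real D \<le> x powr (1/5)"
      using elim(1) unfolding D_def x_def[symmetric] by linarith+
    have D0: "D > 0" using D elim(1) by (simp add: x_def)
    have main: "40 * x powr (9/10) / ln x \<le> q * exp (- (4 * x / q))"
    proof -
      have "4 * x / q \<le> 4 * x / (40 * x / ln x)"
        using q x by (intro divide_left_mono) (auto intro!: mult_pos_pos)
      also have "\<dots> = ln x / 10" using x by simp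
      finally have "exp (- (ln x / 10)) \<le> exp (- (4 * x / q))" by simp
      then have "(40 * x / ln x) * exp (- (ln x / 10)) \<le> q * exp (- (4 * x / q))"
        using q x by (intro mult_mono) auto
      moreover have "(40 * x / ln x) * exp (- (ln x / 10)) = 40 * x powr (9/10) / ln x"
      proof -
        have e1: "exp (- (ln x / 10)) = x powr (- (1/10))" using x by (simp add: powr_def)
        have e2: "x powr (9/10) = x * x powr (- (1/10))" using x powr_add[of x 1 "- (1/10)"] by simp
        show ?thesis unfolding e1 e2 by simp
      qed
      ultimately show ?thesis by (simp only:)
    qed
    have hub: "16 * x / D \<le> 64 * x powr (4/5)"
    proof -
      have "16 * x / D \<le> 16 * x / (x powr (1/5) / 4)"
        using D D0 x by (intro divide_left_mono) auto
      also have "\<dots> = 64 * (x powr 1 / x powr (1/5))" using x by simp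
      also have "\<dots> = 64 * x powr (4/5)" by (subst powr_diff[symmetric]) simp
      finally show ?thesis .
    qed
    have small: "x * (x powr (1/5) / x powr (1/2)) = x powr (7/10)"
    proof -
      have "x * (x powr (1/5) / x powr (1/2)) = x powr 1 * x powr (1/5 - 1/2)"
        unfolding powr_diff using x by simp
      also have "\<dots> = x powr (1 + (1/5 - 1/2))" by (rule powr_add[symmetric])
      finally show ?thesis by simp
    qed
    have "x powr (1/2) \<le> q * exp (- (4 * x / q)) - 16 * x / D - x * (x powr (1/5) / x powr (1/2))"
      using main hub elim(2) unfolding small x_def[symmetric] by linarith
    note h1 = this
    have h2: "4 \<le> x powr (1/5)" "2 * real D \<le> x powr (1/5)" "0 < x powr (1/2)" "0 < q" "0 < D"
      using elim(1) D(2) x q D0 by (auto simp: x_def)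
    have "enough_colors q \<Delta>"
      unfolding enough_colors_def
    proof (rule exI[of _ "x powr (1/5)"], rule exI[of _ "x powr (1/2)"], rule exI[of _ D])
    qed (use h1 h2 in \<open>simp add: x_def\<close>)
    then show ?case by (simp only: q_def x_def)
  qed
qed

section \<open>The union bound over the candidate sets\<close>

lemma fact_ge_exp: "(real m / exp 1) ^ m \<le> fact m"
proof -
  have s: "(\<lambda>n. real m ^ n / fact n) sums exp (real m)"
    using exp_converges[of "real m"] by (simp add: divide_inverse mult.commute)
  \<comment> \<open>A single term of the exponential series is at most its sum.\<close>
  have "(\<Sum>n\<in>{m}. real m ^ n / fact n) \<le> (\<Sum>n. real m ^ n / fact n)"
    by (rule sum_le_suminf[OF sums_summable[OF s]]) auto
  then have "real m ^ m / fact m \<le> exp (real m)" using sums_unique[OF s] by simp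
  moreover have "exp (real m) = exp 1 ^ m" using exp_of_nat_mult[of m "1 :: real"] by simp
  ultimately show ?thesis by (simp add: power_divide field_simps)
qed

lemma binomial_le_exp:
  assumes "m > 0" "real n \<le> m * z" "z > 0"
  shows "real (n choose m) \<le> exp (m * (1 + ln z))"
proof -
  have "real (n choose m) * (real m / exp 1) ^ m \<le> real (n choose m) * fact m"
    by (intro mult_left_mono fact_ge_exp) auto
  also have "\<dots> = real ((n choose m) * fact m)" by simp
  also have "\<dots> \<le> real (n ^ m)" by (intro of_nat_mono binomial_fact_pow)
  also have "\<dots> \<le> (m * z) ^ m" using assms by (simp add: power_mono)
  also have "\<dots> = (z * exp 1) ^ m * (real m / exp 1) ^ m"
    by (simp add: power_mult_distrib[symmetric] mult.commute)
  finally have "real (n choose m) \<le> (z * exp 1) ^ m" using assms(1) by simp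
  also have "z * exp 1 = exp (1 + ln z)" using assms(3) by (simp add: exp_add)
  also have "exp (1 + ln z) ^ m = exp (m * (1 + ln z))" by (rule exp_of_nat_mult[symmetric])
  finally show ?thesis .
qed

text \<open>There are at most exp (2 * m * l) sets, and each survives all \<open>B\<close> digits
  with probability at most exp (- 4 * m * l). The constant is 65536 = 4 * 8 * 2048: 4 from this
  exponent, 8 from the bound on \<open>B\<close>, and 2048 since ln k \<ge> 2048 makes ln k / 1024 -
  1 at least ln k / 2048.\<close>

lemma union_bound_small:
  fixes n k m B :: nat
  defines "L \<equiv> ln (real n)" and "l \<equiv> ln (ln (real n))"
  assumes "n > 0" "k > 0" "m > 0" and n: "n \<le> m * k" and l: "l \<ge> 1" and kL: "real k * (65536 * l) \<le> L"
    and k: "ln k \<ge> 2048" and B: "B \<ge> L / (8 * ln k)"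
  shows "(n choose m) * exp (- (m / k * (ln k / 1024 - 1))) ^ B \<le> 1 / L"
proof -
  have L: "L > 0" using kL l \<open>k > 0\<close> by (smt (verit) mult_pos_pos of_nat_0_less_iff)
  have lnk: "ln k > 0" using k by simp
  have "real k \<le> L" 
  proof -
    have "real k * 1 \<le> real k * (65536 * l)" using l by (intro mult_left_mono) auto
    then show ?thesis using kL by simp
  qed
  then have lk: "ln k \<le> l" unfolding l_def L_def[symmetric] using \<open>k > 0\<close> L by simp
  have "real (n choose m) \<le> exp (m * (1 + ln k))"
    using n assms by (intro binomial_le_exp) (auto simp flip: of_nat_mult)
  also have "\<dots> \<le> exp (2 * (m * l))"
  proof -
    have "m * (1 + ln k) \<le> m * (l + l)" using lk l by (intro mult_left_mono add_mono) auto
    then show ?thesis by simp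
  qed
  finally have choose: "real (n choose m) \<le> exp (2 * (m * l))" .
  have "4 * (m * l) \<le> B * (m / k * (ln k / 1024 - 1))"
  proof -
    have "4 * (m * l) = m / k * (k * (65536 * l)) / 16384" using \<open>k > 0\<close> by simp
    also have "\<dots> \<le> m / k * L / 16384" using kL by (intro divide_right_mono mult_left_mono) auto
    also have "\<dots> = L / (8 * ln k) * (m / k * (ln k / 2048))"
      using lnk by (simp add: mult.commute)
    also have "\<dots> \<le> B * (m / k * (ln k / 1024 - 1))"
      using B k lnk L by (intro mult_mono mult_left_mono) auto
    finally show ?thesis .
  qed
  then have "exp (- (m / k * (ln k / 1024 - 1))) ^ B \<le> exp (- (4 * (m * l)))"
    by (simp add: exp_of_nat_mult[symmetric])
  then have "(n choose m) * exp (- (m / k * (ln k / 1024 - 1))) ^ B \<le> exp (2 * (m * l)) * exp (- (4 * (m * l)))"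
    using choose by (intro mult_mono) auto
  also have "\<dots> = exp (- (2 * (m * l)))" by (simp add: mult_exp_exp)
  also have "\<dots> \<le> exp (- l)"
  proof -
    have "1 * l \<le> real m * l" using \<open>m > 0\<close> l by (intro mult_right_mono) auto
    then show ?thesis using l by simp
  qed
  also have "\<dots> = 1 / L" using L by (simp add: l_def L_def[symmetric] exp_minus field_simps)
  finally show ?thesis .
qed

text \<open>The deterministic part: \<open>A\<close> and \<open>B\<close> say that the digits avoid
  both bad events. Distinct digits are ordered like the coordinates, so staircases of points are
  staircases of digits. An independent set of size \<open>m\<close> in the Hasse diagram would be
  blocked already for the digits \<open>Y N\<close>, whose resolution \<open>N\<close> may be
  coarse.\<close>

lemma graph_parameters:
  fixes \<omega> :: "nat \<Rightarrow> real ^ 2" and n m t q M N :: nat and \<Gamma> :: "(real ^ 2) set \<Rightarrow> (real ^ 2) graph"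
  defines "I \<equiv> {..<n}"
  defines "X \<equiv> (\<lambda>M. \<lambda>i\<in>I. dig M (\<omega> i $ 1))" and "Y \<equiv> (\<lambda>M. \<lambda>i\<in>I. dig M (\<omega> i $ 2))"
  assumes A: "\<not> (\<not> inj_on (X M) I \<or> (\<exists>S\<subseteq>I. card S = m \<and> blocked I (X M) S (\<lambda>_. ()) (Y N)))"
    and B: "\<not> (\<not> inj_on (X M) I \<or> \<not> inj_on (Y M) I \<or>
      (\<exists>v\<in>I. \<exists>sx\<in>{1, -1}. \<exists>sy\<in>{1, -1}. t \<le> card (stair I (\<lambda>i. real (X M i)) (\<lambda>i. real (Y M i)) sx sy v)))"
    and q: "enough_colors q (4 * t)"
    and \<Gamma>: "\<Gamma> \<in> {box_delaunay_graph, hasse_diagram}"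
  shows "chromatic_number (\<Gamma> (\<omega> ` I)) \<le> q" "independence_number (\<Gamma> (\<omega> ` I)) < m"
    "n \<le> chromatic_number (\<Gamma> (\<omega> ` I)) * independence_number (\<Gamma> (\<omega> ` I))"
proof -
  define P where "P = \<omega> ` I"
  define x :: "real ^ 2 \<Rightarrow> real" where "x = (\<lambda>p. p $ 1)"
  define y :: "real ^ 2 \<Rightarrow> real" where "y = (\<lambda>p. p $ 2)"
  have finI: "finite I" and finP: "finite P" by (auto simp: I_def P_def)
  have injX: "i = j" if "i \<in> I" "j \<in> I" "\<omega> i $ 1 = \<omega> j $ 1" for i j
  proof -
    have "X M i = X M j" using that by (simp add: X_def)
    then show ?thesis using A that by (auto dest: inj_onD)
  qed
  have injY: "i = j" if "i \<in> I" "j \<in> I" "\<omega> i $ 2 = \<omega> j $ 2" for i j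
  proof -
    have "Y M i = Y M j" using that by (simp add: Y_def)
    then show ?thesis using B that by (auto dest: inj_onD)
  qed
  have inj\<omega>: "inj_on \<omega> I" by (rule inj_onI) (auto intro: injX)
  have cardP: "card P = n" using card_image[OF inj\<omega>] by (simp add: P_def I_def)
  have injx: "inj_on x P" by (rule inj_onI) (auto simp: P_def x_def dest: injX)
  have injy: "inj_on y P" by (rule inj_onI) (auto simp: P_def y_def dest: injY)
  have Xless: "X M i < X M j \<longleftrightarrow> \<omega> i $ 1 < \<omega> j $ 1" if "i \<in> I" "j \<in> I" for i j
  proof
    assume "\<omega> i $ 1 < \<omega> j $ 1"
    then have "X M i \<le> X M j" "i \<noteq> j" using that by (auto simp: X_def dig_mono)
    moreover have "X M i \<noteq> X M j" using A that \<open>i \<noteq> j\<close> by (auto dest: inj_onD)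
    ultimately show "X M i < X M j" by simp
  qed (use that dig_less_imp in \<open>auto simp: X_def\<close>)
  have Yless: "Y M i < Y M j \<longleftrightarrow> \<omega> i $ 2 < \<omega> j $ 2" if "i \<in> I" "j \<in> I" for i j
  proof
    assume "\<omega> i $ 2 < \<omega> j $ 2"
    then have "Y M i \<le> Y M j" "i \<noteq> j" using that by (auto simp: Y_def dig_mono)
    moreover have "Y M i \<noteq> Y M j" using B that \<open>i \<noteq> j\<close> by (auto dest: inj_onD)
    ultimately show "Y M i < Y M j" by simp
  qed (use that dig_less_imp in \<open>auto simp: Y_def\<close>)
  have hasse_small: "\<not> indep S (snd (hasse_diagram P))" if S: "S \<subseteq> P" "card S = m" for S
  proof
    assume ind: "indep S (snd (hasse_diagram P))"
    define J where "J = {i \<in> I. \<omega> i \<in> S}"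
    have "\<omega> ` J = S" using S by (auto simp: J_def P_def)
    moreover have "inj_on \<omega> J" by (rule inj_on_subset[OF inj\<omega>]) (auto simp: J_def)
    ultimately have "card J = m" using card_image[of \<omega> J] S(2) by simp
    moreover have "blocked I (X M) J (\<lambda>_. ()) (Y N)"
      unfolding blocked_def
    proof (intro ballI impI)
      fix s p assume sp: "s \<in> J" "p \<in> J" "X M s < X M p" "Y N s < Y N p"
      then have I: "s \<in> I" "p \<in> I" "\<omega> s \<in> S" "\<omega> p \<in> S" by (auto simp: J_def)
      have lt: "\<omega> s $ 1 < \<omega> p $ 1" "\<omega> s $ 2 < \<omega> p $ 2"
        using sp I dig_less_imp by (auto simp: X_def Y_def)
      then have "\<omega> s < \<omega> p" by (auto simp: less_vec_def less_eq_vec_def forall_2)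
      then obtain r where r: "r \<in> P - S" "\<omega> s < r" "r < \<omega> p"
        using hasse_indep_blocked[OF finP S(1) ind I(3,4)] by blast
      then obtain z where z: "z \<in> I" "r = \<omega> z" by (auto simp: P_def)
      have le: "\<omega> s $ i \<le> \<omega> z $ i" "\<omega> z $ i \<le> \<omega> p $ i" for i
        using r z by (auto simp: less_vec_def less_eq_vec_def)
      \<comment> \<open>General position makes the blocking point strict along the first axis; its
        second digit may coincide with that of an end.\<close>
      have "\<omega> s $ 1 \<noteq> \<omega> z $ 1" "\<omega> z $ 1 \<noteq> \<omega> p $ 1" using injX z I r by auto
      then have "\<omega> s $ 1 < \<omega> z $ 1" "\<omega> z $ 1 < \<omega> p $ 1" using le[of 1] by auto
      then have "X M s < X M z" "X M z < X M p" using Xless z I by auto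
      moreover have "Y N s \<le> Y N z" "Y N z \<le> Y N p" using le[of 2] z I by (auto simp: Y_def dig_mono)
      moreover have "z \<in> I - J" using z r by (auto simp: J_def)
      ultimately show "\<exists>q\<in>I - J. X M s < X M q \<and> X M q < X M p \<and> () = () \<and> Y N s \<le> Y N q \<and> Y N q \<le> Y N p"
        by blast
    qed
    moreover have "J \<subseteq> I" by (auto simp: J_def)
    ultimately show False using A by auto
  qed
  have fst\<Gamma>: "fst (\<Gamma> P) = P" using \<Gamma> by auto
  have edges: "{u, v} \<in> snd (hasse_diagram P) \<Longrightarrow> {u, v} \<in> snd (\<Gamma> P)"
    "{u, v} \<in> snd (\<Gamma> P) \<Longrightarrow> {u, v} \<in> snd (box_delaunay_graph P)" for u v
    using \<Gamma> hasse_edge_imp_box_delaunay_edge by auto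
  show "independence_number (\<Gamma> (\<omega> ` I)) < m"
    unfolding P_def[symmetric]
  proof (rule independence_number_lt)
    fix S assume "S \<subseteq> fst (\<Gamma> P)" "card S = m"
    then show "\<not> indep S (snd (\<Gamma> P))"
      using hasse_small[of S] edges(1) unfolding fst\<Gamma> indep_def by blast
  qed (simp add: fst\<Gamma> finP)
  have stair_P: "4 * card (stair P x y sx sy p) \<le> 4 * t" if p: "p \<in> P" and s: "sx \<in> {1, -1}" "sy \<in> {1, -1}" for p sx sy
  proof -
    obtain v where v: "v \<in> I" "p = \<omega> v" using p by (auto simp: P_def)
    have sX: "sx * X M i < sx * X M j \<longleftrightarrow> sx * x (\<omega> i) < sx * x (\<omega> j)" if "i \<in> I" "j \<in> I" for i j
      using s(1) Xless[OF that] Xless[OF that(2,1)] by (auto simp: x_def)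
    have sY: "sy * Y M i < sy * Y M j \<longleftrightarrow> sy * y (\<omega> i) < sy * y (\<omega> j)" if "i \<in> I" "j \<in> I" for i j
      using s(2) Yless[OF that] Yless[OF that(2,1)] by (auto simp: y_def)
    have "stair P x y sx sy p \<subseteq> \<omega> ` stair I (\<lambda>i. real (X M i)) (\<lambda>i. real (Y M i)) sx sy v"
    proof
      fix z assume z: "z \<in> stair P x y sx sy p"
      then obtain w where w: "w \<in> I" "z = \<omega> w" by (auto simp: stair_def P_def)
      have "w \<in> stair I (\<lambda>i. real (X M i)) (\<lambda>i. real (Y M i)) sx sy v"
        using z w v sX sY unfolding stair_def P_def by auto
      then show "z \<in> \<omega> ` stair I (\<lambda>i. real (X M i)) (\<lambda>i. real (Y M i)) sx sy v" using w by blast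
    qed
    moreover have "finite (stair I (\<lambda>i. real (X M i)) (\<lambda>i. real (Y M i)) sx sy v)" using finI by (simp add: stair_def)
    ultimately have "card (stair P x y sx sy p) \<le> card (stair I (\<lambda>i. real (X M i)) (\<lambda>i. real (Y M i)) sx sy v)"
      by (meson card_image_le card_mono finite_imageI le_trans)
    also have "\<dots> \<le> t" using B v s by (meson nat_le_linear)
    finally show ?thesis by simp
  qed
  obtain \<tau> R D where "\<tau> \<ge> 4" "2 * real D \<le> \<tau>" "R > 0" "q > 0" "D > 0"
    "q * exp (- (4 * (4 * t) / q)) - 16 * (4 * t) / D - (4 * t) * (\<tau> / R) \<ge> R"
    using q unfolding enough_colors_def by auto
  then obtain f where f: "f \<in> P \<rightarrow> {..<q}" "\<forall>u\<in>P. \<forall>v\<in>P. empty_box P x y u v \<longrightarrow> f u \<noteq> f v"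
    using box_coloring_exists[OF finP injx injy stair_P, of \<tau> D R q] by auto
  have col: "proper_coloring (\<Gamma> P) f"
    unfolding proper_coloring_def
  proof (intro ballI impI)
    fix u v assume "{u, v} \<in> snd (\<Gamma> P)"
    then have "{u, v} \<in> snd (box_delaunay_graph P)" by (rule edges(2))
    then show "f u \<noteq> f v" using f(2) unfolding edge_box_delaunay_iff x_def[symmetric] y_def[symmetric] by auto
  qed
  have f': "f \<in> fst (\<Gamma> P) \<rightarrow> {..<q}" using f(1) fst\<Gamma> by simp
  show "chromatic_number (\<Gamma> (\<omega> ` I)) \<le> q"
    unfolding P_def[symmetric] by (rule chromatic_number_le[OF f' col])
  show "n \<le> chromatic_number (\<Gamma> (\<omega> ` I)) * independence_number (\<Gamma> (\<omega> ` I))"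
    using card_le_chromatic_times_independence[OF _ f' col] finP cardP fst\<Gamma> unfolding P_def[symmetric] by simp
qed

lemma sets_uniform_points_graph:
  fixes \<Gamma> :: "(real ^ 2) set \<Rightarrow> (real ^ 2) graph" and Q :: "nat \<Rightarrow> nat \<Rightarrow> bool"
  assumes \<Gamma>: "\<Gamma> \<in> {box_delaunay_graph, hasse_diagram}"
  shows "{\<omega> \<in> space (uniform_points n). Q (chromatic_number (\<Gamma> (\<omega> ` {..<n}))) (independence_number (\<Gamma> (\<omega> ` {..<n})))}
    \<in> sets (uniform_points n)"
proof (rule sets_graph_parameters)
  let ?M = "uniform_points n"
  have comp: "(\<lambda>\<omega>. \<omega> i $ c) \<in> borel_measurable ?M" if "i \<in> {..<n}" for i c
  proof -
    have "(\<lambda>\<omega>. \<omega> i) \<in> ?M \<rightarrow>\<^sub>M unif"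
      unfolding uniform_points_def using that by (rule measurable_component_singleton)
    then have "(\<lambda>\<omega>. \<omega> i) \<in> ?M \<rightarrow>\<^sub>M borel" by (simp cong: measurable_cong_sets)
    then show ?thesis using measurable_component by (rule measurable_compose)
  qed
  have le: "{\<omega> \<in> space ?M. \<omega> i $ c \<le> \<omega> j $ c} \<in> sets ?M" if "i \<in> {..<n}" "j \<in> {..<n}" for i j c
    using that by (intro borel_measurable_le comp)
  have eq: "{\<omega> \<in> space ?M. \<omega> i = \<omega> j} \<in> sets ?M" if "i \<in> {..<n}" "j \<in> {..<n}" for i j
  proof -
    have "\<omega> i = \<omega> j \<longleftrightarrow> (\<omega> i $ 1 \<le> \<omega> j $ 1 \<and> \<omega> j $ 1 \<le> \<omega> i $ 1) \<and> (\<omega> i $ 2 \<le> \<omega> j $ 2 \<and> \<omega> j $ 2 \<le> \<omega> i $ 2)" for \<omega> :: "nat \<Rightarrow> real ^ 2"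
      by (auto simp: vec_eq_iff forall_2)
    then show ?thesis using that by (simp only:) (intro sets.sets_Collect_conj le)
  qed
  have vle: "{\<omega> \<in> space ?M. \<omega> i \<le> \<omega> j} \<in> sets ?M" if "i \<in> {..<n}" "j \<in> {..<n}" for i j
    using that unfolding less_eq_vec_def forall_2 by (intro sets.sets_Collect_conj le)
  show "{\<omega> \<in> space ?M. \<omega> i = \<omega> j} \<in> sets ?M" if "i \<in> {..<n}" "j \<in> {..<n}" for i j
    by (rule eq[OF that])
  show "{\<omega> \<in> space ?M. {\<omega> i, \<omega> j} \<in> snd (\<Gamma> (\<omega> ` {..<n}))} \<in> sets ?M" if ij: "i \<in> {..<n}" "j \<in> {..<n}" for i j
  proof (cases "\<Gamma> = box_delaunay_graph")
    case True
    have "{\<omega> i, \<omega> j} \<in> snd (\<Gamma> (\<omega> ` {..<n})) \<longleftrightarrow> \<not> \<omega> i = \<omega> j \<and> (\<forall>r\<in>{..<n}.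
        ((\<omega> i $ 1 \<le> \<omega> r $ 1 \<and> \<omega> r $ 1 \<le> \<omega> j $ 1) \<or> (\<omega> j $ 1 \<le> \<omega> r $ 1 \<and> \<omega> r $ 1 \<le> \<omega> i $ 1)) \<longrightarrow>
        ((\<omega> i $ 2 \<le> \<omega> r $ 2 \<and> \<omega> r $ 2 \<le> \<omega> j $ 2) \<or> (\<omega> j $ 2 \<le> \<omega> r $ 2 \<and> \<omega> r $ 2 \<le> \<omega> i $ 2)) \<longrightarrow>
        \<omega> r = \<omega> i \<or> \<omega> r = \<omega> j)" for \<omega>
      using ij unfolding True edge_box_delaunay_iff empty_box_def mid_def by auto
    then show ?thesis using ij
      by (simp only:) (intro sets.sets_Collect_conj sets.sets_Collect_neg sets.sets_Collect_finite_All
          sets.sets_Collect_imp sets.sets_Collect_disj le eq; simp)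
  next
    case False
    then have H: "\<Gamma> = hasse_diagram" using \<Gamma> by auto
    have "{\<omega> i, \<omega> j} \<in> snd (\<Gamma> (\<omega> ` {..<n})) \<longleftrightarrow> \<not> \<omega> i = \<omega> j \<and> (\<omega> i \<le> \<omega> j \<or> \<omega> j \<le> \<omega> i) \<and> (\<forall>r\<in>{..<n}.
        ((\<omega> i \<le> \<omega> r \<and> \<omega> r \<le> \<omega> j) \<or> (\<omega> j \<le> \<omega> r \<and> \<omega> r \<le> \<omega> i)) \<longrightarrow> \<omega> r = \<omega> i \<or> \<omega> r = \<omega> j)" for \<omega>
      using ij unfolding H edge_hasse_iff by auto
    then show ?thesis using ij
      by (simp only:) (intro sets.sets_Collect_conj sets.sets_Collect_neg sets.sets_Collect_finite_All
          sets.sets_Collect_imp sets.sets_Collect_disj vle eq; simp)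
  qed
qed (use \<Gamma> in auto)

section \<open>Choice of the parameters\<close>

definition good_params :: "nat \<Rightarrow> nat \<Rightarrow> nat \<Rightarrow> nat \<Rightarrow> nat \<Rightarrow> nat \<Rightarrow> bool" where
  "good_params n k m B t q \<longleftrightarrow> n > 0 \<and> k > 0 \<and> m > 0 \<and> n \<le> m * k \<and> 1 \<le> ln (ln n) \<and>
     k * (65536 * ln (ln n)) \<le> ln n \<and> 2048 \<le> ln k \<and> ln n / (8 * ln k) \<le> B \<and>
     (\<forall>b<B. k ^ (2 * b) * k \<le> m) \<and> m \<le> 200000 * n * ln (ln n) / ln n \<and>
     real n ^ 3 \<le> 2 ^ t \<and> enough_colors q (4 * t) \<and> q \<le> 200000 * ln n / ln (ln n)"

text \<open>\<open>B\<close> digits in base \<open>k * k\<close> with B \<le> L / (4 * ln k) create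
  at most sqrt n cells, so that even the last digit finds \<open>k\<close> points of
  \<open>S\<close> per cell on average. The constant 200000 covers 2 * 65536, from rounding
  \<open>k\<close> down, plus 1 from rounding \<open>m\<close> up.\<close>

lemma good_params_set_partition:
  fixes L l :: real and n k m B :: nat
  assumes L: "L = ln (real n)" and l: "l = ln L" and "n > 0" and l1: "1 \<le> l" and L8: "8 * l \<le> L"
    and big: "exp 2048 + 1 \<le> L / (65536 * l)" and one: "1 \<le> n * l / L"
    and k: "k = nat \<lfloor>L / (65536 * l)\<rfloor>" and m: "m = nat \<lceil>n / k\<rceil>" and B: "B = nat \<lfloor>L / (4 * ln k)\<rfloor>"
  shows "k > 0" "m > 0" "n \<le> m * k" "k * (65536 * l) \<le> L" "2048 \<le> ln k" "L / (8 * ln k) \<le> B"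
    "\<And>b. b < B \<Longrightarrow> k ^ (2 * b) * k \<le> m" "m \<le> 200000 * n * l / L"
proof -
  have Lpos: "L > 0" using l1 L8 by linarith
  have e0: "(0::real) < exp 2048" by simp
  have kle: "real k \<le> L / (65536 * l)" and kge: "L / (65536 * l) - 1 \<le> k"
    unfolding k using big e0 by linarith+
  have kexp: "exp 2048 \<le> real k" using kge big by linarith
  then show k0: "k > 0" using e0 by linarith
  show k1: "k * (65536 * l) \<le> L" using kle l1 by (simp add: field_simps)
  have "ln (exp 2048) \<le> ln (real k)" using kexp e0 k0 by (subst ln_le_cancel_iff) auto
  then show lnk: "2048 \<le> ln k" by simp
  have "real k * 1 \<le> real k * (65536 * l)" using l1 by (intro mult_left_mono) auto
  then have "real k \<le> L" using k1 by simp
  then have lk: "ln k \<le> l" unfolding l using k0 Lpos by simp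
  have mge: "n / k \<le> real m" unfolding m by linarith
  have mle: "real m \<le> n / k + 1"
  proof -
    have "0 \<le> n / real k" by simp
    then show ?thesis unfolding m by linarith
  qed
  have "0 < n / real k" using \<open>n > 0\<close> k0 by simp
  then show "m > 0" using mge by linarith
  have "real n \<le> real m * real k" using mge k0 by (simp add: field_simps)
  then have nmk': "real n \<le> real (m * k)" by simp
  then show nmk: "n \<le> m * k" by (simp only: of_nat_le_iff)
  have B1: "L / (4 * ln k) - 1 \<le> B" unfolding B by linarith
  have B2: "real B \<le> L / (4 * ln k)" using Lpos lnk unfolding B by (intro of_nat_floor) auto
  have "1 \<le> L / (8 * ln k)" using L8 lk lnk by (simp add: field_simps)
  moreover have "L / (4 * ln k) = L / (8 * ln k) + L / (8 * ln k)" by (simp add: field_simps)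
  ultimately show "L / (8 * ln k) \<le> B" using B1 by linarith
  show "k ^ (2 * b) * k \<le> m" if b: "b < B" for b
  proof -
    have "real b + 1 \<le> L / (4 * ln k)" using b B2 by linarith
    then have "(real b + 1) * (4 * ln k) \<le> L" using lnk by (simp add: field_simps)
    moreover have "real (2 * b + 1) * ln k + ln k + (2 * (real b * ln k) + 2 * ln k) = (real b + 1) * (4 * ln k)"
      by (simp add: algebra_simps)
    moreover have "0 \<le> 2 * (real b * ln k) + 2 * ln k" using lnk by simp
    ultimately have e: "real (2 * b + 1) * ln k + ln k \<le> L" by linarith
    have "real (k ^ (2 * b) * k) * k = exp (real (2 * b + 1) * ln k) * exp (ln k)"
      using k0 unfolding exp_of_nat_mult by simp
    also have "\<dots> = exp (real (2 * b + 1) * ln k + ln k)" by (rule exp_add[symmetric])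
    also have "\<dots> \<le> exp L" using e by simp
    also have "\<dots> = n" using L \<open>n > 0\<close> by simp
    also have "\<dots> \<le> real m * real k" using nmk' by simp
    finally have "real (k ^ (2 * b) * k) \<le> real m" using k0 by simp
    then show ?thesis by (simp only: of_nat_le_iff)
  qed
  show "m \<le> 200000 * n * l / L"
  proof -
    have "1 \<le> exp (2048 :: real)" by simp
    moreover have "z / 2 \<le> r" if "z - 1 \<le> r" "e + 1 \<le> z" "1 \<le> e" for z r e :: real
      using that by linarith
    ultimately have "L / (65536 * l) / 2 \<le> k" using kge big by blast
    then have "n / k \<le> n / (L / (65536 * l) / 2)"
      using Lpos l1 k0 by (intro divide_left_mono mult_pos_pos) auto
    also have "\<dots> = 131072 * (n * l / L)" by simp
    finally have "m \<le> 131072 * (n * l / L) + n * l / L" using mle one by linarith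
    also have "\<dots> \<le> 200000 * (n * l / L)"
    proof -
      have "131072 * z + z \<le> 200000 * z" if "1 \<le> z" for z :: real using that by linarith
      then show ?thesis using one by blast
    qed
    finally show ?thesis by simp
  qed
qed

text \<open>\<open>t\<close> is chosen so that 2 ^ t \<ge> n ^ 3 beats the 4 * n staircases, each of
  size at least \<open>t\<close> with probability at most (1 + n) / 2 ^ t. Then the degree bound 4 *
  t is at most 24 * L, and q is at most 41 * 24 * L / l, where 41 includes rounding.\<close>

lemma good_params_set_colors:
  fixes L l :: real and n t q :: nat
  assumes L: "L = ln (real n)" and l: "l = ln L" and "n > 0" and l1: "1 \<le> l" and L1: "1 \<le> L"
    and t: "t = nat \<lceil>3 * log 2 n\<rceil>" and q: "q = nat \<lceil>40 * real (4 * t) / ln (real (4 * t))\<rceil>"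
  shows "real n ^ 3 \<le> 2 ^ t" "L \<le> 4 * t" "q \<le> 200000 * L / l"
proof -
  have ln2: "3 / 5 \<le> ln (2 :: real)" "ln (2 :: real) \<le> 1"
    using ln2_ge_two_thirds ln2_le_25_over_36 by linarith+
  have lg: "log 2 n = L / ln 2" by (simp add: log_def L)
  have tge: "3 * log 2 n \<le> t" unfolding t by linarith
  have "0 \<le> 3 * log 2 n" unfolding lg using L1 ln2 by simp
  then have tle: "real t \<le> 3 * log 2 n + 1" unfolding t by linarith
  have "real n ^ 3 = (2 powr log 2 n) powr 3" using \<open>n > 0\<close> by (simp add: powr_numeral)
  also have "\<dots> = 2 powr (3 * log 2 n)" by (simp add: powr_powr mult.commute)
  also have "\<dots> \<le> 2 powr t" using tge by simp
  also have "\<dots> = 2 ^ t" by (simp add: powr_realpow)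
  finally show "real n ^ 3 \<le> 2 ^ t" .
  have "L * 1 \<le> L / ln 2" using ln2 L1 by (simp add: field_simps)
  then show D: "L \<le> 4 * t" using tge L1 unfolding lg by simp
  have "L / ln 2 \<le> L / (3 / 5)" using ln2 L1 by (intro divide_left_mono) auto
  then have "L / ln 2 \<le> 5 / 3 * L" by simp
  moreover have "real t \<le> 6 * L" if "real t \<le> 3 * w + 1" "w \<le> 5 / 3 * L" for w
    using that L1 by linarith
  ultimately have "real t \<le> 6 * L" using tle[unfolded lg] by blast
  then have Dle: "real (4 * t) \<le> 24 * L" by simp
  define x where "x = real (4 * t)"
  have x: "L \<le> x" "x \<le> 24 * L" "x > 0" using D Dle L1 by (auto simp: x_def)
  have lnx: "l \<le> ln x" unfolding l using x L1 by simp
  then have lnx0: "ln x > 0" using l1 by linarith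
  have "ln x \<le> x" using x ln_le_minus_one[of x] by linarith
  then have "1 \<le> x / ln x" using lnx0 by simp
  then have "real q \<le> 41 * (x / ln x)" unfolding q x_def[symmetric] by linarith
  also have "\<dots> \<le> 41 * (24 * L / l)" using x lnx lnx0 l1 L1 by (intro mult_left_mono frac_le) auto
  also have "\<dots> = 984 * (L / l)" by simp
  also have "\<dots> \<le> 200000 * (L / l)" using L1 l1 by (intro mult_right_mono) auto
  finally show "q \<le> 200000 * L / l" by simp
qed

lemma eventually_good_params:
  "\<forall>\<^sub>F n :: nat in sequentially. \<exists>k m B t q. good_params n k m B t q"
proof -
  obtain N0 where N0: "\<And>\<Delta>. \<Delta> \<ge> N0 \<Longrightarrow> enough_colors (nat \<lceil>40 * real \<Delta> / ln (real \<Delta>)\<rceil>) \<Delta>"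
    using eventually_enough_colors unfolding eventually_sequentially by blast
  have "filterlim (\<lambda>n :: nat. ln n / (65536 * ln (ln n))) at_top sequentially" by real_asymp
  then have 1: "\<forall>\<^sub>F n :: nat in sequentially. exp 2048 + 1 \<le> ln n / (65536 * ln (ln n))"
    unfolding filterlim_at_top by blast
  have "filterlim (\<lambda>n :: nat. ln n) at_top sequentially" by real_asymp
  then have 2: "\<forall>\<^sub>F n :: nat in sequentially. real N0 + 1 \<le> ln n"
    unfolding filterlim_at_top by blast
  have 3: "\<forall>\<^sub>F n :: nat in sequentially. 1 \<le> ln (ln n)" by real_asymp
  have 4: "\<forall>\<^sub>F n :: nat in sequentially. 8 * ln (ln n) \<le> ln n" by real_asymp
  have 5: "\<forall>\<^sub>F n :: nat in sequentially. 1 \<le> n * ln (ln n) / ln n" by real_asymp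
  have 6: "\<forall>\<^sub>F n :: nat in sequentially. n > 0" by (rule eventually_gt_at_top)
  from 1 2 3 4 5 6 show ?thesis
  proof eventually_elim
    case (elim n)
    define L where "L = ln (real n)"
    define l where "l = ln L"
    define k where "k = nat \<lfloor>L / (65536 * l)\<rfloor>"
    define m where "m = nat \<lceil>n / k\<rceil>"
    define B where "B = nat \<lfloor>L / (4 * ln k)\<rfloor>"
    define t where "t = nat \<lceil>3 * log 2 n\<rceil>"
    define q where "q = nat \<lceil>40 * real (4 * t) / ln (real (4 * t))\<rceil>"
    have h: "exp 2048 + 1 \<le> L / (65536 * l)" "real N0 + 1 \<le> L" "1 \<le> l" "8 * l \<le> L" "1 \<le> n * l / L" "n > 0" "1 \<le> L"
      using elim by (simp_all add: L_def l_def)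
    note p = good_params_set_partition[OF L_def l_def h(6,3,4,1,5) k_def m_def B_def]
    note c = good_params_set_colors[OF L_def l_def h(6,3,7) t_def q_def]
    have "N0 \<le> 4 * t" using c(2) h(2) by linarith
    then have "enough_colors q (4 * t)" unfolding q_def by (rule N0)
    then have "good_params n k m B t q"
      unfolding good_params_def using p c h unfolding l_def L_def by blast
    then show ?case by blast
  qed
qed

text \<open>The loss 1 / ln n is the union bound over candidate sets; 11 / n collects three times 1
  / n for equal digits and 8 / n for long staircases.\<close>

lemma prob_good_event_ge:
  fixes \<Gamma> :: "(real ^ 2) set \<Rightarrow> (real ^ 2) graph"
  assumes par: "good_params n k m B t q" and \<Gamma>: "\<Gamma> \<in> {box_delaunay_graph, hasse_diagram}"
  defines "c \<equiv> 1 / 200000" and "C \<equiv> 200000"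
  defines "E \<equiv> {\<omega> \<in> space (uniform_points n). let G = \<Gamma> (\<omega> ` {..<n}) in
            c * ln (real n) / ln (ln (real n)) \<le> real (chromatic_number G) \<and>
            real (chromatic_number G) \<le> C * ln (real n) / ln (ln (real n)) \<and>
            c * real n * ln (ln (real n)) / ln (real n) \<le> real (independence_number G) \<and>
            real (independence_number G) \<le> C * real n * ln (ln (real n)) / ln (real n)}"
  shows "1 - (1 / ln n + 11 / n) \<le> measure (uniform_points n) E"
proof -
  interpret prob_space "uniform_points n" by (rule prob_space_uniform_points)
  define I where "I = {..<n}"
  \<comment> \<open>Some two of the \<open>n\<close> points share a digit with probability at most n
    ^ 2 / M = 1 / n.\<close>
  define M where "M = n ^ 3"
  define l where "l = ln (ln (real n))"
  define L where "L = ln (real n)"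
  have p: "n > 0" "k > 0" "m > 0" "n \<le> m * k" "1 \<le> l" "k * (65536 * l) \<le> L" "2048 \<le> ln k"
    "L / (8 * ln k) \<le> B" "\<And>b. b < B \<Longrightarrow> k ^ (2 * b) * k \<le> m" "m \<le> C * n * l / L"
    "real n ^ 3 \<le> 2 ^ t" "enough_colors q (4 * t)" "q \<le> C * L / l"
    using par unfolding good_params_def l_def L_def C_def by auto
  have L0: "L > 0"
  proof -
    have "0 < real k * (65536 * l)" using p(2,5) by simp
    then show ?thesis using p(6) by linarith
  qed
  have l0: "l > 0" using p(5) by linarith
  have M0: "M > 0" "k ^ (2 * B) > 0" using p(1,2) by (auto simp: M_def)
  define \<Phi>1 where "\<Phi>1 = (\<lambda>x y. \<not> inj_on x I \<or> (\<exists>S\<subseteq>I. card S = m \<and> blocked I x S (\<lambda>_. ()) y))"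
  define \<Phi>2 where "\<Phi>2 = (\<lambda>x y. \<not> inj_on x I \<or> \<not> inj_on y I \<or>
      (\<exists>v\<in>I. \<exists>sx\<in>{1, -1}. \<exists>sy\<in>{1, -1}. t \<le> card (stair I (\<lambda>i. real (x i)) (\<lambda>i. real (y i)) sx sy v)))"
  define bad where "bad = (\<lambda>\<Phi> N. {\<omega> \<in> space (uniform_points n).
      \<Phi> (\<lambda>i\<in>{..<n}. dig M (\<omega> i $ 1)) (\<lambda>i\<in>{..<n}. dig N (\<omega> i $ 2))} :: (nat \<Rightarrow> real ^ 2) set)"
  have bad_sets: "bad \<Phi> N \<in> events" if "N > 0" for \<Phi> N
    unfolding bad_def by (rule prob_digits_le(1)[OF M0(1) that])
  have tie: "(real n)\<^sup>2 / real M = 1 / n" by (simp add: M_def power2_eq_square power3_eq_cube)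
  have bad1: "prob (bad \<Phi>1 (k ^ (2 * B))) \<le> 1 / n + 1 / L"
  proof -
    have "prob (bad \<Phi>1 (k ^ (2 * B))) \<le> avg I M (\<lambda>x. avg I (k ^ (2 * B)) (\<lambda>y. of_bool (\<Phi>1 x y)))"
      unfolding bad_def I_def by (rule prob_digits_le(2)[OF M0])
    also have "\<dots> \<le> (real (card I))\<^sup>2 / M + (card I choose m) * exp (- (m / k * (ln k / 1024 - 1))) ^ B"
      unfolding \<Phi>1_def by (rule avg_exists_blocked_le) (use p M0 in \<open>auto simp: I_def\<close>)
    also have "(card I choose m) * exp (- (m / k * (ln k / 1024 - 1))) ^ B \<le> 1 / L"
      unfolding L_def using p unfolding L_def l_def
      by (simp only: I_def card_lessThan) (intro union_bound_small)
    finally show ?thesis using tie by (simp add: I_def)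
  qed
  have bad2: "prob (bad \<Phi>2 M) \<le> 10 / n"
  proof -
    have "prob (bad \<Phi>2 M) \<le> avg I M (\<lambda>x. avg I M (\<lambda>y. of_bool (\<Phi>2 x y)))"
      unfolding bad_def I_def by (rule prob_digits_le(2)[OF M0(1) M0(1)])
    also have "\<dots> \<le> (real (card I))\<^sup>2 / M + (real (card I))\<^sup>2 / M + 4 * card I * (1 + card I) / 2 ^ t"
      unfolding \<Phi>2_def by (rule avg_exists_stair_le) (use M0 in \<open>auto simp: I_def\<close>)
    also have "\<dots> = 2 / n + 4 * n * (1 + n) / 2 ^ t" using tie by (simp add: I_def)
    also have "4 * n * (1 + n) / 2 ^ t \<le> (4 * n * (n + n)) / real n ^ 3"
    proof (rule frac_le)
      have "4 * n * (1 + n) \<le> 4 * n * (n + n)" using p(1) by (intro mult_left_mono add_right_mono) auto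
      then show "real (4 * n * (1 + n)) \<le> real (4 * n * (n + n))" by (rule of_nat_mono)
    qed (use p(1,11) in auto)
    also have "(4 * n * (n + n)) / real n ^ 3 = 8 / n" using p(1) by (simp add: power3_eq_cube)
    finally show ?thesis by simp
  qed
  have E_sets: "E \<in> events"
    unfolding E_def Let_def by (rule sets_uniform_points_graph[OF \<Gamma>])
  have good: "space (uniform_points n) - (bad \<Phi>1 (k ^ (2 * B)) \<union> bad \<Phi>2 M) \<subseteq> E"
  proof
    fix \<omega> assume \<omega>: "\<omega> \<in> space (uniform_points n) - (bad \<Phi>1 (k ^ (2 * B)) \<union> bad \<Phi>2 M)"
    let ?G = "\<Gamma> (\<omega> ` {..<n})"
    have *: "chromatic_number ?G \<le> q" "independence_number ?G < m" "n \<le> chromatic_number ?G * independence_number ?G"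
      using \<omega> graph_parameters[where \<omega> = \<omega> and n = n and m = m and M = M and N = "k ^ (2 * B)", OF _ _ p(12) \<Gamma>]
      unfolding bad_def \<Phi>1_def \<Phi>2_def I_def by auto
    define a where "a = real (chromatic_number ?G)"
    define b where "b = real (independence_number ?G)"
    have le: "a \<le> q" "b \<le> m" "n \<le> a * b"
      using * by (auto simp: a_def b_def simp flip: of_nat_mult)
    have upper: "a \<le> C * L / l" "b \<le> C * n * l / L" using le p(10,13) by linarith+
    have nn: "0 \<le> a" "0 \<le> b" by (auto simp: a_def b_def)
    \<comment> \<open>Each lower bound follows from n \<le> a * b and the upper bound on the other
      parameter; hence c = 1 / C.\<close>
    have "n \<le> a * (C * n * l / L)" using le(3) mult_left_mono[OF upper(2) nn(1)] by linarith
    then have "c * L / l \<le> a" using p(1) l0 L0 by (simp add: c_def C_def field_simps)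
    moreover have "n \<le> (C * L / l) * b" using le(3) mult_right_mono[OF upper(1) nn(2)] by linarith
    then have "c * n * l / L \<le> b" using p(1) l0 L0 by (simp add: c_def C_def field_simps)
    ultimately show "\<omega> \<in> E"
      using \<omega> upper unfolding E_def Let_def a_def b_def L_def l_def by auto
  qed
  have "1 - prob (bad \<Phi>1 (k ^ (2 * B)) \<union> bad \<Phi>2 M) = prob (space (uniform_points n) - (bad \<Phi>1 (k ^ (2 * B)) \<union> bad \<Phi>2 M))"
    by (rule prob_compl[symmetric]) (intro sets.Un bad_sets M0)
  also have "\<dots> \<le> prob E" by (rule finite_measure_mono[OF good E_sets])
  finally have "1 - prob (bad \<Phi>1 (k ^ (2 * B)) \<union> bad \<Phi>2 M) \<le> prob E" .
  moreover have "prob (bad \<Phi>1 (k ^ (2 * B)) \<union> bad \<Phi>2 M) \<le> prob (bad \<Phi>1 (k ^ (2 * B))) + prob (bad \<Phi>2 M)"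
    by (intro measure_Un_le bad_sets M0)
  ultimately show ?thesis using bad1 bad2 by (simp add: L_def)
qed

theorem theorem1p1:
  shows "\<exists>(c :: real) (C :: real). c > 0 \<and> C > 0 \<and>
    (\<forall>\<Gamma> \<in> {box_delaunay_graph, hasse_diagram :: (real ^ 2) set \<Rightarrow> (real ^ 2) graph}.
      (\<lambda>n. \<P>(\<omega> in uniform_points n.
          let G = \<Gamma> (\<omega> ` {..<n}) in
            c * ln (real n) / ln (ln (real n)) \<le> real (chromatic_number G) \<and>
            real (chromatic_number G) \<le> C * ln (real n) / ln (ln (real n)) \<and>
            c * real n * ln (ln (real n)) / ln (real n) \<le> real (independence_number G) \<and>
            real (independence_number G) \<le> C * real n * ln (ln (real n)) / ln (real n)))
        \<longlonglongrightarrow> 1)"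
proof (rule exI[of _ "1 / 200000"], rule exI[of _ 200000], intro conjI ballI)
  fix \<Gamma> :: "(real ^ 2) set \<Rightarrow> (real ^ 2) graph"
  assume \<Gamma>: "\<Gamma> \<in> {box_delaunay_graph, hasse_diagram}"
  have lim: "(\<lambda>n :: nat. 1 - (1 / ln n + 11 / n)) \<longlonglongrightarrow> 1" by real_asymp
  show "(\<lambda>n. \<P>(\<omega> in uniform_points n.
          let G = \<Gamma> (\<omega> ` {..<n}) in
            (1 / 200000) * ln (real n) / ln (ln (real n)) \<le> real (chromatic_number G) \<and>
            real (chromatic_number G) \<le> 200000 * ln (real n) / ln (ln (real n)) \<and>
            (1 / 200000) * real n * ln (ln (real n)) / ln (real n) \<le> real (independence_number G) \<and>
            real (independence_number G) \<le> 200000 * real n * ln (ln (real n)) / ln (real n))) \<longlonglongrightarrow> 1"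
    (is "?p \<longlonglongrightarrow> 1")
  proof (rule tendsto_sandwich[OF _ _ lim tendsto_const])
    show "\<forall>\<^sub>F n in sequentially. 1 - (1 / ln (real n) + 11 / real n) \<le> ?p n"
      using eventually_good_params
    proof eventually_elim
      case (elim n)
      then obtain k m B t q where "good_params n k m B t q" by blast
      from prob_good_event_ge[OF this \<Gamma>] show ?case by simp
    qed
    show "\<forall>\<^sub>F n in sequentially. ?p n \<le> 1"
      using prob_space.prob_le_1[OF prob_space_uniform_points] by (intro always_eventually allI)
  qed
qed auto

end
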